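(* Let $X$ be a random vector in $\mathbb{R}^d$ with density $p$ with respect to Lebesgue measure. Suppose that $Q_{p,p}(\varepsilon,R)<\infty$ and $T_{p,p}(\varepsilon,R)<\infty$ for some positive $\varepsilon$ and $R$. Then the following statements hold for any fixed $k\in\mathbb{N}$. 1) If $K_{p,p}(1,N)<\infty$ for some $N\in\mathbb{N}$, then $\mathsf{E}\,\widehat{H}_n(k)\to H(X)$ as $n\to\infty$. 2) If $K_{p,p}(2,N)<\infty$ for some $N\in\mathbb{N}$, then $\mathsf{E}\,(\widehat{H}_n(k)-H(X))^2\to0$ as $n\to\infty$. In particular, the hypothesis $K_{p,p}(1,N)<\infty$ in 1) may be replaced by $L_{p,p}(\nu)<\infty$ for some $\nu>1$, and the hypothesis $K_{p,p}(2,N)<\infty$ in 2) may be replaced by $L_{p,p}(\nu)<\infty$ for some $\nu>2$.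
   Context: Shannon differential entropy: $H(X)=-\int_{\mathbb{R}^d}p(x)\log p(x)\,dx$ (natural logarithm, $0\cdot\log0:=0$). Estimator (Kozachenko-Leonenko): $X_1,X_2,\ldots$ are i.i.d. with the law of $X$; $\|\cdot\|$ is the Euclidean norm; for $n\ge k+1$ and $i=1,\ldots,n$, $R_{n,k}(i)$ is the distance from $X_i$ to its $k$-th nearest neighbor in $\{X_1,\ldots,X_n\}\setminus\{X_i\}$ (almost surely the points are distinct; ties broken by increasing index). Put $$\widehat{H}_n(k)=\frac1n\sum_{i=1}^n\log\left(\frac{R_{n,k}^d(i)\,V_d\,(n-1)}{e^{\psi(k)}}\right),$$ where $V_d$ is the volume of the unit ball in $\mathbb{R}^d$ and $\psi(t)=\Gamma'(t)/\Gamma(t)$ is the digamma function. Functionals: let $e_{[0]}=1$, $e_{[N]}=\exp\{e_{[N-1]}\}$, $\log_{[1]}(t)=\log t$, $\log_{[N]}(t)=\log(\log_{[N-1]}(t))$ for $N>1$ and $t>e_{[N-2]}$. Let $G_N:\mathbb{R}_+\to\mathbb{R}_+$, $G_N(t)=0$ for $t\in[0,e_{[N-1]}]$ and $G_N(t)=t\log_{[N]}(t)$ for $t>e_{[N-1]}$. Let $B(x,r)=\{y:\|x-y\|\le r\}$, $I_p(x,r)=\frac{1}{r^dV_d}\int_{B(x,r)}p(y)\,dy$, $M_p(x,R)=\sup_{r\in(0,R]}I_p(x,r)$, $m_p(x,R)=\inf_{r\in(0,R]}I_p(x,r)$. For $\nu,\varepsilon,R>0$ and $N\in\mathbb{N}$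 define, with values in $[0,\infty]$ and $1/0:=\infty$, $$K_{p,p}(\nu,N)=\iint_{\|x-y\|>e_{[N]}}G_N\big(|\log\|x-y\||^{\nu}\big)p(x)p(y)\,dx\,dy,$$ $$Q_{p,p}(\varepsilon,R)=\int_{\mathbb{R}^d}M_p(x,R)^{\varepsilon}p(x)\,dx,\qquad T_{p,p}(\varepsilon,R)=\int_{\mathbb{R}^d}m_p(x,R)^{-\varepsilon}p(x)\,dx,$$ (the last two integrals may equivalently be taken over $\{x:p(x)>0\}$), and $$L_{p,p}(\nu)=\int_{\mathbb{R}^d}\int_{\mathbb{R}^d}|\log\|x-y\||^{\nu}p(x)p(y)\,dx\,dy.$$ *)

theory Defs
  imports "HOL-Probability.Probability"
begin

definition differential_entropy :: "('a::euclidean_space \<Rightarrow> real) \<Rightarrow> real" where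
  "differential_entropy p = - (LINT x|lborel. p x * ln (p x))"

text \<open>The definition above is the library entropy of any random variable with density \<open>p\<close>.\<close>

lemma (in prob_space) entropy_eq_differential_entropy:
  fixes X :: "'a \<Rightarrow> 'b::euclidean_space" and p :: "'b \<Rightarrow> real"
  assumes "distributed M lborel X (\<lambda>x. ennreal (p x))" and "\<And>x. 0 \<le> p x"
  shows "prob_space.entropy M (exp 1) lborel X = differential_entropy p"
proof -
  interpret information_space M "exp 1"
    by standard simp
  show ?thesis
    using entropy_distr[OF assms(1)] assms(2)
    by (simp add: differential_entropy_def log_def)
qed

abbreviation unit_vol :: "'a::euclidean_space itself \<Rightarrow> real" where
  "unit_vol _ \<equiv> measure lborel (cball (0::'a) 1)"

text \<open>
  The index of the \<open>k\<close>-th nearest neighbour (\<open>k \<ge> 1\<close>) of the point \<open>x i\<close> among the points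
  \<open>x j\<close> with \<open>j \<in> {1..n} - {i}\<close>. Since \<^const>\<open>sort_key\<close> is stable and the list of indices
  is increasing, ties are broken by increasing index. The excluded point is identified by its
  index rather than its value; for pairwise distinct points this makes no difference.
\<close>

definition nn_index :: "(nat \<Rightarrow> 'a::metric_space) \<Rightarrow> nat \<Rightarrow> nat \<Rightarrow> nat \<Rightarrow> nat" where
  "nn_index x n k i =
     sort_key (\<lambda>j. dist (x i) (x j)) (filter (\<lambda>j. j \<noteq> i) [1..<Suc n]) ! (k - 1)"

definition nn_dist :: "(nat \<Rightarrow> 'a::metric_space) \<Rightarrow> nat \<Rightarrow> nat \<Rightarrow> nat \<Rightarrow> real" where
  "nn_dist x n k i = dist (x i) (x (nn_index x n k i))"

text \<open>\<open>KL_estimator x n k\<close> is meaningful for \<open>1 \<le> k\<close> and \<open>k + 1 \<le> n\<close>.\<close>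

definition KL_estimator :: "(nat \<Rightarrow> 'a::euclidean_space) \<Rightarrow> nat \<Rightarrow> nat \<Rightarrow> real" where
  "KL_estimator x n k =
     1 / real n * (\<Sum>i=1..n. ln (nn_dist x n k i ^ DIM('a) * unit_vol TYPE('a) * (real n - 1)
                                  / exp (Digamma (real k))))"

primrec iter_exp :: "nat \<Rightarrow> real" where
  "iter_exp 0 = 1"
| "iter_exp (Suc N) = exp (iter_exp N)"

primrec iter_ln :: "nat \<Rightarrow> real \<Rightarrow> real" where
  "iter_ln 0 t = t"
| "iter_ln (Suc N) t = ln (iter_ln N t)"

definition G_fun :: "nat \<Rightarrow> real \<Rightarrow> real" where
  "G_fun N t = (if t > iter_exp (N - 1) then t * iter_ln N t else 0)"

definition I_avg :: "('a::euclidean_space \<Rightarrow> real) \<Rightarrow> 'a \<Rightarrow> real \<Rightarrow> ennreal" where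
  "I_avg p x r =
     (\<integral>\<^sup>+y\<in>cball x r. ennreal (p y) \<partial>lborel) / ennreal (r ^ DIM('a) * unit_vol TYPE('a))"

definition M_sup :: "('a::euclidean_space \<Rightarrow> real) \<Rightarrow> 'a \<Rightarrow> real \<Rightarrow> ennreal" where
  "M_sup p x R = (SUP r\<in>{0<..R}. I_avg p x r)"

definition m_inf :: "('a::euclidean_space \<Rightarrow> real) \<Rightarrow> 'a \<Rightarrow> real \<Rightarrow> ennreal" where
  "m_inf p x R = (INF r\<in>{0<..R}. I_avg p x r)"

text \<open>Real powers on \<open>[0, \<infinity>]\<close>, for a positive exponent.\<close>

definition ennreal_powr :: "ennreal \<Rightarrow> real \<Rightarrow> ennreal" where
  "ennreal_powr u a = (if u = \<infinity> then \<infinity> else ennreal (enn2real u powr a))"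

definition K_fun :: "('a::euclidean_space \<Rightarrow> real) \<Rightarrow> real \<Rightarrow> nat \<Rightarrow> ennreal" where
  "K_fun p \<nu> N =
     (\<integral>\<^sup>+x. (\<integral>\<^sup>+y\<in>{y. norm (x - y) > iter_exp N}.
         ennreal (G_fun N (\<bar>ln (norm (x - y))\<bar> powr \<nu>) * p x * p y) \<partial>lborel) \<partial>lborel)"

definition Q_fun :: "('a::euclidean_space \<Rightarrow> real) \<Rightarrow> real \<Rightarrow> real \<Rightarrow> ennreal" where
  "Q_fun p \<epsilon> R = (\<integral>\<^sup>+x. ennreal_powr (M_sup p x R) \<epsilon> * ennreal (p x) \<partial>lborel)"

text \<open>
  In \<^typ>\<open>ennreal\<close>, \<open>inverse 0 = \<infinity>\<close> and \<open>\<infinity> * 0 = 0\<close>, so only points with \<open>p x > 0\<close>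
  contribute.
\<close>

definition T_fun :: "('a::euclidean_space \<Rightarrow> real) \<Rightarrow> real \<Rightarrow> real \<Rightarrow> ennreal" where
  "T_fun p \<epsilon> R = (\<integral>\<^sup>+x. inverse (ennreal_powr (m_inf p x R) \<epsilon>) * ennreal (p x) \<partial>lborel)"

text \<open>
  The logarithm is \<open>-\<infinity>\<close> on the diagonal in the usual reading but \<open>ln 0 = 0\<close> here; the
  diagonal is a null set, so the integral is the same.
\<close>

definition L_fun :: "('a::euclidean_space \<Rightarrow> real) \<Rightarrow> real \<Rightarrow> ennreal" where
  "L_fun p \<nu> =
     (\<integral>\<^sup>+x. (\<integral>\<^sup>+y. ennreal (\<bar>ln (norm (x - y))\<bar> powr \<nu> * p x * p y) \<partial>lborel) \<partial>lborel)"

end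

theory Submission
  imports Defs
begin

text \<open>
  Let $F_x(r)$ be the probability of the closed ball of radius $r$ around $x$, let $R_i$ be the
  distance from $X_i$ to its $k$-th nearest neighbour, and put $U_i = F_{X_i}(R_i)$. Given $X_i$, the
  variables $F_{X_i}(\|X_i - X_j\|)$ are independent and uniform on $[0,1]$, so $U_i$ is the $k$-th
  order statistic of $n-1$ uniform variables and $\mathsf{E}\ln U_i = \psi(k) - \psi(n)$. The $i$-th
  summand of the estimator is $Y_i - \ln I_p(X_i, R_i)$, where $Y_i = \ln((n-1)U_i) - \psi(k)$ has mean
  tending to $0$. By Lebesgue's differentiation theorem $I_p(X_i, R_i) \to p(X_i)$ almost surely, and
  the logarithms are dominated: by powers of $M_p$ and $m_p$ if $R_i < R$, and otherwise by
  $\ln^+$ of the distances to the first $k$ other points, because $R_i$ decreases in $n$.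

  For the mean square, the covariance of $Y_1$ and $Y_2$ has to vanish in the limit. Omitting $X_2$
  among the neighbours of $X_1$ (and vice versa) changes $Y_1$ little in $L^2$. Given two distinct
  points $x$ and $y$, the numbers of the other points in disjoint balls around $x$ and $y$ are
  negatively dependent, which bounds the covariance from above; that is enough.
\<close>

section \<open>Lebesgue differentiation over balls\<close>

text \<open>The law of \<open>knn_prob\<close> is the same for every density, so the density enters
  only through \<open>L\<close>, and the hypotheses on ball averages and distances only through a
  dominating function for \<open>L\<close>. The squared logarithm of a ball average is at most
  (2/\<epsilon>)^2 times the powers in \<open>Q_fun\<close> and \<open>T_fun\<close>. Second moments
  of the local part are therefore available in both statements, which differ only in the moment of
  ln^+ of a distance that they require.

  The obstacle is the dependence among the Y_i, whose neighbour balls may overlap. One-sided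
  estimates suffice because the mean square of an average is nonnegative anyway. For fixed x and y
  the transformed variables are cut at the level \<open>separation x y\<close>, the smaller mass of
  the two balls whose radius is half of the distance. Below this level the balls around x and y are
  disjoint, and exceeding it has probability of order 1/m among m points. The resulting bound blows
  up as x and y approach each other, so it is capped by a uniform second-moment bound, and dominated
  convergence over the pair gives the limit.\<close>

lemma negligible_ball_comparison:
  fixes f g :: "'a::euclidean_space \<Rightarrow> real"
  assumes [measurable]: "f \<in> borel_measurable borel" "g \<in> borel_measurable borel"
    and f0: "\<And>x. 0 \<le> f x" and \<delta>: "0 < \<delta>"
    and fin: "\<And>n::nat. (\<integral>\<^sup>+x\<in>ball 0 (real n). ennreal (f x) \<partial>lborel) < \<infinity>"
  shows "negligible {x. f x + \<delta> \<le> g x \<and> (\<forall>d>0. \<exists>r>0. r < d \<and>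
    emeasure (density lborel (\<lambda>x. ennreal (g x))) (cball x r) \<le> emeasure (density lborel (\<lambda>x. ennreal (f x))) (cball x r))}"
    (is "negligible ?S")
proof -
  define F where "F = density lborel (\<lambda>x. ennreal (f x))"
  define G where "G = density lborel (\<lambda>x. ennreal (g x))"
  have sF[measurable_cong, simp]: "sets F = sets borel" and sG[measurable_cong, simp]: "sets G = sets borel"
    by (auto simp: F_def G_def)
  have emF: "emeasure F A = (\<integral>\<^sup>+x\<in>A. ennreal (f x) \<partial>lborel)" if "A \<in> sets borel" for A
    unfolding F_def using that by (subst emeasure_density; (measurable)?)
  have emG: "emeasure G A = (\<integral>\<^sup>+x\<in>A. ennreal (g x) \<partial>lborel)" if "A \<in> sets borel" for A
    unfolding G_def using that by (subst emeasure_density; (measurable)?)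
  have [measurable]: "ball (0::'a) (real n) \<in> sets borel" for n :: nat by simp
  \<comment> \<open>Vitali covering: up to a negligible set, the points of \<open>?S\<close> in a
    fixed ball are covered by disjoint balls that lie in an open set barely larger than
    \<open>B\<close> and carry no more g-mass than f-mass. Summed up, this conflicts with the
    surplus of at least \<delta> per unit volume on \<open>B\<close> unless the covering has small
    volume. The criterion by outer covers avoids any question of measurability of
    \<open>?S\<close>.\<close>
  have "negligible (?S \<inter> ball 0 (real n))" for n :: nat
    unfolding negligible_outer_le
  proof (intro allI impI)
    fix e :: real assume e: "e > 0"
    \<comment> \<open>The covering costs e'/\<delta> in volume inside \<open>B\<close> and e'
      outside; \<open>ee\<close> adds the two up to e.\<close>
    define e' where "e' = e / (1 / \<delta> + 1)"
    have e': "e' > 0" using e \<delta> by (simp add: e'_def add_pos_pos)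
    have "1 / \<delta> + 1 > 0" using \<delta> by (simp add: add_pos_pos)
    then have ee: "e' / \<delta> + e' = e" by (simp add: e'_def divide_simps) (simp add: algebra_simps)
    \<comment> \<open>With density 1 + f, a single bound for U - B controls both its volume and its
      f-mass. Cutting off at the ball makes \<open>M\<close> finite, hence outer regular.\<close>
    define M where "M = density lborel (\<lambda>x. ennreal (1 + f x) * indicator (ball 0 (real n)) x)"
    have sM[measurable_cong, simp]: "sets M = sets borel" by (simp add: M_def)
    have emM: "emeasure M A = (\<integral>\<^sup>+x\<in>A. ennreal (1 + f x) * indicator (ball 0 (real n)) x \<partial>lborel)" if "A \<in> sets borel" for A
      unfolding M_def using that by (subst emeasure_density; (measurable)?)
    have "emeasure M UNIV = (\<integral>\<^sup>+x. ennreal (1 + f x) * indicator (ball 0 (real n)) x \<partial>lborel)"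
      unfolding M_def by (subst emeasure_density; (measurable)?)
    also have "\<dots> = (\<integral>\<^sup>+x. indicator (ball 0 (real n)) x + ennreal (f x) * indicator (ball 0 (real n)) x \<partial>lborel)"
      by (intro nn_integral_cong) (auto simp: f0 ennreal_plus split: split_indicator)
    also have "\<dots> = emeasure lborel (ball (0::'a) (real n)) + (\<integral>\<^sup>+x\<in>ball 0 (real n). ennreal (f x) \<partial>lborel)"
      by (subst nn_integral_add) auto
    also have "\<dots> < \<infinity>" using fin[of n] emeasure_lborel_ball_finite[of "0::'a" "real n"] by (simp add: )
    finally have finM: "finite_measure M" by (intro finite_measureI) (simp add: M_def)
    interpret M: finite_measure M by fact
    define B where "B = {x\<in>ball 0 (real n). f x + \<delta> \<le> g x}"
    have [measurable]: "B \<in> sets borel" unfolding B_def by measurable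
    have "emeasure M B < emeasure M B + ennreal e'"
      using M.emeasure_finite[of B] e' by (simp add: less_top ennreal_less_zero_iff)
    moreover have "emeasure M B = (INF U \<in> {U. B \<subseteq> U \<and> open U}. emeasure M U)"
      by (rule outer_regular) (use finM in \<open>auto simp: M.emeasure_finite M_def[symmetric]\<close>)
    ultimately have "\<exists>U. B \<subseteq> U \<and> open U \<and> emeasure M U < emeasure M B + ennreal e'"
      by (auto simp: INF_less_iff)
    then obtain U0 where U0: "B \<subseteq> U0" "open U0" "emeasure M U0 < emeasure M B + ennreal e'" by blast
    define U where "U = U0 \<inter> ball 0 (real n)"
    have U: "B \<subseteq> U" "open U" "U \<subseteq> ball 0 (real n)" using U0 by (auto simp: U_def B_def)
    have [measurable]: "U \<in> sets borel" using U(2) by simp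
    have [measurable]: "U0 \<in> sets borel" using U0(2) by simp
    have "emeasure M U \<le> emeasure M U0" by (intro emeasure_mono) (auto simp: U_def)
    then have MU: "emeasure M U < emeasure M B + ennreal e'" using U0(3) by order
    have "emeasure M U = emeasure M B + emeasure M (U - B)"
      using U(1) by (subst plus_emeasure) (auto intro!: arg_cong[where f="emeasure M"])
    with MU have MUB: "emeasure M (U - B) \<le> ennreal e'"
      using M.emeasure_finite[of B] by (metis ennreal_add_left_cancel_less less_imp_le)
    define K where "K = {z::'a\<times>real. snd z > 0 \<and> cball (fst z) (snd z) \<subseteq> U \<and> emeasure G (cball (fst z) (snd z)) \<le> emeasure F (cball (fst z) (snd z))}"
    have K1: "\<exists>i. i \<in> K \<and> x \<in> cball (fst i) (snd i) \<and> snd i < d" if x: "x \<in> ?S \<inter> ball 0 (real n)" and d: "d > 0" for x d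
    proof -
      have "x \<in> U" using x U(1) by (auto simp: B_def)
      then obtain h where h: "h > 0" "cball x h \<subseteq> U" using U(2) by (meson open_contains_cball)
      obtain r where r: "r > 0" "r < min d h" "emeasure G (cball x r) \<le> emeasure F (cball x r)"
        using x d h(1) unfolding F_def G_def by (auto dest!: spec[of _ "min d h"])
      have "cball x r \<subseteq> cball x h" using r by (auto)
      then have "(x,r) \<in> K" using r h by (auto simp: K_def)
      then show ?thesis using r by (intro exI[of _ "(x,r)"]) auto
    qed
    obtain C where C: "countable C" "C \<subseteq> K" "pairwise (\<lambda>i j. disjnt (cball (fst i) (snd i)) (cball (fst j) (snd j))) C"
       "negligible (?S \<inter> ball 0 (real n) - (\<Union>i \<in> C. cball (fst i) (snd i)))"
      by (rule Vitali_covering_theorem_cballs[of K snd "?S \<inter> ball 0 (real n)" fst])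
         (use K1 in \<open>auto simp: K_def\<close>)
    define T where "T = (\<Union>i \<in> C. cball (fst i) (snd i))"
    have [measurable]: "T \<in> sets borel" unfolding T_def using C(1) by (intro sets.countable_UN'') auto
    have TU: "T \<subseteq> U" using C(2) by (auto simp: T_def K_def)
    have disj: "disjoint_family_on (\<lambda>i. cball (fst i) (snd i)) C"
      using C(3) by (auto simp: disjoint_family_on_def pairwise_def disjnt_def)
    have "emeasure G T = (\<integral>\<^sup>+i. emeasure G (cball (fst i) (snd i)) \<partial>count_space C)"
      unfolding T_def by (rule emeasure_UN_countable) (use disj C in auto)
    also have "\<dots> \<le> (\<integral>\<^sup>+i. emeasure F (cball (fst i) (snd i)) \<partial>count_space C)"
      using C(2) by (intro nn_integral_mono) (auto simp: K_def)
    also have "\<dots> = emeasure F T"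
      unfolding T_def by (rule emeasure_UN_countable[symmetric]) (use disj C in auto)
    finally have GF: "emeasure G T \<le> emeasure F T" .
    have TUx: "x \<in> U" "norm x < real n" if "x \<in> T" for x using TU U(3) that by auto
    have T_split: "T = (T \<inter> B) \<union> (T - B)" by auto
    have "emeasure F (T - B) \<le> emeasure M (U - B)"
      by (subst emF, measurable, subst emM, measurable)
         (auto intro!: nn_integral_mono simp: f0 TUx ennreal_plus split: split_indicator)
    then have FM: "emeasure F (T - B) \<le> ennreal e'" using MUB by (rule order_trans)
    have "emeasure F T = emeasure F ((T \<inter> B) \<union> (T - B))" using T_split by simp
    also have "\<dots> \<le> emeasure F (T \<inter> B) + emeasure F (T - B)" by (rule emeasure_subadditive) auto
    also have "\<dots> \<le> emeasure F (T \<inter> B) + ennreal e'" using FM by (rule add_left_mono)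
    finally have F1: "emeasure F T \<le> emeasure F (T \<inter> B) + ennreal e'" .
    have "emeasure lborel (T - B) \<le> emeasure M (U - B)"
    proof -
      have "emeasure lborel (T - B) = (\<integral>\<^sup>+x. indicator (T - B) x \<partial>lborel)" by simp
      also have "\<dots> \<le> emeasure M (U - B)"
        by (subst emM, measurable, rule nn_integral_mono) (auto simp: f0 TUx ennreal_plus split: split_indicator)
      finally show ?thesis .
    qed
    then have LM: "emeasure lborel (T - B) \<le> ennreal e'" using MUB by (rule order_trans)
    have "emeasure lborel T = emeasure lborel ((T \<inter> B) \<union> (T - B))" using T_split by simp
    also have "\<dots> \<le> emeasure lborel (T \<inter> B) + emeasure lborel (T - B)" by (rule emeasure_subadditive) auto
    also have "\<dots> \<le> emeasure lborel (T \<inter> B) + ennreal e'" using LM by (rule add_left_mono)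
    finally have L1: "emeasure lborel T \<le> emeasure lborel (T \<inter> B) + ennreal e'" .
    have "emeasure F (T \<inter> B) + ennreal \<delta> * emeasure lborel (T \<inter> B) = (\<integral>\<^sup>+x. ennreal (f x) * indicator (T \<inter> B) x + ennreal \<delta> * indicator (T \<inter> B) x \<partial>lborel)"
      by (subst nn_integral_add) (auto simp: emF nn_integral_cmult_indicator)
    also have "\<dots> \<le> emeasure G (T \<inter> B)"
      by (subst emG, measurable)
        (use \<delta> in \<open>auto intro!: nn_integral_mono simp: B_def f0 ennreal_plus[symmetric] intro!: ennreal_leI simp del: ennreal_plus split: split_indicator\<close>)
    also have "\<dots> \<le> emeasure G T" by (intro emeasure_mono) auto
    also have "\<dots> \<le> emeasure F (T \<inter> B) + ennreal e'" using GF F1 by order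
    finally have "emeasure F (T \<inter> B) + ennreal \<delta> * emeasure lborel (T \<inter> B) \<le> emeasure F (T \<inter> B) + ennreal e'" .
    moreover have "emeasure F (T \<inter> B) < \<infinity>"
    proof -
      have "emeasure F (T \<inter> B) \<le> emeasure F (ball 0 (real n))"
        by (intro emeasure_mono) (auto simp: B_def)
      also have "\<dots> < \<infinity>" using fin[of n] by (simp add: emF)
      finally show ?thesis .
    qed
    ultimately have "ennreal \<delta> * emeasure lborel (T \<inter> B) \<le> ennreal e'"
      by (metis ennreal_add_left_cancel_le infinity_ennreal_def less_irrefl)
    then have "ennreal (1/\<delta>) * (ennreal \<delta> * emeasure lborel (T \<inter> B)) \<le> ennreal (1/\<delta>) * ennreal e'"
      by (intro mult_left_mono) auto
    then have "emeasure lborel (T \<inter> B) \<le> ennreal (e' / \<delta>)"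
      using \<delta> e' by (simp add: mult.assoc[symmetric] ennreal_mult[symmetric])
    then have "emeasure lborel T \<le> ennreal (e' / \<delta>) + ennreal e'" using L1 by (meson add_mono order_refl order_trans)
    also have "\<dots> = ennreal e" using e' \<delta> by (simp add: ennreal_plus[symmetric] ee del: ennreal_plus) 
    finally have Te: "emeasure lborel T \<le> ennreal e" .
    then have mT: "T \<in> lmeasurable" by (intro fmeasurableI) (auto intro: le_less_trans)
    let ?N = "?S \<inter> ball 0 (real n) - T"
    have N: "negligible ?N" using C(4) by (simp add: T_def)
    have "measure lebesgue (T \<union> ?N) \<le> measure lebesgue T + measure lebesgue ?N"
      using mT N by (intro measure_Un_le) (auto simp: negligible_imp_measurable fmeasurableD)
    also have "\<dots> = measure lebesgue T" using N by (simp add: negligible_imp_measure0)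
    also have "\<dots> \<le> e" using Te e by (simp add: measure_def enn2real_leI)
    finally have le_e: "measure lebesgue (T \<union> ?N) \<le> e" .
    show "\<exists>T. ?S \<inter> ball 0 (real n) \<subseteq> T \<and> T \<in> lmeasurable \<and> measure lebesgue T \<le> e"
    proof (intro exI conjI)
      show "T \<union> ?N \<in> lmeasurable" by (rule fmeasurable.Un[OF mT negligible_imp_measurable[OF N]])
      show "measure lebesgue (T \<union> ?N) \<le> e" by (fact le_e)
    qed blast
  qed
  then have "negligible (\<Union>n::nat. ?S \<inter> ball 0 (real n))" by (intro negligible_Union_nat)
  also have "(\<Union>n::nat. ?S \<inter> ball 0 (real n)) = ?S" by (auto intro: reals_Archimedean2)
  finally show ?thesis .
qed

text \<open>If the averages do not converge to p x, then rationals c < c' separate p x from the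
  averages over arbitrarily small balls, on one side or the other. Comparing p with constant
  densities puts x into one of countably many null sets.\<close>

theorem lebesgue_differentiation_cball:
  fixes p :: "'a::euclidean_space \<Rightarrow> real"
  assumes p0: "\<And>x. 0 \<le> p x" and p: "integrable lborel p"
  shows "AE x in lborel. ((\<lambda>r. measure (density lborel (\<lambda>x. ennreal (p x))) (cball x r) / measure lborel (cball x r)) \<longlongrightarrow> p x) (at_right 0)"
proof -
  have [measurable]: "p \<in> borel_measurable borel" using p by auto
  define P where "P = density lborel (\<lambda>x. ennreal (p x))"
  have finp: "(\<integral>\<^sup>+x. ennreal (p x) \<partial>lborel) < \<infinity>" using p p0 by (simp add: integrable_iff_bounded)
  interpret P: finite_measure P
    by (rule finite_measureI) (use finp in \<open>simp add: P_def emeasure_density\<close>)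
  have finp': "(\<integral>\<^sup>+x\<in>A. ennreal (p x) \<partial>lborel) < \<infinity>" for A
  proof -
    have "(\<integral>\<^sup>+x\<in>A. ennreal (p x) \<partial>lborel) \<le> (\<integral>\<^sup>+x. ennreal (p x) \<partial>lborel)"
      by (intro nn_integral_mono) (auto split: split_indicator)
    then show ?thesis using finp by order
  qed
  have ec: "emeasure (density lborel (\<lambda>x. ennreal c)) (cball x r) = ennreal (c * measure lborel (cball x r))" if "0 \<le> c" for c r and x :: 'a
  proof -
    have "emeasure lborel (cball x r) = ennreal (measure lborel (cball x r))"
      using emeasure_lborel_cball_finite[of x r] by (intro emeasure_eq_ennreal_measure) auto
    then show ?thesis using that by (simp add: emeasure_density nn_integral_cmult_indicator ennreal_mult)
  qed
  have em: "emeasure P (cball x r) = ennreal (measure P (cball x r))" for x r by (simp add: P.emeasure_eq_measure)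
  have finc: "(\<integral>\<^sup>+x\<in>ball (0::'a) (real n). ennreal c \<partial>lborel) < \<infinity>" for n :: nat and c
    using emeasure_lborel_ball_finite[of "0::'a" "real n"]
    by (simp add: nn_integral_cmult_indicator ennreal_mult_less_top)
  \<comment> \<open>The condition on the point is p x <= c in \<open>N1\<close> and c' <= p x in
    \<open>N2\<close>; it is written with the gap c' - c to match
    \<open>negligible_ball_comparison\<close>.\<close>
  define N1 where "N1 c c' = {x. p x + (c' - c) \<le> c' \<and> (\<forall>d>0. \<exists>r>0. r < d \<and> emeasure (density lborel (\<lambda>x. ennreal c')) (cball x r) \<le> emeasure P (cball x r))}" for c c' :: real
  define N2 where "N2 c c' = {x. c + (c' - c) \<le> p x \<and> (\<forall>d>0. \<exists>r>0. r < d \<and> emeasure P (cball x r) \<le> emeasure (density lborel (\<lambda>x. ennreal c)) (cball x r))}" for c c' :: real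
  have N1: "negligible (N1 c c')" if "0 \<le> c" "c < c'" for c c'
    using negligible_ball_comparison[of p "\<lambda>_. c'" "c' - c"] that p0 finp' by (simp add: N1_def P_def)
  have N2: "negligible (N2 c c')" if "0 \<le> c" "c < c'" for c c'
    using negligible_ball_comparison[of "\<lambda>_. c" p "c' - c"] that p0 finc by (simp add: N2_def P_def)
  define I where "I = {(c, c'). c \<in> \<rat> \<and> c' \<in> \<rat> \<and> 0 \<le> c \<and> c < (c'::real)}"
  have cI: "countable I" by (rule countable_subset[of _ "\<rat> \<times> \<rat>"]) (auto simp: I_def countable_rat)
  define N where "N = (\<Union>(c,c')\<in>I. N1 c c' \<union> N2 c c')"
  have "negligible N" unfolding N_def using cI N1 N2
    by (auto simp: I_def intro!: negligible_countable_Union)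
  then have "AE x in lebesgue. x \<notin> N" by (auto simp: negligible_iff_null_sets intro: AE_not_in)
  then have "AE x in lborel. x \<notin> N" by (simp add: AE_completion_iff)
  then show ?thesis
  proof (rule AE_mp, intro AE_I2 impI)
    fix x assume x: "x \<notin> N"
    have "((\<lambda>r. measure P (cball x r) / measure lborel (cball x r)) \<longlongrightarrow> p x) (at_right 0)"
    proof (rule order_tendstoI)
      fix a assume a: "p x < a"
      obtain c where c: "c \<in> \<rat>" "p x < c" "c < a" using Rats_dense_in_real[OF a] by blast
      obtain c' where c': "c' \<in> \<rat>" "c < c'" "c' < a" using Rats_dense_in_real[OF c(3)] by blast
      have "x \<notin> N1 c c'" using x c c' p0[of x] by (force simp: N_def I_def)
      then obtain d where d: "d > 0" "\<And>r. r > 0 \<Longrightarrow> r < d \<Longrightarrow> \<not> emeasure (density lborel (\<lambda>x. ennreal c')) (cball x r) \<le> emeasure P (cball x r)"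
        using c by (auto simp: N1_def)
      have "measure P (cball x r) / measure lborel (cball x r) < a" if r: "0 < r" "r < d" for r
      proof -
        have pos: "measure lborel (cball x r) > 0" using r content_cball_pos[of r x] by simp
        have "measure P (cball x r) < c' * measure lborel (cball x r)"
          using d(2)[OF r] ec[of c' x r] em[of x r] c c' p0[of x] by (simp add: not_le ennreal_less_iff)
        then have "measure P (cball x r) / measure lborel (cball x r) < c'" using pos by (simp add: field_simps)
        then show ?thesis using c' by linarith
      qed
      then show "\<forall>\<^sub>F r in at_right 0. measure P (cball x r) / measure lborel (cball x r) < a"
        unfolding eventually_at_right_field using d(1) by blast
    next
      fix a assume a: "a < p x"
      show "\<forall>\<^sub>F r in at_right 0. a < measure P (cball x r) / measure lborel (cball x r)"
      \<comment> \<open>Averages are nonnegative, which settles a < 0. Otherwise c and c' are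
        nonnegative, as membership in \<open>I\<close> demands.\<close>
      proof (cases "a < 0")
        case True
        then show ?thesis by (intro always_eventually allI) (meson divide_nonneg_nonneg measure_nonneg order.strict_trans2)
      next
        case False
        obtain c where c: "c \<in> \<rat>" "a < c" "c < p x" using Rats_dense_in_real[OF a] by blast
        obtain c' where c': "c' \<in> \<rat>" "c < c'" "c' < p x" using Rats_dense_in_real[OF c(3)] by blast
        have "x \<notin> N2 c c'" using x c c' False by (force simp: N_def I_def)
        then obtain d where d: "d > 0" "\<And>r. r > 0 \<Longrightarrow> r < d \<Longrightarrow> \<not> emeasure P (cball x r) \<le> emeasure (density lborel (\<lambda>x. ennreal c)) (cball x r)"
          using c' by (auto simp: N2_def)
        have "a < measure P (cball x r) / measure lborel (cball x r)" if r: "0 < r" "r < d" for r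
        proof -
          have pos: "measure lborel (cball x r) > 0" using r content_cball_pos[of r x] by simp
          have "c * measure lborel (cball x r) < measure P (cball x r)"
            using d(2)[OF r] ec[of c x r] em[of x r] c c' False by (simp add: not_le ennreal_less_iff)
          then have "c < measure P (cball x r) / measure lborel (cball x r)" using pos by (simp add: field_simps)
          then show ?thesis using c by linarith
        qed
        then show ?thesis unfolding eventually_at_right_field using d(1) by blast
      qed
    qed
    then show "((\<lambda>r. measure (density lborel (\<lambda>x. ennreal (p x))) (cball x r) / measure lborel (cball x r)) \<longlongrightarrow> p x) (at_right 0)"
      by (simp add: P_def)
  qed
qed

section \<open>Tails of the binomial distribution\<close>

text \<open>The probability of at least k successes in m trials, by cases on one trial instead of a
  sum of binomial coefficients. The same recursion arises when one coordinate of a product measure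
  is integrated out. Truncated subtraction keeps the value 1 at k = 0.\<close>

primrec binomial_tail :: "nat \<Rightarrow> nat \<Rightarrow> real \<Rightarrow> real" where
  "binomial_tail 0 k s = (if k = 0 then 1 else 0)"
| "binomial_tail (Suc m) k s = s * binomial_tail m (k - 1) s + (1 - s) * binomial_tail m k s"

lemma binomial_tail_0 [simp]: "binomial_tail m 0 s = 1"
  by (induction m) (auto simp: algebra_simps)

lemma binomial_tail_bounds:
  assumes "0 \<le> s" "s \<le> 1"
  shows "0 \<le> binomial_tail m k s \<and> binomial_tail m k s \<le> 1"
proof (induction m arbitrary: k)
  case (Suc m)
  have "s * binomial_tail m (k - 1) s + (1 - s) * binomial_tail m k s \<le> s * 1 + (1 - s) * 1"
    using Suc assms by (intro add_mono mult_left_mono) auto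
  then show ?case using Suc assms by auto
qed auto

lemma binomial_tail_antimono:
  assumes "0 \<le> s" "s \<le> 1"
  shows "binomial_tail m (Suc k) s \<le> binomial_tail m k s"
proof (induction m arbitrary: k)
  case (Suc m)
  show ?case
  proof (cases k)
    case 0
    then show ?thesis using binomial_tail_bounds[OF assms, of "Suc m" "Suc k"] by simp
  next
    case (Suc l)
    then show ?thesis using Suc.IH[of l] Suc.IH[of k] assms by (auto intro!: add_mono mult_left_mono)
  qed
qed auto

lemma binomial_tail_at_ends:
  "binomial_tail m k 0 = (if k = 0 then 1 else 0)" "binomial_tail m k 1 = (if k \<le> m then 1 else 0)"
  by (induction m arbitrary: k) auto

text \<open>Markov's inequality in disguise: for 1 <= k <= m, one minus the tail is the probability
  that the k-th of m uniform order statistics exceeds s, and the mean of that statistic is k / (m +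
  1).\<close>

lemma one_minus_binomial_tail_le:
  assumes "0 \<le> s" "s \<le> 1"
  shows "(1 - binomial_tail m k s) * s * (real m + 1) \<le> real k"
proof (induction m arbitrary: k)
  case 0
  then show ?case using assms by auto
next
  case (Suc m)
  let ?b = "\<lambda>m k. 1 - binomial_tail m k s"
  show ?case
  proof (cases k)
    case 0
    then show ?thesis by simp
  next
    case (Suc l)
    show ?thesis
    proof (cases "s * (real m + 2) \<le> real l + 1")
      case True
      have "?b (Suc m) k * s * (real (Suc m) + 1) \<le> 1 * s * (real (Suc m) + 1)"
        using binomial_tail_bounds[OF assms, of "Suc m" k] assms by (intro mult_right_mono) auto
      then show ?thesis using True Suc by (simp add: algebra_simps)
    next
      \<comment> \<open>The estimate (l + 1 - s)(m + 2) <= (l + 1)(m + 1) needed below amounts to l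
        + 1 <= s (m + 2), which the failed case condition provides.\<close>
      case False
      have e: "?b (Suc m) k = s * ?b m l + (1 - s) * ?b m k" using Suc by (simp add: algebra_simps)
      have "?b (Suc m) k * s * (real m + 1) = s * (?b m l * s * (real m + 1)) + (1 - s) * (?b m k * s * (real m + 1))"
        unfolding e by (simp add: algebra_simps)
      also have "\<dots> \<le> s * real l + (1 - s) * real k"
        using Suc.IH[of l] Suc.IH[of k] assms by (intro add_mono mult_left_mono) auto
      also have "\<dots> = real l + 1 - s" using Suc by (simp add: algebra_simps)
      finally have "?b (Suc m) k * s * (real m + 1) * (real m + 2) \<le> (real l + 1 - s) * (real m + 2)"
        by (intro mult_right_mono) auto
      also have "\<dots> \<le> (real l + 1) * (real m + 1)" using False by (simp add: algebra_simps)
      finally have "(?b (Suc m) k * s * (real m + 2)) * (real m + 1) \<le> (real l + 1) * (real m + 1)"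
        by (simp add: algebra_simps)
      then have "?b (Suc m) k * s * (real m + 2) \<le> real l + 1" by (simp only: mult_le_cancel_right)
      then show ?thesis using Suc by (simp add: algebra_simps)
    qed
  qed
qed

text \<open>The difference of two consecutive tails is the probability of exactly k successes in m
  trials, so the derivative is the density of the (k + 1)-st order statistic of m + 1 uniform
  variables.\<close>

lemma binomial_tail_has_derivative:
  "((\<lambda>s. binomial_tail (Suc m) (Suc k) s) has_real_derivative
     real (Suc m) * (binomial_tail m k s - binomial_tail m (Suc k) s)) (at s)"
proof (induction m arbitrary: k)
  case 0
  show ?case by (auto intro!: derivative_eq_intros)
next
  case (Suc m)
  let ?B = binomial_tail
  have D: "((\<lambda>s. s * ?B (Suc m) k s + (1 - s) * ?B (Suc m) (Suc k) s) has_real_derivative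
     (?B (Suc m) k s + s * d1 + ((1 - s) * (real (Suc m) * (?B m k s - ?B m (Suc k) s)) - ?B (Suc m) (Suc k) s))) (at s)"
    if "((\<lambda>s. ?B (Suc m) k s) has_real_derivative d1) (at s)" for d1
    using that Suc.IH[of k] by (auto intro!: derivative_eq_intros simp del: binomial_tail.simps)
  show ?case
  proof (cases k)
    case 0
    have "((\<lambda>s. ?B (Suc m) k s) has_real_derivative 0) (at s)" unfolding 0 binomial_tail_0 by simp
    from D[OF this] show ?thesis using 0 by (simp add: algebra_simps)
  next
    case (Suc l)
    from D[OF Suc.IH[of l, folded Suc]] show ?thesis using Suc by (simp add: algebra_simps)
  qed
qed

lemma continuous_on_binomial_tail: "continuous_on A (\<lambda>s. binomial_tail m k s)"
  by (induction m arbitrary: k) (auto intro!: continuous_intros)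

lemma borel_measurable_binomial_tail [measurable]: "(\<lambda>s. binomial_tail m k s) \<in> borel_measurable borel"
  by (intro borel_measurable_continuous_onI continuous_on_binomial_tail)

lemma has_integral_binomial_pmf:
  assumes "k \<le> m"
  shows "((\<lambda>s. binomial_tail m k s - binomial_tail m (Suc k) s) has_integral 1 / (real m + 1)) {0..1}"
proof -
  have "((\<lambda>s. real (Suc m) * (binomial_tail m k s - binomial_tail m (Suc k) s)) has_integral
      binomial_tail (Suc m) (Suc k) 1 - binomial_tail (Suc m) (Suc k) 0) {0..1}"
    by (rule fundamental_theorem_of_calculus)
       (auto intro: has_field_derivative_at_within[OF binomial_tail_has_derivative]
             simp: has_real_derivative_iff_has_vector_derivative[symmetric] simp del: binomial_tail.simps of_nat_Suc)
  then have "((\<lambda>s. real (Suc m) * (binomial_tail m k s - binomial_tail m (Suc k) s)) has_integral 1) {0..1}"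
    using assms by (simp add: binomial_tail_at_ends del: binomial_tail.simps)
  from has_integral_mult_right[OF this, of "1 / real (Suc m)"] show ?thesis
    by (simp add: mult.assoc[symmetric] add.commute del: mult.assoc)
qed

text \<open>One minus the mean of an order statistic. Consecutive tails differ by a probability mass
  function of integral 1 / (m + 1), so the value falls linearly in k.\<close>

lemma has_integral_binomial_tail:
  assumes "k \<le> m + 1"
  shows "((\<lambda>s. binomial_tail m k s) has_integral 1 - real k / (real m + 1)) {0..1}"
  using assms
proof (induction k)
  case 0
  then show ?case using has_integral_const_real[of "1::real" 0 1] by simp
next
  case (Suc k)
  have "((\<lambda>s. binomial_tail m k s - (binomial_tail m k s - binomial_tail m (Suc k) s)) has_integral
      (1 - real k / (real m + 1)) - 1 / (real m + 1)) {0..1}"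
    using Suc by (intro has_integral_diff has_integral_binomial_pmf) auto
  moreover have "(1 - real k / (real m + 1)) - 1 / (real m + 1) = 1 - real (Suc k) / (real m + 1)"
    by (simp add: add_divide_distrib)
  ultimately show ?case by simp
qed

text \<open>The constants are those of $-\mathsf{E}\ln U_{(k)}$ for $m$ independent uniform variables.\<close>

lemma has_integral_binomial_tail_div:
  assumes "1 \<le> k" "k \<le> m"
  shows "((\<lambda>s. binomial_tail m k s / s) has_integral harm m - harm (k - 1)) {0..1}"
  using assms
proof (induction m)
  case (Suc m)
  \<comment> \<open>Divided by s, the recursion adds a probability mass function, and its integral 1
    / (m + 1) is the next harmonic increment.\<close>
  have step: "binomial_tail (Suc m) k s / s = binomial_tail m k s / s + (binomial_tail m (k - 1) s - binomial_tail m k s)"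
    if "s \<noteq> 0" for s using that by (simp add: field_simps)
  have pm: "((\<lambda>s. binomial_tail m (k - 1) s - binomial_tail m k s) has_integral 1 / (real m + 1)) {0..1}"
    using has_integral_binomial_pmf[of "k - 1" m] Suc.prems by simp
  have old: "((\<lambda>s. binomial_tail m k s / s) has_integral harm m - harm (k - 1)) {0..1}"
  proof (cases "k \<le> m")
    case True then show ?thesis using Suc by simp
  next
    case False
    \<comment> \<open>Here m = k - 1, where the recursion in m effectively starts: k successes in m
      trials are impossible and both sides are 0.\<close>
    have "binomial_tail m k s = 0" if "m < k" for m k s
      using that by (induction m arbitrary: k) auto
    then show ?thesis using False Suc.prems by (simp add: le_Suc_eq)
  qed
  have "((\<lambda>s. binomial_tail m k s / s + (binomial_tail m (k - 1) s - binomial_tail m k s)) has_integral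
       (harm m - harm (k - 1)) + 1 / (real m + 1)) {0..1}"
    by (intro has_integral_add old pm)
  then have "((\<lambda>s. binomial_tail (Suc m) k s / s) has_integral (harm m - harm (k - 1)) + 1 / (real m + 1)) {0..1}"
    by (rule has_integral_spike[where S="{0}", rotated 2]) (use step in auto)
  then show ?case by (simp add: harm_Suc field_simps)
qed auto

text \<open>The difference of the two sides is $ab(g(k-1)-g(k))(h(l-1)-h(l)) \ge 0$, where $g$ and $h$
  are the tails with parameters $a$ and $b$.\<close>

lemma binomial_tail_negative_dependence_step:
  assumes a: "0 \<le> a" "a \<le> 1" and b: "0 \<le> b" "b \<le> 1"
  shows "a * (binomial_tail m (k - 1) a * binomial_tail m l b) + b * (binomial_tail m k a * binomial_tail m (l - 1) b)
       + (1 - a - b) * (binomial_tail m k a * binomial_tail m l b)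
       \<le> binomial_tail (Suc m) k a * binomial_tail (Suc m) l b"
proof -
  have mono: "binomial_tail m j s \<le> binomial_tail m (j - 1) s" if "0 \<le> s" "s \<le> 1" for j s
    using binomial_tail_antimono[OF that, of m "j - 1"] by (cases j) auto
  have "0 \<le> (a * b) * ((binomial_tail m (k - 1) a - binomial_tail m k a) * (binomial_tail m (l - 1) b - binomial_tail m l b))"
    using mono[OF a, of k] mono[OF b, of l] a b by (intro mult_nonneg_nonneg) auto
  then show ?thesis by (simp add: algebra_simps)
qed

section \<open>Order statistics\<close>

text \<open>The k-th smallest value, with multiplicity. Counting instead of sorting turns an event
  about the statistic into an event about a number of indices, for which the product measure has a
  recursion.\<close>

definition order_stat :: "nat \<Rightarrow> 'b set \<Rightarrow> ('b \<Rightarrow> real) \<Rightarrow> real" where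
  "order_stat k J f = Min {t \<in> f ` J. k \<le> card {j \<in> J. f j \<le> t}}"

context
  fixes J :: "'b set" and k :: nat
  assumes fin: "finite J" and k1: "1 \<le> k" and kJ: "k \<le> card J"
begin

text \<open>The largest value not exceeding r is a candidate, since every index with value at most r
  is counted below it.\<close>

lemma order_stat_candidates:
  fixes f :: "'b \<Rightarrow> real"
  assumes "k \<le> card {j \<in> J. f j \<le> r}"
  shows "\<exists>t\<in>{t \<in> f ` J. k \<le> card {j \<in> J. f j \<le> t}}. t \<le> r"
proof -
  let ?A = "{j \<in> J. f j \<le> r}"
  have ne: "?A \<noteq> {}" using assms k1 by (metis card.empty not_one_le_zero order_trans)
  define t where "t = Max (f ` ?A)"
  have t: "t \<in> f ` ?A" unfolding t_def using ne fin by (intro Max_in) auto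
  have "f j \<le> t" if "j \<in> ?A" for j unfolding t_def using that fin by (intro Max_ge) auto
  then have "?A \<subseteq> {j \<in> J. f j \<le> t}" by auto
  then have "card ?A \<le> card {j \<in> J. f j \<le> t}" using fin by (intro card_mono) auto
  then show ?thesis using t assms by force
qed

lemma order_stat_in: "order_stat k J f \<in> {t \<in> f ` J. k \<le> card {j \<in> J. f j \<le> t}}"
  unfolding order_stat_def
proof (rule Min_in)
  have "\<And>j. j \<in> J \<Longrightarrow> f j \<le> Max (f ` J)" using fin by simp
  then have "{j \<in> J. f j \<le> Max (f ` J)} = J" by auto
  then show "{t \<in> f ` J. k \<le> card {j \<in> J. f j \<le> t}} \<noteq> {}"
    using order_stat_candidates[of f "Max (f ` J)"] kJ by auto
qed (use fin in auto)

lemma order_stat_attained: "\<exists>j\<in>J. order_stat k J f = f j"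
  using order_stat_in[of f] by auto

lemma order_stat_le_iff: "order_stat k J f \<le> r \<longleftrightarrow> k \<le> card {j \<in> J. f j \<le> r}"
proof
  assume "order_stat k J f \<le> r"
  then have "card {j \<in> J. f j \<le> order_stat k J f} \<le> card {j \<in> J. f j \<le> r}"
    using fin by (intro card_mono) auto
  then show "k \<le> card {j \<in> J. f j \<le> r}" using order_stat_in[of f] by simp
next
  assume "k \<le> card {j \<in> J. f j \<le> r}"
  then obtain t where t: "t \<in> {t \<in> f ` J. k \<le> card {j \<in> J. f j \<le> t}}" "t \<le> r"
    using order_stat_candidates by blast
  have "order_stat k J f \<le> t"
    unfolding order_stat_def by (rule Min_le[OF _ t(1)]) (use fin in auto)
  then show "order_stat k J f \<le> r" using t(2) by simp
qed

lemma order_stat_less_iff: "order_stat k J f < r \<longleftrightarrow> k \<le> card {j \<in> J. f j < r}"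
proof
  assume "order_stat k J f < r"
  then have "card {j \<in> J. f j \<le> order_stat k J f} \<le> card {j \<in> J. f j < r}"
    using fin by (intro card_mono) auto
  then show "k \<le> card {j \<in> J. f j < r}" using order_stat_in[of f] by simp
next
  let ?A = "{j \<in> J. f j < r}"
  assume k: "k \<le> card ?A"
  then have ne: "?A \<noteq> {}" using k1 by (metis card.empty not_one_le_zero order_trans)
  define t where "t = Max (f ` ?A)"
  have t: "t \<in> f ` ?A" unfolding t_def using ne fin by (intro Max_in) auto
  have "f j \<le> t" if "j \<in> ?A" for j unfolding t_def using that fin by (intro Max_ge) auto
  then have "card ?A \<le> card {j \<in> J. f j \<le> t}" using fin by (intro card_mono) auto
  then have "order_stat k J f \<le> t" using k by (simp add: order_stat_le_iff)
  then show "order_stat k J f < r" using t by auto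
qed

lemma order_stat_unique: "(\<And>r. x \<le> r \<longleftrightarrow> k \<le> card {j \<in> J. f j \<le> r}) \<Longrightarrow> x = order_stat k J f"
  by (metis order_stat_le_iff order_refl order_antisym)

text \<open>\<open>F\<close> may be constant on intervals, as a distribution function can be. The
  second inequality therefore counts strictly smaller values: F (f j) < F t forces f j < t for
  monotone \<open>F\<close>.\<close>

lemma order_stat_mono_comp:
  assumes F: "mono F"
  shows "order_stat k J (\<lambda>j. F (f j)) = F (order_stat k J f)"
proof (rule antisym)
  have "card {j \<in> J. f j \<le> order_stat k J f} \<le> card {j \<in> J. F (f j) \<le> F (order_stat k J f)}"
    using fin monoD[OF F, of _ "order_stat k J f"] by (intro card_mono) auto
  then show "order_stat k J (\<lambda>j. F (f j)) \<le> F (order_stat k J f)"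
    using order_stat_in[of f] by (simp add: order_stat_le_iff)
next
  show "F (order_stat k J f) \<le> order_stat k J (\<lambda>j. F (f j))"
  proof (rule ccontr)
    assume "\<not> ?thesis"
    then have "k \<le> card {j \<in> J. F (f j) < F (order_stat k J f)}" by (simp add: not_le order_stat_less_iff)
    also have "\<dots> \<le> card {j \<in> J. f j < order_stat k J f}"
      using fin monoD[OF F, of "order_stat k J f"] by (intro card_mono) (auto simp: not_le[symmetric])
    finally show False using order_stat_less_iff[of f "order_stat k J f"] by simp
  qed
qed

lemma order_stat_subset_le:
  assumes "J \<subseteq> J'" "finite J'"
  shows "order_stat k J' f \<le> order_stat k J f"
  unfolding order_stat_def
proof (rule Min_le)
  obtain t where t: "t \<in> f ` J" "k \<le> card {j \<in> J. f j \<le> t}" "t = order_stat k J f" using order_stat_in[of f] by auto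
  have "card {j \<in> J. f j \<le> t} \<le> card {j \<in> J'. f j \<le> t}" using assms by (intro card_mono) auto
  then show "Min {t \<in> f ` J. k \<le> card {j \<in> J. f j \<le> t}} \<in> {t \<in> f ` J'. k \<le> card {j \<in> J'. f j \<le> t}}"
    using t assms by (auto simp: order_stat_def)
qed (use assms in auto)

lemma borel_measurable_order_stat:
  assumes [measurable]: "\<And>j. j \<in> J \<Longrightarrow> f j \<in> borel_measurable M"
  shows "(\<lambda>\<omega>. order_stat k J (\<lambda>j. f j \<omega>)) \<in> borel_measurable M"
proof (subst borel_measurable_iff_le, intro allI)
  fix r
  have "{\<omega> \<in> space M. order_stat k J (\<lambda>j. f j \<omega>) \<le> r} = {\<omega> \<in> space M. real k \<le> (\<Sum>j\<in>J. indicator {..r} (f j \<omega>))}"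
    using fin by (auto simp: order_stat_le_iff indicator_def sum.If_cases Int_def)
  also have "\<dots> \<in> sets M" by measurable
  finally show "{\<omega> \<in> space M. order_stat k J (\<lambda>j. f j \<omega>) \<le> r} \<in> sets M" .
qed

end

text \<open>If the new statistic lay below both, the inserted index would not contribute to its
  count, and the old indices alone would already reach k. Together with
  \<open>order_stat_subset_le\<close>, a new point has an effect only if its value lies below the
  old statistic.\<close>

lemma order_stat_insert_ge:
  assumes "finite J" "1 \<le> k" "k \<le> card J" "i \<notin> J"
  shows "min (f i) (order_stat k J f) \<le> order_stat k (insert i J) f"
proof (rule ccontr)
  let ?o = "order_stat k (insert i J) f"
  assume "\<not> ?thesis"
  then have l: "?o < f i" "?o < order_stat k J f" by auto
  have "k \<le> card {j \<in> insert i J. f j \<le> ?o}" using order_stat_in[of "insert i J" k f] assms by (simp add: card_insert_if)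
  also have "{j \<in> insert i J. f j \<le> ?o} = {j \<in> J. f j \<le> ?o}" using l by auto
  finally have "order_stat k J f \<le> ?o" using assms by (simp add: order_stat_le_iff)
  then show False using l by simp
qed

lemma order_stat_reindex:
  assumes "bij_betw \<pi> J J'" "finite J" "1 \<le> k" "k \<le> card J"
  shows "order_stat k J (\<lambda>j. f (\<pi> j)) = order_stat k J' f"
proof -
  have c: "card {j \<in> J. f (\<pi> j) \<le> r} = card {j \<in> J'. f j \<le> r}" for r
    using assms(1) by (intro bij_betw_same_card[of \<pi>]) (auto simp: bij_betw_def inj_on_def)
  have "finite J'" using assms(1,2) bij_betw_finite[of \<pi> J J'] by simp
  moreover have "card J' = card J" using bij_betw_same_card[OF assms(1)] by simp
  ultimately show ?thesis using assms c by (intro order_stat_unique) (auto simp: order_stat_le_iff)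
qed

lemma order_stat_cong: "(\<And>j. j \<in> J \<Longrightarrow> f j = g j) \<Longrightarrow> order_stat k J f = order_stat k J g"
proof -
  assume a: "\<And>j. j \<in> J \<Longrightarrow> f j = g j"
  then have "f ` J = g ` J" "\<And>t. {j \<in> J. f j \<le> t} = {j \<in> J. g j \<le> t}" by auto
  then show ?thesis by (simp add: order_stat_def)
qed

section \<open>Nearest-neighbour distances as order statistics\<close>

lemma sorted_nth_le_iff:
  fixes ys :: "real list"
  assumes "sorted ys" "1 \<le> k" "k \<le> length ys"
  shows "ys ! (k - 1) \<le> r \<longleftrightarrow> k \<le> length (filter (\<lambda>y. y \<le> r) ys)"
proof
  assume l: "ys ! (k - 1) \<le> r"
  have "{..<k} \<subseteq> {i. i < length ys \<and> ys ! i \<le> r}"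
  proof
    fix i assume "i \<in> {..<k}"
    then show "i \<in> {i. i < length ys \<and> ys ! i \<le> r}"
      using assms(2,3) order_trans[OF sorted_nth_mono[OF assms(1), of i "k - 1"] l] by simp
  qed
  then have "card {..<k} \<le> card {i. i < length ys \<and> ys ! i \<le> r}" by (intro card_mono) auto
  then show "k \<le> length (filter (\<lambda>y. y \<le> r) ys)" by (simp add: length_filter_conv_card)
next
  assume k: "k \<le> length (filter (\<lambda>y. y \<le> r) ys)"
  show "ys ! (k - 1) \<le> r"
  proof (rule ccontr)
    assume l: "\<not> ys ! (k - 1) \<le> r"
    have "i < k - 1" if "i < length ys" "ys ! i \<le> r" for i
      using that l assms sorted_nth_mono[of ys "k - 1" i] by (meson le_less_linear order_trans)
    then have "card {i. i < length ys \<and> ys ! i \<le> r} \<le> card {..<k - 1}" by (intro card_mono) auto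
    then show False using k assms by (simp add: length_filter_conv_card)
  qed
qed

text \<open>Ties affect only the index that the stable sort selects, not the distance at that
  position, so both sides are determined by the same counts.\<close>

lemma nn_dist_eq_order_stat:
  fixes x :: "nat \<Rightarrow> 'a::metric_space"
  assumes "1 \<le> k" "k + 1 \<le> n" "i \<in> {1..n}"
  shows "nn_dist x n k i = order_stat k ({1..n} - {i}) (\<lambda>j. dist (x i) (x j))"
proof (rule order_stat_unique)
  show kc: "k \<le> card ({1..n} - {i})" using assms by simp
  fix r
  define g where "g = (\<lambda>j. dist (x i) (x j))"
  define xs where "xs = sort_key g (filter (\<lambda>j. j \<noteq> i) [1..<Suc n])"
  have d: "distinct xs" by (simp add: xs_def)
  have s: "set xs = {1..n} - {i}" by (auto simp: xs_def)
  have len: "length xs = card ({1..n} - {i})" using distinct_card[OF d] s by simp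
  have "nn_dist x n k i = map g xs ! (k - 1)"
    using len kc assms by (simp add: nn_dist_def nn_index_def xs_def g_def)
  also have "\<dots> \<le> r \<longleftrightarrow> k \<le> length (filter (\<lambda>y. y \<le> r) (map g xs))"
    using assms len kc by (intro sorted_nth_le_iff) (auto simp: xs_def)
  also have "length (filter (\<lambda>y. y \<le> r) (map g xs)) = card (set (filter (\<lambda>j. g j \<le> r) xs))"
    using distinct_card[OF distinct_filter[OF d], of "\<lambda>j. g j \<le> r"] by (simp add: filter_map o_def)
  also have "set (filter (\<lambda>j. g j \<le> r) xs) = {j \<in> {1..n} - {i}. g j \<le> r}" using s by auto
  finally show "nn_dist x n k i \<le> r \<longleftrightarrow> k \<le> card {j \<in> {1..n} - {i}. dist (x i) (x j) \<le> r}"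
    by (simp add: g_def)
qed (use assms in auto)

section \<open>Order statistics of independent uniform variables\<close>

lemma card_insert_update_in:
  assumes "finite J" "i \<notin> J"
  shows "card {j \<in> insert i J. (x(i := y)) j \<in> A} = card {j \<in> J. x j \<in> A} + (if y \<in> A then 1 else 0)"
proof -
  have "{j \<in> insert i J. (x(i := y)) j \<in> A} = {j \<in> J. x j \<in> A} \<union> (if y \<in> A then {i} else {})"
    using assms by auto
  then show ?thesis using assms by auto
qed

context prob_space
begin

lemma measurable_count_in:
  assumes "finite J" "A \<in> sets M"
  shows "(\<lambda>z. card {j \<in> J. z j \<in> A}) \<in> measurable (Pi\<^sub>M J (\<lambda>_. M)) (count_space UNIV)"
proof -
  have "(\<lambda>z. \<Sum>j\<in>J. indicator A (z j) :: real) \<in> borel_measurable (Pi\<^sub>M J (\<lambda>_. M))"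
    using assms by measurable
  also have "(\<lambda>z. \<Sum>j\<in>J. indicator A (z j) :: real) = (\<lambda>z. real (card {j \<in> J. z j \<in> A}))"
    using assms by (auto simp: indicator_def sum.If_cases Int_def)
  finally have [measurable]: "(\<lambda>z. real (card {j \<in> J. z j \<in> A})) \<in> borel_measurable (Pi\<^sub>M J (\<lambda>_. M))" .
  have "(\<lambda>z. nat \<lfloor>real (card {j \<in> J. z j \<in> A})\<rfloor>) \<in> measurable (Pi\<^sub>M J (\<lambda>_. M)) (count_space UNIV)"
    by measurable
  then show ?thesis by simp
qed

text \<open>Integrating out the inserted coordinate splits the event by whether it lies in
  \<open>A\<close>, which is the recursion of \<open>binomial_tail\<close>.\<close>

lemma emeasure_count_ge:
  assumes "finite J" "A \<in> sets M"
  shows "emeasure (Pi\<^sub>M J (\<lambda>_. M)) {z \<in> space (Pi\<^sub>M J (\<lambda>_. M)). k \<le> card {j \<in> J. z j \<in> A}}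
    = ennreal (binomial_tail (card J) k (prob A))"
  using assms(1)
proof (induction J arbitrary: k)
  case empty
  then show ?case by (simp add: PiM_empty)
next
  case (insert i J)
  interpret product_sigma_finite "\<lambda>_::'b. M" by standard
  let ?E = "\<lambda>J k. {z \<in> space (Pi\<^sub>M J (\<lambda>_. M)). k \<le> card {j \<in> J. z j \<in> A}}"
  have Em: "?E J k \<in> sets (Pi\<^sub>M J (\<lambda>_. M))" if "finite J" for J :: "'b set" and k
    using measurable_count_in[OF that assms(2)] by measurable
  note c = card_insert_update_in[OF insert.hyps]
  have e: "indicator (?E (insert i J) k) (x(i := y)) = (indicator (if y \<in> A then ?E J (k - 1) else ?E J k) x :: ennreal)"
    if "x \<in> space (Pi\<^sub>M J (\<lambda>_. M))" "y \<in> space M" for x y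
    using that c[of x y] by (auto simp: indicator_def space_PiM PiE_def extensional_def split: if_splits)
  have "emeasure (Pi\<^sub>M (insert i J) (\<lambda>_. M)) (?E (insert i J) k) = (\<integral>\<^sup>+z. indicator (?E (insert i J) k) z \<partial>Pi\<^sub>M (insert i J) (\<lambda>_. M))"
    using insert.hyps by (intro nn_integral_indicator[symmetric] Em) simp
  also have "\<dots> = (\<integral>\<^sup>+y. \<integral>\<^sup>+x. indicator (?E (insert i J) k) (x(i := y)) \<partial>Pi\<^sub>M J (\<lambda>_. M) \<partial>M)"
    using insert.hyps by (intro product_nn_integral_insert_rev) (auto intro!: borel_measurable_indicator Em simp del: insert_iff)
  also have "\<dots> = (\<integral>\<^sup>+y. \<integral>\<^sup>+x. indicator (if y \<in> A then ?E J (k - 1) else ?E J k) x \<partial>Pi\<^sub>M J (\<lambda>_. M) \<partial>M)"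
    using e by (intro nn_integral_cong) auto
  also have "\<dots> = (\<integral>\<^sup>+y. ennreal (binomial_tail (card J) (k - 1) (prob A)) * indicator A y
      + ennreal (binomial_tail (card J) k (prob A)) * indicator (space M - A) y \<partial>M)"
    using insert by (intro nn_integral_cong) (auto simp: nn_integral_indicator Em)
  also have "\<dots> = ennreal (binomial_tail (card J) (k - 1) (prob A)) * ennreal (prob A)
      + ennreal (binomial_tail (card J) k (prob A)) * ennreal (1 - prob A)"
    using assms by (subst nn_integral_add) (auto simp: nn_integral_cmult_indicator emeasure_eq_measure prob_compl)
  also have "\<dots> = ennreal (binomial_tail (card (insert i J)) k (prob A))"
    using insert.hyps binomial_tail_bounds[of "prob A"]
    by (simp add: ennreal_mult[symmetric] ennreal_plus[symmetric] mult.commute del: ennreal_plus)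
  finally show ?case .
qed

text \<open>A point that falls into \<open>A\<close> is lost for \<open>B\<close>, so large counts
  in the two sets hinder each other. In the induction the new coordinate lies in \<open>A\<close>,
  in \<open>B\<close> or in neither, and \<open>binomial_tail_negative_dependence_step\<close>
  compares these three terms with the product of the tails.\<close>

lemma emeasure_count_ge_disjoint:
  assumes "finite J" "A \<in> sets M" "B \<in> sets M" "A \<inter> B = {}"
  shows "emeasure (Pi\<^sub>M J (\<lambda>_. M)) {z \<in> space (Pi\<^sub>M J (\<lambda>_. M)). k \<le> card {j \<in> J. z j \<in> A} \<and> l \<le> card {j \<in> J. z j \<in> B}}
    \<le> ennreal (binomial_tail (card J) k (prob A) * binomial_tail (card J) l (prob B))"
  using assms(1)
proof (induction J arbitrary: k l)
  case empty
  then show ?case by (simp add: PiM_empty)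
next
  case (insert i J)
  interpret product_sigma_finite "\<lambda>_::'b. M" by standard
  let ?E = "\<lambda>J k l. {z \<in> space (Pi\<^sub>M J (\<lambda>_. M)). k \<le> card {j \<in> J. z j \<in> A} \<and> l \<le> card {j \<in> J. z j \<in> B}}"
  let ?T = "\<lambda>k l. binomial_tail (card J) k (prob A) * binomial_tail (card J) l (prob B)"
  have Em: "?E J k l \<in> sets (Pi\<^sub>M J (\<lambda>_. M))" if "finite J" for J :: "'b set" and k l
    using measurable_count_in[OF that assms(2)] measurable_count_in[OF that assms(3)] by measurable
  note c = card_insert_update_in[OF insert.hyps]
  have AB: "y \<in> A \<Longrightarrow> y \<notin> B" for y using assms by auto
  have e: "indicator (?E (insert i J) k l) (x(i := y)) =
     (indicator (if y \<in> A then ?E J (k - 1) l else if y \<in> B then ?E J k (l - 1) else ?E J k l) x :: ennreal)"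
    if "x \<in> space (Pi\<^sub>M J (\<lambda>_. M))" "y \<in> space M" for x y
    using that c[of x y A] c[of x y B] AB[of y] by (auto simp: indicator_def space_PiM PiE_def extensional_def split: if_splits)
  have T0: "0 \<le> ?T k l" for k l using binomial_tail_bounds[of "prob A"] binomial_tail_bounds[of "prob B"] by auto
  have pAB: "0 \<le> 1 - prob A - prob B"
    using finite_measure_Union[OF assms(2-4)] prob_le_1[of "A \<union> B"] by simp
  have "emeasure (Pi\<^sub>M (insert i J) (\<lambda>_. M)) (?E (insert i J) k l) = (\<integral>\<^sup>+z. indicator (?E (insert i J) k l) z \<partial>Pi\<^sub>M (insert i J) (\<lambda>_. M))"
    using insert.hyps by (intro nn_integral_indicator[symmetric] Em) simp
  also have "\<dots> = (\<integral>\<^sup>+y. \<integral>\<^sup>+x. indicator (?E (insert i J) k l) (x(i := y)) \<partial>Pi\<^sub>M J (\<lambda>_. M) \<partial>M)"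
    using insert.hyps by (intro product_nn_integral_insert_rev) (auto intro!: borel_measurable_indicator Em simp del: insert_iff)
  also have "\<dots> = (\<integral>\<^sup>+y. \<integral>\<^sup>+x. indicator (if y \<in> A then ?E J (k - 1) l else if y \<in> B then ?E J k (l - 1) else ?E J k l) x \<partial>Pi\<^sub>M J (\<lambda>_. M) \<partial>M)"
    using e by (intro nn_integral_cong) auto
  also have "\<dots> \<le> (\<integral>\<^sup>+y. ennreal (?T (k - 1) l) * indicator A y + (ennreal (?T k (l - 1)) * indicator B y
      + ennreal (?T k l) * indicator (space M - (A \<union> B)) y) \<partial>M)"
    using insert AB by (intro nn_integral_mono) (auto simp: nn_integral_indicator Em)
  also have "\<dots> = ennreal (?T (k - 1) l) * ennreal (prob A) + (ennreal (?T k (l - 1)) * ennreal (prob B)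
      + ennreal (?T k l) * ennreal (1 - prob A - prob B))"
    using assms finite_measure_Union[OF assms(2-4)]
    by (simp add: nn_integral_add nn_integral_cmult_indicator emeasure_eq_measure prob_compl diff_diff_eq)
  also have "\<dots> = ennreal (prob A * ?T (k - 1) l + prob B * ?T k (l - 1) + (1 - prob A - prob B) * ?T k l)"
  proof -
    have "ennreal x * ennreal a + (ennreal y * ennreal b + ennreal z * ennreal c) = ennreal (a * x + b * y + c * z)"
      if "0 \<le> a" "0 \<le> b" "0 \<le> c" "0 \<le> x" "0 \<le> y" "0 \<le> z" for a b c x y z
      using that by (simp add: ennreal_mult ennreal_plus mult.commute add.assoc)
    from this[OF measure_nonneg measure_nonneg pAB T0 T0 T0] show ?thesis .
  qed
  also have "\<dots> \<le> ennreal (binomial_tail (card (insert i J)) k (prob A) * binomial_tail (card (insert i J)) l (prob B))"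
    using insert.hyps binomial_tail_negative_dependence_step[of "prob A" "prob B" "card J" k l]
    by (intro ennreal_leI) (simp del: binomial_tail.simps)
  finally show ?case .
qed

end

text \<open>The square of ln t <= t^(e/2) / (e/2). Here and in the reflected version below, e = 1/2,
  e = 1 and e = \<epsilon> yield the later constants 16, 4 and \<open>powr_const\<close>.\<close>

lemma ln_squared_le_powr:
  assumes "1 \<le> t" "0 < e"
  shows "(ln t)\<^sup>2 \<le> (2 / e)\<^sup>2 * t powr (e::real)"
proof -
  have "ln t \<le> t powr (e / 2) / (e / 2)" using assms by (intro ln_powr_bound) auto
  then have "(ln t)\<^sup>2 \<le> (t powr (e / 2) / (e / 2))\<^sup>2" using assms by (intro power_mono) auto
  also have "\<dots> = (2 / e)\<^sup>2 * (t powr (e / 2))\<^sup>2" by (simp add: power_divide power_mult_distrib field_simps)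
  also have "(t powr (e / 2))\<^sup>2 = t powr e" using assms by (simp add: powr_power)
  finally show ?thesis .
qed

lemma ln_squared_le_powr_minus:
  assumes "0 < t" "t \<le> 1" "0 < e"
  shows "(ln t)\<^sup>2 \<le> (2 / e)\<^sup>2 * t powr (- e::real)"
  using ln_squared_le_powr[of "1 / t" e] assms by (simp add: ln_div powr_divide powr_minus_divide)

lemma nn_integral_inverse:
  assumes "0 < x" "x \<le> a"
  shows "(\<integral>\<^sup>+s. ennreal (1 / s) * indicator {x..a} s \<partial>lborel) = ennreal (ln a - ln x)"
  by (rule nn_integral_FTC_Icc) (use assms in \<open>auto intro!: derivative_eq_intros simp: divide_inverse\<close>)

text \<open>The bounds are required at every point, so that order statistics of \<open>u\<close> lie
  in [0, 1] pointwise and not just almost everywhere.\<close>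

definition uniform_on_unit :: "'a measure \<Rightarrow> ('a \<Rightarrow> real) \<Rightarrow> bool" where
  "uniform_on_unit M u \<longleftrightarrow> u \<in> borel_measurable M \<and> (\<forall>z. 0 \<le> u z \<and> u z \<le> 1) \<and>
     (\<forall>s\<in>{0..1}. Sigma_Algebra.measure M {z \<in> space M. u z \<le> s} = s)"

context prob_space
begin

lemma distr_uniform_on_unit:
  assumes u: "uniform_on_unit M u"
  shows "distr M borel u = uniform_measure lborel {0..1}"
proof (rule cdf_unique)
  have [measurable]: "u \<in> borel_measurable M" using u by (simp add: uniform_on_unit_def)
  show "real_distribution (distr M borel u)" by simp
  interpret D: prob_space "uniform_measure lborel {0..1::real}"
    by (rule prob_space_uniform_measure) auto
  show "real_distribution (uniform_measure lborel {0..1::real})"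
    by (simp add: real_distribution_def real_distribution_axioms_def D.prob_space_axioms)
  show "cdf (distr M borel u) = cdf (uniform_measure lborel {0..1})"
  proof
    fix s :: real
    have "cdf (distr M borel u) s = prob {z \<in> space M. u z \<le> s}"
      by (simp add: cdf_def measure_distr vimage_def Int_def conj_commute)
    also have "\<dots> = (if s < 0 then 0 else min s 1)"
    proof -
      have "prob {z \<in> space M. u z \<le> s} = 0" if "s < 0"
      proof -
        have "{z \<in> space M. u z \<le> s} = {}" using u that by (auto simp: uniform_on_unit_def not_le intro: less_le_trans)
        then show ?thesis by (simp only: measure_empty)
      qed
      moreover have "prob {z \<in> space M. u z \<le> s} = 1" if "s > 1"
      proof -
        have "{z \<in> space M. u z \<le> s} = space M" using u that by (auto simp: uniform_on_unit_def intro: order_trans less_imp_le)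
        then show ?thesis by (simp only: prob_space)
      qed
      moreover have "prob {z \<in> space M. u z \<le> s} = s" if "0 \<le> s" "s \<le> 1" using u that by (simp add: uniform_on_unit_def)
      ultimately show ?thesis by (cases "s < 0"; cases "s > 1") (simp_all add: prob_space)
    qed
    also have "\<dots> = cdf (uniform_measure lborel {0..1}) s"
    proof -
      have "{0..1} \<inter> {..s} = (if s < 0 then {} else {0..min s 1})" by (auto simp: min_def)
      then show ?thesis by (simp add: cdf_def measure_uniform_measure min.commute)
    qed
    finally show "cdf (distr M borel u) s = cdf (uniform_measure lborel {0..1}) s" .
  qed
qed

lemma nn_integral_uniform_on_unit:
  assumes u: "uniform_on_unit M u" and [measurable]: "g \<in> borel_measurable borel"
  shows "(\<integral>\<^sup>+z. g (u z) \<partial>M) = (\<integral>\<^sup>+s\<in>{0..1}. g s \<partial>lborel)"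
proof -
  have [measurable]: "u \<in> borel_measurable M" using u by (simp add: uniform_on_unit_def)
  have "(\<integral>\<^sup>+z. g (u z) \<partial>M) = (\<integral>\<^sup>+s. g s \<partial>distr M borel u)" by (simp add: nn_integral_distr)
  also have "\<dots> = (\<integral>\<^sup>+s. g s * indicator {0..1} s \<partial>lborel)"
    unfolding distr_uniform_on_unit[OF u] by (simp add: nn_integral_uniform_measure divide_ennreal_def)
  finally show ?thesis .
qed

text \<open>The singularity of exponent -1/2 is integrable and dominates squared logarithms near 0;
  rescaling to level c makes its mean proportional to c. Equality can fail for c > 1, where part of
  the interval up to c lies outside [0, 1].\<close>

lemma nn_integral_uniform_powr:
  assumes u: "uniform_on_unit M u" and c: "0 < c"
  shows "(\<integral>\<^sup>+z. ennreal ((u z / c) powr (- (1/2)) * indicator {..c} (u z)) \<partial>M) \<le> ennreal (2 * c)"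
proof -
  have i: "((\<lambda>s. (s / c) powr (- (1/2))) has_integral 2 * c) {0..c}"
  proof -
    have "((\<lambda>s. s powr (- (1/2))) has_integral (c powr (1/2) / (1/2))) {0..c}"
      using has_integral_powr_from_0[of "- (1/2)" c] c by simp
    from has_integral_mult_right[OF this, of "c powr (1/2)"]
    have "((\<lambda>s. c powr (1/2) * s powr (- (1/2))) has_integral c powr (1/2) * (c powr (1/2) / (1/2))) {0..c}" .
    also have "c powr (1/2) * (c powr (1/2) / (1/2)) = 2 * c" using c by (simp add: powr_half_sqrt)
    finally show ?thesis
      by (rule has_integral_eq[rotated]) (use c in \<open>auto simp: powr_divide powr_minus_divide\<close>)
  qed
  have "(\<integral>\<^sup>+z. ennreal ((u z / c) powr (- (1/2)) * indicator {..c} (u z)) \<partial>M)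
      = (\<integral>\<^sup>+s\<in>{0..1}. ennreal ((s / c) powr (- (1/2)) * indicator {..c} s) \<partial>lborel)"
    by (rule nn_integral_uniform_on_unit[OF u]) measurable
  also have "\<dots> \<le> (\<integral>\<^sup>+s. ennreal ((s / c) powr (- (1/2))) * indicator {0..c} s \<partial>lborel)"
    by (intro nn_integral_mono) (auto split: split_indicator)
  also have "\<dots> = ennreal (2 * c)" by (rule nn_integral_has_integral_lebesgue'[OF _ i]) auto
  finally show ?thesis .
qed

end

section \<open>Order statistics of uniform coordinates under a product measure\<close>

locale uniform_sample = prob_space M for M :: "'a measure" +
  fixes J :: "nat set" and k :: nat
  assumes finJ: "finite J" and k1: "1 \<le> k" and kJ: "k \<le> card J"
begin

abbreviation "P \<equiv> Pi\<^sub>M J (\<lambda>_. M)"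

sublocale P: prob_space P
  by (rule prob_space_PiM) (rule prob_space_axioms)

definition ord :: "('a \<Rightarrow> real) \<Rightarrow> (nat \<Rightarrow> 'a) \<Rightarrow> real" where
  "ord u z = order_stat k J (\<lambda>j. u (z j))"

lemma borel_measurable_ord [measurable]:
  assumes [measurable]: "u \<in> borel_measurable M"
  shows "ord u \<in> borel_measurable P"
proof -
  have "(\<lambda>z. order_stat k J (\<lambda>j. u (z j))) \<in> borel_measurable P"
    by (rule borel_measurable_order_stat[OF finJ k1 kJ]) measurable
  then show ?thesis unfolding ord_def .
qed

lemma emeasure_ord_le:
  assumes u: "uniform_on_unit M u" and s: "0 \<le> s" "s \<le> 1"
  shows "emeasure P {z \<in> space P. ord u z \<le> s} = ennreal (binomial_tail (card J) k s)"
proof -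
  have [measurable]: "u \<in> borel_measurable M" using u by (simp add: uniform_on_unit_def)
  let ?A = "{z \<in> space M. u z \<le> s}"
  have "{z \<in> space P. ord u z \<le> s} = {z \<in> space P. k \<le> card {j \<in> J. z j \<in> ?A}}"
  proof -
    have "{j \<in> J. z j \<in> ?A} = {j \<in> J. u (z j) \<le> s}" if "z \<in> space P" for z
      using that by (auto simp: space_PiM)
    then show ?thesis by (auto simp: ord_def order_stat_le_iff[OF finJ k1 kJ])
  qed
  then show ?thesis using emeasure_count_ge[OF finJ, of ?A k] u s by (simp add: uniform_on_unit_def)
qed

lemma ord_bounds:
  assumes u: "uniform_on_unit M u"
  shows "0 \<le> ord u z" "ord u z \<le> 1"
  using order_stat_attained[OF finJ k1 kJ, of "\<lambda>j. u (z j)"] u by (auto simp: ord_def uniform_on_unit_def)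

lemma AE_ord_pos:
  assumes u: "uniform_on_unit M u"
  shows "AE z in P. 0 < ord u z"
proof -
  have [measurable]: "u \<in> borel_measurable M" using u by (simp add: uniform_on_unit_def)
  have "emeasure P {z \<in> space P. ord u z \<le> 0} = 0"
    using emeasure_ord_le[OF u, of 0] k1 by (simp add: binomial_tail_at_ends)
  then have "AE z in P. \<not> ord u z \<le> 0" by (subst AE_iff_measurable[OF _ refl]) auto
  then show ?thesis by (simp add: not_le)
qed

text \<open>The logarithm truncated at a is the integral of ds/s over the levels s < a already
  reached by the statistic. By Tonelli's theorem, expectations of logarithms become integrals of the
  probabilities that \<open>ord u\<close> is at most s.\<close>

lemma ord_layer_cake:
  assumes "0 < ord u z" "0 < a"
  shows "ennreal (ln a - ln (min (ord u z) a)) = (\<integral>\<^sup>+s. ennreal (1 / s) * indicator {0<..<a} s * indicator {ord u z..} s \<partial>lborel)"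
proof -
  have "(\<integral>\<^sup>+s. ennreal (1 / s) * indicator {0<..<a} s * indicator {ord u z..} s \<partial>lborel)
     = (\<integral>\<^sup>+s. ennreal (1 / s) * indicator {min (ord u z) a..a} s \<partial>lborel)"
  proof (rule nn_integral_cong_AE)
    have "AE s in lborel. s \<noteq> a" by (rule AE_lborel_singleton)
    then show "AE s in lborel. ennreal (1 / s) * indicator {0<..<a} s * indicator {ord u z..} s = ennreal (1 / s) * indicator {min (ord u z) a..a} s"
      by eventually_elim (use assms in \<open>auto split: split_indicator\<close>)
  qed
  then show ?thesis using assms by (simp add: nn_integral_inverse)
qed

lemma nn_integral_ord_tail:
  assumes u: "uniform_on_unit M u" and a: "0 < a" "a \<le> 1"
  shows "(\<integral>\<^sup>+z. ennreal (ln a - ln (min (ord u z) a)) \<partial>P)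
     = (\<integral>\<^sup>+s. ennreal (binomial_tail (card J) k s / s) * indicator {0<..<a} s \<partial>lborel)"
proof -
  have [measurable]: "u \<in> borel_measurable M" using u by (simp add: uniform_on_unit_def)
  interpret pair_sigma_finite P lborel by standard
  have "(\<integral>\<^sup>+z. ennreal (ln a - ln (min (ord u z) a)) \<partial>P)
     = (\<integral>\<^sup>+z. \<integral>\<^sup>+s. ennreal (1 / s) * indicator {0<..<a} s * indicator {ord u z..} s \<partial>lborel \<partial>P)"
    using AE_ord_pos[OF u] by (intro nn_integral_cong_AE) (auto simp: ord_layer_cake a)
  also have "\<dots> = (\<integral>\<^sup>+s. \<integral>\<^sup>+z. ennreal (1 / s) * indicator {0<..<a} s * indicator {ord u z..} s \<partial>P \<partial>lborel)"
  proof (rule Fubini'[symmetric])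
    have [measurable]: "Measurable.pred (P \<Otimes>\<^sub>M borel) (\<lambda>x. snd x \<in> {ord u (fst x)..})"
      unfolding atLeast_iff by measurable
    show "(\<lambda>(z, s). ennreal (1 / s) * indicator {0<..<a} s * indicator {ord u z..} s) \<in> borel_measurable (P \<Otimes>\<^sub>M lborel)" 
      by measurable
  qed
  also have "\<dots> = (\<integral>\<^sup>+s. ennreal (binomial_tail (card J) k s / s) * indicator {0<..<a} s \<partial>lborel)"
  proof (intro nn_integral_cong)
    fix s :: real
    show "(\<integral>\<^sup>+z. ennreal (1 / s) * indicator {0<..<a} s * indicator {ord u z..} s \<partial>P) = ennreal (binomial_tail (card J) k s / s) * indicator {0<..<a} s"
    proof (cases "s \<in> {0<..<a}")
      case True
      have "(\<integral>\<^sup>+z. ennreal (1 / s) * indicator {0<..<a} s * indicator {ord u z..} s \<partial>P) = (\<integral>\<^sup>+z. ennreal (1 / s) * indicator {z \<in> space P. ord u z \<le> s} z \<partial>P)"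
        using True by (intro nn_integral_cong) (auto split: split_indicator)
      also have "\<dots> = ennreal (1 / s) * ennreal (binomial_tail (card J) k s)"
        using True a by (subst nn_integral_cmult_indicator) (auto simp: emeasure_ord_le[OF u])
      finally show ?thesis using True a binomial_tail_bounds[of s "card J" k]
        by (simp add: ennreal_mult[symmetric])
    qed simp
  qed
  finally show ?thesis .
qed

lemma nn_integral_neg_ln_ord:
  assumes u: "uniform_on_unit M u"
  shows "(\<integral>\<^sup>+z. ennreal (- ln (ord u z)) \<partial>P) = ennreal (harm (card J) - harm (k - 1))"
proof -
  have "(\<integral>\<^sup>+z. ennreal (- ln (ord u z)) \<partial>P) = (\<integral>\<^sup>+z. ennreal (ln 1 - ln (min (ord u z) 1)) \<partial>P)"
    using ord_bounds[OF u] by (simp add: min_absorb1)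
  also have "\<dots> = (\<integral>\<^sup>+s. ennreal (binomial_tail (card J) k s / s) * indicator {0<..<1} s \<partial>lborel)"
    by (rule nn_integral_ord_tail[OF u]) auto
  also have "\<dots> = (\<integral>\<^sup>+s. ennreal (binomial_tail (card J) k s / s) * indicator {0..1} s \<partial>lborel)"
  proof (rule nn_integral_cong_AE)
    have "AE s in lborel. s \<noteq> (1::real)" by (rule AE_lborel_singleton)
    then show "AE s in lborel. ennreal (binomial_tail (card J) k s / s) * indicator {0<..<1} s = ennreal (binomial_tail (card J) k s / s) * indicator {0..1} s"
      by eventually_elim (auto split: split_indicator)
  qed
  also have "\<dots> = ennreal (harm (card J) - harm (k - 1))"
    by (rule nn_integral_has_integral_lebesgue'[OF _ has_integral_binomial_tail_div[OF k1 kJ]])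
       (use binomial_tail_bounds in auto)
  finally show ?thesis .
qed

lemma nn_integral_ord:
  assumes u: "uniform_on_unit M u"
  shows "(\<integral>\<^sup>+z. ennreal (ord u z) \<partial>P) = ennreal (real k / (real (card J) + 1))"
proof -
  have [measurable]: "u \<in> borel_measurable M" using u by (simp add: uniform_on_unit_def)
  interpret pair_sigma_finite P lborel by standard
  have "(\<integral>\<^sup>+z. ennreal (ord u z) \<partial>P) = (\<integral>\<^sup>+z. \<integral>\<^sup>+s. indicator {0..1} s * indicator {..<ord u z} s \<partial>lborel \<partial>P)"
  proof (intro nn_integral_cong)
    fix z
    have "(\<integral>\<^sup>+s. indicator {0..1::real} s * indicator {..<ord u z} s \<partial>lborel) = (\<integral>\<^sup>+s. indicator {0..<ord u z} s \<partial>lborel)"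
      using ord_bounds[OF u, of z] by (intro nn_integral_cong) (auto split: split_indicator)
    then show "ennreal (ord u z) = (\<integral>\<^sup>+s. indicator {0..1} s * indicator {..<ord u z} s \<partial>lborel)"
      using ord_bounds[OF u, of z] by simp
  qed
  also have "\<dots> = (\<integral>\<^sup>+s. \<integral>\<^sup>+z. indicator {0..1} s * indicator {..<ord u z} s \<partial>P \<partial>lborel)"
  proof (rule Fubini'[symmetric])
    have [measurable]: "Measurable.pred (P \<Otimes>\<^sub>M borel) (\<lambda>x. snd x \<in> {..<ord u (fst x)})"
      unfolding lessThan_iff by measurable
    show "(\<lambda>(z, s). indicator {0..1} s * indicator {..<ord u z} s :: ennreal) \<in> borel_measurable (P \<Otimes>\<^sub>M lborel)"
      by measurable
  qed
  also have "\<dots> = (\<integral>\<^sup>+s. ennreal (1 - binomial_tail (card J) k s) * indicator {0..1} s \<partial>lborel)"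
  proof (intro nn_integral_cong)
    fix s :: real
    show "(\<integral>\<^sup>+z. indicator {0..1} s * indicator {..<ord u z} s \<partial>P) = ennreal (1 - binomial_tail (card J) k s) * indicator {0..1} s"
    proof (cases "s \<in> {0..1}")
      case True
      have "(\<integral>\<^sup>+z. indicator {0..1} s * indicator {..<ord u z} s \<partial>P) = (\<integral>\<^sup>+z. indicator (space P - {z \<in> space P. ord u z \<le> s}) z \<partial>P)"
        using True by (intro nn_integral_cong) (auto split: split_indicator)
      also have "\<dots> = emeasure P (space P - {z \<in> space P. ord u z \<le> s})" by (rule nn_integral_indicator) measurable
      also have "\<dots> = 1 - ennreal (binomial_tail (card J) k s)"
        using True by (subst emeasure_compl) (auto simp: emeasure_ord_le[OF u] P.emeasure_space_1)
      also have "\<dots> = ennreal (1 - binomial_tail (card J) k s)"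
        using True binomial_tail_bounds[of s "card J" k] by (simp add: ennreal_minus flip: ennreal_1)
      finally show ?thesis using True by simp
    qed simp
  qed
  also have "\<dots> = ennreal (1 - (1 - real k / (real (card J) + 1)))"
  proof (rule nn_integral_has_integral_lebesgue')
    show "((\<lambda>s. 1 - binomial_tail (card J) k s) has_integral 1 - (1 - real k / (real (card J) + 1))) {0..1}"
      using has_integral_const_real[of "1::real" 0 1] kJ
      by (intro has_integral_diff has_integral_binomial_tail) auto
  qed (use binomial_tail_bounds in auto)
  finally show ?thesis by simp
qed

text \<open>A bound free of the sample size. For c U <= 1 the order statistic U is one of the
  coordinates, so the squared logarithm is at most 16 times a sum of card J singular terms of mean
  at most 2/c each, which gives 32. For c U > 1 it is at most 4 c U, and the mean k / (card J + 1)
  of U gives 4 k.\<close>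

lemma nn_integral_ln_ord_squared:
  assumes u: "uniform_on_unit M u" and c: "real (card J) \<le> c" "c \<le> real (card J) + 1"
  shows "(\<integral>\<^sup>+z. ennreal ((ln (c * ord u z))\<^sup>2) \<partial>P) \<le> ennreal (32 + 4 * real k)"
proof -
  have [measurable]: "u \<in> borel_measurable M" using u by (simp add: uniform_on_unit_def)
  have c0: "c > 0" using c k1 kJ by linarith
  let ?g = "\<lambda>x. (x / (1 / c)) powr (- (1/2)) * indicator {..1 / c} x"
  have pt: "ennreal ((ln (c * ord u z))\<^sup>2) \<le> ennreal 16 * (\<Sum>j\<in>J. ennreal (?g (u (z j)))) + ennreal (4 * c) * ennreal (ord u z)"
    if pos: "0 < ord u z" for z
  proof -
    obtain j where j: "j \<in> J" "ord u z = u (z j)"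
      using order_stat_attained[OF finJ k1 kJ, of "\<lambda>j. u (z j)"] by (auto simp: ord_def)
    have "(ln (c * ord u z))\<^sup>2 \<le> 16 * ?g (ord u z) + 4 * c * ord u z"
    proof (cases "c * ord u z \<le> 1")
      case True
      have "(ln (c * ord u z))\<^sup>2 \<le> (2 / (1/2))\<^sup>2 * (c * ord u z) powr (- (1/2))"
        using True pos c0 by (intro ln_squared_le_powr_minus) auto
      also have "\<dots> = 16 * ?g (ord u z)" using True c0 by (simp add: field_simps)
      finally show ?thesis using pos c0 by (smt (verit) mult_pos_pos)
    next
      case False
      have "(ln (c * ord u z))\<^sup>2 \<le> (2 / 1)\<^sup>2 * (c * ord u z) powr 1"
        using False by (intro ln_squared_le_powr) auto
      also have "\<dots> = 4 * c * ord u z" using pos c0 by simp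
      finally show ?thesis by (simp add: add_increasing)
    qed
    then have "ennreal ((ln (c * ord u z))\<^sup>2) \<le> ennreal (16 * ?g (ord u z) + 4 * c * ord u z)" by (rule ennreal_leI)
    also have "\<dots> = ennreal 16 * ennreal (?g (ord u z)) + ennreal (4 * c) * ennreal (ord u z)"
      using pos c0 by (simp add: ennreal_mult ennreal_plus mult.assoc del: ennreal_numeral)
    also have "\<dots> \<le> ennreal 16 * (\<Sum>j\<in>J. ennreal (?g (u (z j)))) + ennreal (4 * c) * ennreal (ord u z)"
      unfolding j(2) using finJ j(1) by (intro add_right_mono mult_left_mono member_le_sum) auto
    finally show ?thesis .
  qed
  have comp: "(\<integral>\<^sup>+z. ennreal (?g (u (z j))) \<partial>P) \<le> ennreal (2 / c)" if "j \<in> J" for j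
  proof -
    have "(\<integral>\<^sup>+z. ennreal (?g (u (z j))) \<partial>P) = (\<integral>\<^sup>+y. ennreal (?g (u y)) \<partial>distr P M (\<lambda>z. z j))"
      using that by (subst nn_integral_distr) auto
    also have "distr P M (\<lambda>z. z j) = M"
      using that by (intro distr_PiM_component) (auto intro: prob_space_axioms)
    also have "(\<integral>\<^sup>+y. ennreal (?g (u y)) \<partial>M) \<le> ennreal (2 * (1 / c))"
      by (rule nn_integral_uniform_powr[OF u]) (use c0 in auto)
    finally show ?thesis by simp
  qed
  have "(\<integral>\<^sup>+z. ennreal ((ln (c * ord u z))\<^sup>2) \<partial>P)
      \<le> (\<integral>\<^sup>+z. ennreal 16 * (\<Sum>j\<in>J. ennreal (?g (u (z j)))) + ennreal (4 * c) * ennreal (ord u z) \<partial>P)"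
    by (intro nn_integral_mono_AE eventually_mono[OF AE_ord_pos[OF u]] pt)
  also have "\<dots> = ennreal 16 * (\<Sum>j\<in>J. \<integral>\<^sup>+z. ennreal (?g (u (z j))) \<partial>P) + ennreal (4 * c) * (\<integral>\<^sup>+z. ennreal (ord u z) \<partial>P)"
    by (subst nn_integral_add, measurable, measurable, subst nn_integral_cmult, measurable, subst nn_integral_cmult, measurable, subst nn_integral_sum, measurable)
  also have "\<dots> \<le> ennreal 16 * (\<Sum>j\<in>J. ennreal (2 / c)) + ennreal (4 * c) * ennreal (real k / (real (card J) + 1))"
    unfolding nn_integral_ord[OF u] by (intro add_right_mono mult_left_mono sum_mono comp) auto
  also have "\<dots> = ennreal (16 * (real (card J) * (2 / c)) + 4 * c * (real k / (real (card J) + 1)))"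
    using c0 by (simp add: ennreal_of_nat_eq_real_of_nat ennreal_mult[symmetric] ennreal_plus[symmetric] del: ennreal_numeral ennreal_plus)
  also have "\<dots> \<le> ennreal (32 + 4 * real k)"
  proof (rule ennreal_leI)
    have "real (card J) / c \<le> 1" using c c0 by simp
    moreover have "c * (real k / (real (card J) + 1)) \<le> real k"
      using c mult_right_mono[OF c(2), of "real k"] by (simp add: field_simps)
    ultimately show "16 * (real (card J) * (2 / c)) + 4 * c * (real k / (real (card J) + 1)) \<le> 32 + 4 * real k" by simp
  qed
  finally show ?thesis .
qed

end

section \<open>Products and squares of square-integrable functions\<close>

lemma mult_le_half_squares: "a * b \<le> (a\<^sup>2 + b\<^sup>2) / (2::real)"
  using sum_squares_bound[of a b] by simp

text \<open>Stands in for the Cauchy-Schwarz inequality: if t is the square root of a bound on the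
  second moment of y, the mean of x y is of order t.\<close>

lemma mult_le_weighted_squares:
  assumes "0 < (t::real)"
  shows "x * y \<le> t * x\<^sup>2 / 2 + y\<^sup>2 / (2 * t)"
proof -
  have "0 \<le> (t * x - y)\<^sup>2 / (2 * t)" using assms by simp
  also have "\<dots> = t * x\<^sup>2 / 2 + y\<^sup>2 / (2 * t) - x * y"
    using assms by (simp add: power2_eq_square field_simps)
  finally show ?thesis by simp
qed

lemma integrable_mult_of_squares:
  fixes f g :: "'a \<Rightarrow> real"
  assumes [measurable]: "f \<in> borel_measurable M" "g \<in> borel_measurable M"
    and "integrable M (\<lambda>x. (f x)\<^sup>2)" "integrable M (\<lambda>x. (g x)\<^sup>2)"
  shows "integrable M (\<lambda>x. f x * g x)"
proof (rule Bochner_Integration.integrable_bound)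
  show "integrable M (\<lambda>x. (f x)\<^sup>2 + (g x)\<^sup>2)" using assms by auto
  show "AE x in M. norm (f x * g x) \<le> norm ((f x)\<^sup>2 + (g x)\<^sup>2)"
  proof (intro AE_I2)
    fix x
    have "2 * (\<bar>f x\<bar> * \<bar>g x\<bar>) \<le> (f x)\<^sup>2 + (g x)\<^sup>2"
      using sum_squares_bound[of "\<bar>f x\<bar>" "\<bar>g x\<bar>"] by (simp add: mult.assoc)
    moreover have "0 \<le> \<bar>f x\<bar> * \<bar>g x\<bar>" by simp
    ultimately have "\<bar>f x\<bar> * \<bar>g x\<bar> \<le> (f x)\<^sup>2 + (g x)\<^sup>2" by linarith
    then show "norm (f x * g x) \<le> norm ((f x)\<^sup>2 + (g x)\<^sup>2)" by (simp add: abs_mult)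
  qed
qed measurable

lemma integrable_square_add:
  fixes f g :: "'a \<Rightarrow> real"
  assumes [measurable]: "f \<in> borel_measurable M" "g \<in> borel_measurable M"
    and "integrable M (\<lambda>x. (f x)\<^sup>2)" "integrable M (\<lambda>x. (g x)\<^sup>2)"
  shows "integrable M (\<lambda>x. (f x + g x)\<^sup>2)"
  unfolding power2_sum using integrable_mult_of_squares[OF assms] assms
  by (auto simp: mult.assoc)

context uniform_sample
begin

text \<open>The layer-cake formula is applied to both factors. For levels s, t < a the assumption
  \<open>sep\<close> makes the sets where u <= s and v <= t disjoint, so
  \<open>emeasure_count_ge_disjoint\<close> bounds the joint probability by the product.\<close>

lemma nn_integral_ord_tail_product:
  assumes u: "uniform_on_unit M u" and v: "uniform_on_unit M v" and a: "0 < a" "a \<le> 1"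
    and sep: "\<And>z. z \<in> space M \<Longrightarrow> a \<le> u z \<or> a \<le> v z"
  shows "(\<integral>\<^sup>+z. ennreal (ln a - ln (min (ord u z) a)) * ennreal (ln a - ln (min (ord v z) a)) \<partial>P)
     \<le> (\<integral>\<^sup>+z. ennreal (ln a - ln (min (ord u z) a)) \<partial>P) * (\<integral>\<^sup>+z. ennreal (ln a - ln (min (ord v z) a)) \<partial>P)"
proof -
  have [measurable]: "u \<in> borel_measurable M" "v \<in> borel_measurable M" using u v by (simp_all add: uniform_on_unit_def)
  interpret pair_sigma_finite P lborel by standard
  let ?h = "\<lambda>w s z. ennreal (1 / s) * indicator {0<..<a} s * indicator {ord w z..} s :: ennreal"
  let ?q = "\<lambda>s. ennreal (binomial_tail (card J) k s / s) * indicator {0<..<a} s :: ennreal"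
  have hm1[measurable]: "(\<lambda>x. ?h w (f x) (g x)) \<in> borel_measurable N"
    if [measurable]: "w \<in> borel_measurable M" "f \<in> borel_measurable N" "g \<in> measurable N P" for w and N :: "'n measure" and f g
  proof -
    have [measurable]: "Measurable.pred N (\<lambda>x. f x \<in> {ord w (g x)..})"
      unfolding atLeast_iff by measurable
    show ?thesis by measurable
  qed
  have "(\<integral>\<^sup>+z. ennreal (ln a - ln (min (ord u z) a)) * ennreal (ln a - ln (min (ord v z) a)) \<partial>P)
      = (\<integral>\<^sup>+z. (\<integral>\<^sup>+s. ?h u s z \<partial>lborel) * (\<integral>\<^sup>+t. ?h v t z \<partial>lborel) \<partial>P)"
  proof (rule nn_integral_cong_AE)
    show "AE z in P. ennreal (ln a - ln (min (ord u z) a)) * ennreal (ln a - ln (min (ord v z) a))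
       = (\<integral>\<^sup>+s. ?h u s z \<partial>lborel) * (\<integral>\<^sup>+t. ?h v t z \<partial>lborel)"
      using AE_ord_pos[OF u] AE_ord_pos[OF v] by eventually_elim (simp only: ord_layer_cake a)
  qed
  also have "\<dots> = (\<integral>\<^sup>+z. (\<integral>\<^sup>+s. (\<integral>\<^sup>+t. ?h u s z * ?h v t z \<partial>lborel) \<partial>lborel) \<partial>P)"
    by (intro nn_integral_cong) (subst nn_integral_multc[symmetric], measurable, intro nn_integral_cong, subst nn_integral_cmult, measurable)
  also have "\<dots> = (\<integral>\<^sup>+s. (\<integral>\<^sup>+z. (\<integral>\<^sup>+t. ?h u s z * ?h v t z \<partial>lborel) \<partial>P) \<partial>lborel)"
    by (rule Fubini'[symmetric]) measurable
  also have "\<dots> = (\<integral>\<^sup>+s. (\<integral>\<^sup>+t. (\<integral>\<^sup>+z. ?h u s z * ?h v t z \<partial>P) \<partial>lborel) \<partial>lborel)"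
    by (intro nn_integral_cong Fubini'[symmetric]) measurable
  also have "\<dots> \<le> (\<integral>\<^sup>+s. (\<integral>\<^sup>+t. ?q s * ?q t \<partial>lborel) \<partial>lborel)"
  proof (intro nn_integral_mono)
    fix s t :: real
    show "(\<integral>\<^sup>+z. ?h u s z * ?h v t z \<partial>P) \<le> ?q s * ?q t"
    proof (cases "s \<in> {0<..<a} \<and> t \<in> {0<..<a}")
      case True
      let ?A = "{z \<in> space M. u z \<le> s}" and ?B = "{z \<in> space M. v z \<le> t}"
      let ?E = "{z \<in> space P. ord u z \<le> s \<and> ord v z \<le> t}"
      have "(\<integral>\<^sup>+z. ?h u s z * ?h v t z \<partial>P) = (\<integral>\<^sup>+z. (ennreal (1 / s) * ennreal (1 / t)) * indicator ?E z \<partial>P)"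
        using True by (intro nn_integral_cong) (auto split: split_indicator)
      also have "\<dots> = (ennreal (1 / s) * ennreal (1 / t)) * emeasure P ?E"
        by (rule nn_integral_cmult_indicator) measurable
      also have "?E = {z \<in> space P. k \<le> card {j \<in> J. z j \<in> ?A} \<and> k \<le> card {j \<in> J. z j \<in> ?B}}"
      proof -
        have "{j \<in> J. z j \<in> ?A} = {j \<in> J. u (z j) \<le> s}" "{j \<in> J. z j \<in> ?B} = {j \<in> J. v (z j) \<le> t}" if "z \<in> space P" for z
          using that by (auto simp: space_PiM)
        then show ?thesis by (auto simp: ord_def order_stat_le_iff[OF finJ k1 kJ])
      qed
      also have "emeasure P \<dots> \<le> ennreal (binomial_tail (card J) k (prob ?A) * binomial_tail (card J) k (prob ?B))"
        using sep True by (intro emeasure_count_ge_disjoint finJ) (force+)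
      also have "prob ?A = s" using u True a by (simp add: uniform_on_unit_def)
      also have "prob ?B = t" using v True a by (simp add: uniform_on_unit_def)
      also have "(ennreal (1 / s) * ennreal (1 / t)) * ennreal (binomial_tail (card J) k s * binomial_tail (card J) k t) = ?q s * ?q t"
        using True a binomial_tail_bounds[of s "card J" k] binomial_tail_bounds[of t "card J" k]
        by (simp add: ennreal_mult[symmetric] mult.commute)
      finally show ?thesis by (simp add: mult_left_mono)
    qed auto
  qed
  also have "\<dots> = (\<integral>\<^sup>+s. ?q s \<partial>lborel) * (\<integral>\<^sup>+t. ?q t \<partial>lborel)"
    by (subst nn_integral_multc[symmetric], measurable, intro nn_integral_cong, subst nn_integral_cmult, measurable)
  also have "\<dots> = (\<integral>\<^sup>+z. ennreal (ln a - ln (min (ord u z) a)) \<partial>P) * (\<integral>\<^sup>+z. ennreal (ln a - ln (min (ord v z) a)) \<partial>P)"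
    using nn_integral_ord_tail[OF u a] nn_integral_ord_tail[OF v a] by simp
  finally show ?thesis .
qed

lemma integrable_ln_ord_squared:
  assumes u: "uniform_on_unit M u"
  shows "integrable P (\<lambda>z. (ln (ord u z) + c)\<^sup>2)" "integrable P (\<lambda>z. ln (ord u z) + c)"
proof -
  have [measurable]: "u \<in> borel_measurable M" using u by (simp add: uniform_on_unit_def)
  let ?m = "real (card J)"
  have m: "?m > 0" using k1 kJ by simp
  have "integrable P (\<lambda>z. (ln (?m * ord u z))\<^sup>2)"
    using nn_integral_ln_ord_squared[OF u, of ?m] by (intro integrableI_bounded) (auto intro: le_less_trans)
  then have "integrable P (\<lambda>z. (ln (?m * ord u z) + (c - ln ?m))\<^sup>2)"
    by (intro integrable_square_add) auto
  then show sq: "integrable P (\<lambda>z. (ln (ord u z) + c)\<^sup>2)"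
  proof (rule integrable_cong_AE_imp)
    have e: "(ln (?m * x) + (c - ln ?m))\<^sup>2 = (ln x + c)\<^sup>2" if "0 < x" for x
      using ln_mult_pos[OF m that] by simp
    show "AE z in P. (ln (?m * ord u z) + (c - ln ?m))\<^sup>2 = (ln (ord u z) + c)\<^sup>2"
      using AE_ord_pos[OF u] by eventually_elim (rule e)
  qed measurable
  show "integrable P (\<lambda>z. ln (ord u z) + c)"
    by (rule P.square_integrable_imp_integrable[OF _ sq]) measurable
qed

lemma expectation_ln_ord:
  assumes u: "uniform_on_unit M u"
  shows "(LINT z|P. ln (ord u z) + c) = c - (harm (card J) - harm (k - 1))"
proof -
  have [measurable]: "u \<in> borel_measurable M" using u by (simp add: uniform_on_unit_def)
  have "harm (k - 1) \<le> (harm (card J) :: real)"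
    by (rule harm_mono) (use kJ in auto)
  \<comment> \<open>On the null event where the statistic is 0, this rests on ln 0 = 0.\<close>
  moreover have "ln (ord u z) \<le> 0" for z
    using ord_bounds[OF u, of z] by (cases "ord u z = 0") auto
  ultimately have "(LINT z|P. - ln (ord u z)) = harm (card J) - harm (k - 1)"
    using nn_integral_neg_ln_ord[OF u] by (intro integral_eq_nn_integral[THEN trans]) auto
  then have "(LINT z|P. ln (ord u z)) = - (harm (card J) - harm (k - 1))" by simp
  then show ?thesis using integrable_ln_ord_squared(2)[OF u, of 0] by (simp add: P.prob_space)
qed

text \<open>The constant is 2 (32 + 4 k) + 2 \<psi>^2, from (x - \<psi>)^2 <= 2 (x^2 +
  \<psi>^2).\<close>

lemma expectation_ln_ord_squared_le:
  assumes u: "uniform_on_unit M u" and c: "real (card J) \<le> c" "c \<le> real (card J) + 1"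
  shows "(LINT z|P. (ln (ord u z) + (ln c - \<psi>))\<^sup>2) \<le> 64 + 8 * real k + 2 * \<psi>\<^sup>2"
proof -
  have [measurable]: "u \<in> borel_measurable M" using u by (simp add: uniform_on_unit_def)
  have c0: "c > 0" using c k1 kJ by linarith
  have i: "integrable P (\<lambda>z. (ln (ord u z) + ln c)\<^sup>2)" by (rule integrable_ln_ord_squared[OF u])
  have "(\<integral>\<^sup>+z. ennreal ((ln (ord u z) + ln c)\<^sup>2) \<partial>P) = (\<integral>\<^sup>+z. ennreal ((ln (c * ord u z))\<^sup>2) \<partial>P)"
  proof (rule nn_integral_cong_AE)
    have e: "ennreal ((ln x + ln c)\<^sup>2) = ennreal ((ln (c * x))\<^sup>2)" if "0 < x" for x
      using ln_mult_pos[OF c0 that] by (simp add: add.commute)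
    show "AE z in P. ennreal ((ln (ord u z) + ln c)\<^sup>2) = ennreal ((ln (c * ord u z))\<^sup>2)"
      using AE_ord_pos[OF u] by eventually_elim (rule e)
  qed
  also have "\<dots> \<le> ennreal (32 + 4 * real k)" by (rule nn_integral_ln_ord_squared[OF u c])
  finally have "(LINT z|P. (ln (ord u z) + ln c)\<^sup>2) \<le> 32 + 4 * real k"
    using nn_integral_eq_integral[OF i] by (subst ennreal_le_iff[symmetric]) (simp_all del: ennreal_plus)
  then have "2 * ((LINT z|P. (ln (ord u z) + ln c)\<^sup>2) + \<psi>\<^sup>2) \<le> 64 + 8 * real k + 2 * \<psi>\<^sup>2" by simp
  moreover have "(LINT z|P. (ln (ord u z) + (ln c - \<psi>))\<^sup>2) \<le> (LINT z|P. 2 * ((ln (ord u z) + ln c)\<^sup>2 + \<psi>\<^sup>2))"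
  proof (rule integral_mono)
    fix z
    have "0 \<le> (ln (ord u z) + ln c + \<psi>)\<^sup>2" by simp
    then show "(ln (ord u z) + (ln c - \<psi>))\<^sup>2 \<le> 2 * ((ln (ord u z) + ln c)\<^sup>2 + \<psi>\<^sup>2)"
      by (simp add: power2_eq_square algebra_simps)
  qed (use i integrable_ln_ord_squared[OF u] in auto)
  ultimately show ?thesis using i by (simp add: P.prob_space)
qed

lemma prob_ord_gt_le:
  assumes u: "uniform_on_unit M u" and a: "0 < a" "a \<le> 1"
  shows "P.prob {z \<in> space P. a < ord u z} \<le> real k / ((real (card J) + 1) * a)"
proof -
  have [measurable]: "u \<in> borel_measurable M" using u by (simp add: uniform_on_unit_def)
  have "{z \<in> space P. a < ord u z} = space P - {z \<in> space P. ord u z \<le> a}" by auto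
  then have "P.prob {z \<in> space P. a < ord u z} = 1 - P.prob {z \<in> space P. ord u z \<le> a}"
    by (simp add: P.prob_compl)
  also have "P.prob {z \<in> space P. ord u z \<le> a} = binomial_tail (card J) k a"
    using emeasure_ord_le[OF u, of a] a binomial_tail_bounds[of a "card J" k] by (simp add: P.emeasure_eq_measure)
  finally have "P.prob {z \<in> space P. a < ord u z} = 1 - binomial_tail (card J) k a" .
  moreover have "(1 - binomial_tail (card J) k a) * ((real (card J) + 1) * a) \<le> real k"
    using one_minus_binomial_tail_le[of a "card J" k] a by (simp add: ac_simps)
  ultimately show ?thesis using a by (simp add: pos_le_divide_eq)
qed

text \<open>The truncated logarithms $\ln\min(U,a)$ are negatively correlated, and the excess
  $\ln^+(U/a)$ is bounded and supported on an event of probability $O(1/m)$.\<close>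

lemma expectation_ln_ord_product_le:
  assumes u: "uniform_on_unit M u" and v: "uniform_on_unit M v" and a: "0 < a" "a \<le> 1"
    and sep: "\<And>z. z \<in> space M \<Longrightarrow> a \<le> u z \<or> a \<le> v z"
    and C: "(LINT z|P. (ln (ord u z) + c)\<^sup>2) \<le> C" "(LINT z|P. (ln (ord v z) + c)\<^sup>2) \<le> C"
  defines "\<delta> \<equiv> real k / ((real (card J) + 1) * a)" and "\<kappa> \<equiv> - ln a"
    and "\<eta> \<equiv> c - (harm (card J) - harm (k - 1))"
  shows "(LINT z|P. (ln (ord u z) + c) * (ln (ord v z) + c)) \<le> 2 * \<eta>\<^sup>2 + 2 * (\<kappa> * \<delta>)\<^sup>2 + sqrt \<delta> * (C + \<kappa>\<^sup>2) + \<kappa>\<^sup>2 * \<delta>"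
proof -
  have [measurable]: "u \<in> borel_measurable M" "v \<in> borel_measurable M" using u v by (simp_all add: uniform_on_unit_def)
  have \<delta>: "\<delta> > 0" using a k1 by (simp add: \<delta>_def)
  have \<kappa>: "\<kappa> \<ge> 0" using a by (simp add: \<kappa>_def)
  \<comment> \<open>The logarithm is split at level a: \<open>A\<close> is its truncated part below
    a and \<open>D\<close> the excess above a, with Y = (c + ln a) - A + D. Only \<open>A\<close> is
    accessible to negative dependence; \<open>D\<close> is small in the mean.\<close>
  define Y where "Y w z = ln (ord w z) + c" for w z
  define D where "D w z = ln (max (ord w z) a) - ln a" for w z
  define A where "A w z = ln a - ln (min (ord w z) a)" for w z
  have Y_eq: "Y w z = (c + ln a) - A w z + D w z" for w z
    by (cases "ord w z \<le> a") (auto simp: Y_def A_def D_def)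
  have [measurable]: "Y w \<in> borel_measurable P" "D w \<in> borel_measurable P" "A w \<in> borel_measurable P"
    if [measurable]: "w \<in> borel_measurable M" for w
    unfolding Y_def D_def A_def by measurable
  have D0: "0 \<le> D w z" and Dl: "D w z \<le> \<kappa> * indicator {z \<in> space P. a < ord w z} z"
    if "uniform_on_unit M w" "z \<in> space P" for w z
    using ord_bounds[OF that(1), of z] that(2) a by (auto simp: D_def \<kappa>_def max_def split: split_indicator)
  have D\<kappa>: "D w z \<le> \<kappa>" if "uniform_on_unit M w" "z \<in> space P" for w z
    using Dl[OF that] \<kappa> by (auto split: split_indicator_asm)
  have iY: "integrable P (\<lambda>z. (Y w z)\<^sup>2)" and iY1: "integrable P (\<lambda>z. Y w z)" if "uniform_on_unit M w" for w
    using integrable_ln_ord_squared[OF that] by (auto simp: Y_def)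
  have iD: "integrable P (\<lambda>z. (D w z)\<^sup>2)" and iD1: "integrable P (\<lambda>z. D w z)" if w: "uniform_on_unit M w" for w
  proof -
    have [measurable]: "w \<in> borel_measurable M" using w by (simp add: uniform_on_unit_def)
    show "integrable P (\<lambda>z. (D w z)\<^sup>2)"
      by (rule P.integrable_const_bound[where B="\<kappa>\<^sup>2"]) (auto intro!: AE_I2 power_mono D0 D\<kappa> w)
    show "integrable P (\<lambda>z. D w z)"
      by (rule P.integrable_const_bound[where B="\<kappa>"]) (auto intro!: AE_I2 simp: abs_of_nonneg D0 D\<kappa> w)
  qed
  have A_alt: "A w z = (c + ln a) - Y w z + D w z" for w z using Y_eq[of w z] by simp
  have iA: "integrable P (\<lambda>z. (A w z)\<^sup>2)" and iA1: "integrable P (\<lambda>z. A w z)" if w: "uniform_on_unit M w" for w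
  proof -
    have [measurable]: "w \<in> borel_measurable M" using w by (simp add: uniform_on_unit_def)
    have "integrable P (\<lambda>z. ((c + ln a) + (- Y w z + D w z))\<^sup>2)"
      using iY[OF w] iD[OF w] by (intro integrable_square_add) auto
    then show "integrable P (\<lambda>z. (A w z)\<^sup>2)" unfolding A_alt by (simp add: algebra_simps)
    show "integrable P (\<lambda>z. A w z)" unfolding A_alt using iY1[OF w] iD1[OF w] by auto
  qed
  have A0: "AE z in P. 0 \<le> A w z" if w: "uniform_on_unit M w" for w
    using AE_ord_pos[OF w] by eventually_elim (use a in \<open>auto simp: A_def\<close>)
  define \<alpha> where "\<alpha> = (LINT z|P. A u z)"
  have nnA: "(\<integral>\<^sup>+z. ennreal (A w z) \<partial>P) = ennreal (LINT z|P. A w z)" if w: "uniform_on_unit M w" for w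
    by (rule nn_integral_eq_integral[OF iA1[OF w] A0[OF w]])
  have "ennreal (LINT z|P. A v z) = ennreal (LINT z|P. A u z)"
    unfolding nnA[OF u, symmetric] nnA[OF v, symmetric] using nn_integral_ord_tail[OF u a] nn_integral_ord_tail[OF v a] by (simp add: A_def)
  moreover have A0': "0 \<le> (LINT z|P. A w z)" if w: "uniform_on_unit M w" for w
    by (rule integral_nonneg_AE[OF A0[OF w]])
  ultimately have \<alpha>v: "(LINT z|P. A v z) = \<alpha>" using u v by (simp add: \<alpha>_def)
  have iAA: "integrable P (\<lambda>z. A u z * A v z)"
    by (rule integrable_mult_of_squares) (use iA u v in auto)
  have EAA: "(LINT z|P. A u z * A v z) \<le> \<alpha> * \<alpha>"
  proof -
    have "ennreal (LINT z|P. A u z * A v z) = (\<integral>\<^sup>+z. ennreal (A u z * A v z) \<partial>P)"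
      by (rule nn_integral_eq_integral[OF iAA, symmetric]) (use A0[OF u] A0[OF v] in \<open>auto elim!: eventually_elim2\<close>)
    also have "\<dots> = (\<integral>\<^sup>+z. ennreal (A u z) * ennreal (A v z) \<partial>P)"
      by (rule nn_integral_cong_AE) (use A0[OF u] A0[OF v] in \<open>auto elim!: eventually_elim2 simp: ennreal_mult\<close>)
    also have "\<dots> \<le> ennreal (LINT z|P. A u z) * ennreal (LINT z|P. A v z)"
      unfolding nnA[OF u, symmetric] nnA[OF v, symmetric] using nn_integral_ord_tail_product[OF u v a sep] by (simp add: A_def)
    also have "\<dots> = ennreal (\<alpha> * \<alpha>)" using A0'[OF u] unfolding \<alpha>v by (simp add: \<alpha>_def ennreal_mult)
    finally show ?thesis using A0'[OF u] by (subst (asm) ennreal_le_iff) (auto simp: \<alpha>_def)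
  qed
  have ED: "(LINT z|P. D w z) \<le> \<kappa> * \<delta>" and ED2: "(LINT z|P. (D w z)\<^sup>2) \<le> \<kappa>\<^sup>2 * \<delta>" if w: "uniform_on_unit M w" for w
  proof -
    have [measurable]: "w \<in> borel_measurable M" using w by (simp add: uniform_on_unit_def)
    let ?G = "{z \<in> space P. a < ord w z}"
    have [measurable]: "?G \<in> sets P" by measurable
    have pG: "P.prob ?G \<le> \<delta>" unfolding \<delta>_def by (rule prob_ord_gt_le[OF w a])
    have "(LINT z|P. D w z) \<le> (LINT z|P. \<kappa> * indicator ?G z)"
      by (rule integral_mono) (use iD1[OF w] Dl[OF w] in \<open>auto intro!: integrable_mult_right simp: P.emeasure_eq_measure\<close>)
    also have "\<dots> = \<kappa> * P.prob ?G" by simp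
    also have "\<dots> \<le> \<kappa> * \<delta>" using pG \<kappa> by (rule mult_left_mono)
    finally show "(LINT z|P. D w z) \<le> \<kappa> * \<delta>" .
    have "(LINT z|P. (D w z)\<^sup>2) \<le> (LINT z|P. \<kappa>\<^sup>2 * indicator ?G z)"
    proof (rule integral_mono)
      fix z assume z: "z \<in> space P"
      have "(D w z)\<^sup>2 \<le> (\<kappa> * indicator ?G z)\<^sup>2" using Dl[OF w z] D0[OF w z] by (rule power_mono)
      then show "(D w z)\<^sup>2 \<le> \<kappa>\<^sup>2 * indicator ?G z" by (auto split: split_indicator simp: power_mult_distrib)
    qed (use iD[OF w] in \<open>auto intro!: integrable_mult_right simp: P.emeasure_eq_measure\<close>)
    also have "\<dots> = \<kappa>\<^sup>2 * P.prob ?G" by simp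
    also have "\<dots> \<le> \<kappa>\<^sup>2 * \<delta>" using pG by (rule mult_left_mono) simp
    finally show "(LINT z|P. (D w z)\<^sup>2) \<le> \<kappa>\<^sup>2 * \<delta>" .
  qed
  have ED0: "0 \<le> (LINT z|P. D u z)" by (rule integral_nonneg_AE) (auto intro!: AE_I2 D0 u)
  have EY: "(LINT z|P. Y u z) = \<eta>" using expectation_ln_ord[OF u, of c] by (simp add: Y_def \<eta>_def)
  have EP: "c + ln a - \<alpha> = \<eta> - (LINT z|P. D u z)"
    unfolding \<alpha>_def A_alt using iY1[OF u] iD1[OF u] EY by (simp add: P.prob_space)
  have main: "(c + ln a - \<alpha>)\<^sup>2 \<le> 2 * \<eta>\<^sup>2 + 2 * (\<kappa> * \<delta>)\<^sup>2"
  proof -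
    have "(LINT z|P. D u z)\<^sup>2 \<le> (\<kappa> * \<delta>)\<^sup>2" using ED[OF u] ED0 by (rule power_mono)
    moreover have "0 \<le> (\<eta> + (LINT z|P. D u z))\<^sup>2" by simp
    ultimately show ?thesis unfolding EP by (simp add: power2_eq_square algebra_simps)
  qed
  \<comment> \<open>The weight sqrt \<delta> balances the cross terms: with second moment at most C
    for Y and \<kappa>^2 \<delta> for D, each costs at most s (C + \<kappa>^2) / 2.\<close>
  define s where "s = sqrt \<delta>"
  have s: "s > 0" "s * s = \<delta>" using \<delta> by (auto simp: s_def)
  note cross = mult_le_weighted_squares[OF s(1)]
  have pt: "Y u z * Y v z \<le> ((c + ln a)\<^sup>2 - (c + ln a) * (A u z + A v z) + A u z * A v z)
     + (s * (Y u z)\<^sup>2 / 2 + (D v z)\<^sup>2 / (2 * s)) + (s * (Y v z)\<^sup>2 / 2 + (D u z)\<^sup>2 / (2 * s))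
     + 0" if z: "z \<in> space P" for z
  proof -
    have "Y u z * Y v z = (Y u z - D u z) * (Y v z - D v z) + Y u z * D v z + Y v z * D u z - D u z * D v z"
      by (simp add: algebra_simps)
    also have "(Y u z - D u z) * (Y v z - D v z) = (c + ln a)\<^sup>2 - (c + ln a) * (A u z + A v z) + A u z * A v z"
      unfolding Y_eq[of u] Y_eq[of v] by (simp add: power2_eq_square algebra_simps)
    finally show ?thesis using cross[of "Y u z" "D v z"] cross[of "Y v z" "D u z"] mult_nonneg_nonneg[OF D0[OF u z] D0[OF v z]] by linarith
  qed
  have "(LINT z|P. Y u z * Y v z) \<le> (LINT z|P. ((c + ln a)\<^sup>2 - (c + ln a) * (A u z + A v z) + A u z * A v z)
     + (s * (Y u z)\<^sup>2 / 2 + (D v z)\<^sup>2 / (2 * s)) + (s * (Y v z)\<^sup>2 / 2 + (D u z)\<^sup>2 / (2 * s)) + 0)"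
    by (rule integral_mono) (use pt iA1 iAA iY iD u v in \<open>auto intro!: integrable_mult_of_squares\<close>)
  also have "\<dots> = ((c + ln a)\<^sup>2 - (c + ln a) * (\<alpha> + \<alpha>) + (LINT z|P. A u z * A v z))
     + (s * (LINT z|P. (Y u z)\<^sup>2) / 2 + (LINT z|P. (D v z)\<^sup>2) / (2 * s)) + (s * (LINT z|P. (Y v z)\<^sup>2) / 2 + (LINT z|P. (D u z)\<^sup>2) / (2 * s))"
    using iA1 iAA iY iD u v \<alpha>v by (simp add: P.prob_space \<alpha>_def)
  also have "\<dots> \<le> ((c + ln a)\<^sup>2 - (c + ln a) * (\<alpha> + \<alpha>) + \<alpha> * \<alpha>)
     + (s * C / 2 + (\<kappa>\<^sup>2 * \<delta>) / (2 * s)) + (s * C / 2 + (\<kappa>\<^sup>2 * \<delta>) / (2 * s))"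
  proof -
    have "s * (LINT z|P. (Y w z)\<^sup>2) / 2 \<le> s * C / 2" if "(LINT z|P. (ln (ord w z) + c)\<^sup>2) \<le> C" for w
      using that s(1) by (simp add: Y_def)
    moreover have "(LINT z|P. (D w z)\<^sup>2) / (2 * s) \<le> (\<kappa>\<^sup>2 * \<delta>) / (2 * s)" if "uniform_on_unit M w" for w
      using ED2[OF that] s(1) by (intro divide_right_mono) auto
    ultimately show ?thesis using C u v EAA by (intro add_mono order_refl) (auto intro!: diff_left_mono)
  qed
  also have "\<dots> = (c + ln a - \<alpha>)\<^sup>2 + s * (C + \<kappa>\<^sup>2)"
    using s by (simp add: power2_eq_square field_simps flip: s(2))
  also have "\<dots> \<le> 2 * \<eta>\<^sup>2 + 2 * (\<kappa> * \<delta>)\<^sup>2 + sqrt \<delta> * (C + \<kappa>\<^sup>2) + \<kappa>\<^sup>2 * \<delta>"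
    using main \<delta> by (simp add: s_def add_increasing2)
  finally show ?thesis by (simp add: Y_def)
qed

end

section \<open>Balls under a probability density\<close>

locale probability_density =
  fixes p :: "'a::euclidean_space \<Rightarrow> real"
  assumes p_nonneg: "\<And>x. 0 \<le> p x" and p_measurable [measurable]: "p \<in> borel_measurable borel"
    and prob_space_density: "prob_space (density lborel (\<lambda>x. ennreal (p x)))"
begin

definition \<mu> :: "'a measure" where "\<mu> = density lborel (\<lambda>x. ennreal (p x))"

sublocale \<mu>: prob_space \<mu>
  using prob_space_density by (simp add: \<mu>_def)

lemma sets_\<mu> [measurable_cong, simp]: "sets \<mu> = sets borel" by (simp add: \<mu>_def)
lemma space_\<mu> [simp]: "space \<mu> = UNIV" by (simp add: \<mu>_def)

lemma AE_\<mu>: "(AE x in lborel. Q x) \<Longrightarrow> AE x in \<mu>. Q x"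
  unfolding \<mu>_def by (subst AE_density) (auto elim: eventually_mono)

lemma AE_p_pos: "AE x in \<mu>. 0 < p x"
  unfolding \<mu>_def by (subst AE_density) auto

definition cball_prob :: "'a \<Rightarrow> real \<Rightarrow> real" where
  "cball_prob x r = measure \<mu> (cball x r)"

lemma cball_prob_eq_cdf: "cball_prob x r = cdf (distr \<mu> borel (dist x)) r"
  by (simp add: cball_prob_def cdf_def measure_distr vimage_def cball_def)

lemma real_distribution_dist: "real_distribution (distr \<mu> borel (dist x))"
  by (simp add: \<mu>.real_distribution_distr)

text \<open>A jump of the distribution function of the distance would be the mass of a sphere, which
  is a Lebesgue null set.\<close>

lemma isCont_cball_prob: "isCont (cball_prob x) r"
proof -
  interpret D: real_distribution "distr \<mu> borel (dist x)" by (rule real_distribution_dist)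
  have "measure (distr \<mu> borel (dist x)) {r} = measure \<mu> (sphere x r)"
    by (simp add: measure_distr vimage_def sphere_def)
  also have "AE y in lborel. y \<notin> sphere x r"
    using negligible_sphere[of x r] by (intro AE_not_in) (auto simp: negligible_iff_null_sets null_sets_completion_iff)
  then have "AE y in \<mu>. y \<notin> sphere x r" by (rule AE_\<mu>)
  then have "measure \<mu> (sphere x r) = 0" by (simp add: \<mu>.prob_eq_0)
  finally have "isCont (cdf (distr \<mu> borel (dist x))) r" by (simp add: D.isCont_cdf)
  then show ?thesis by (simp add: cball_prob_eq_cdf[abs_def])
qed

lemma cball_prob_mono: "r \<le> s \<Longrightarrow> cball_prob x r \<le> cball_prob x s"
  unfolding cball_prob_def by (intro \<mu>.finite_measure_mono) auto

lemma mono_cball_prob: "mono (cball_prob x)"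
  by (intro monoI cball_prob_mono)

lemma cball_prob_bounds [simp]: "0 \<le> cball_prob x r" "cball_prob x r \<le> 1"
  by (auto simp: cball_prob_def)

lemma cball_prob_0 [simp]: "cball_prob x 0 = 0"
proof -
  have "AE y in \<mu>. y \<notin> {x}" by (rule AE_\<mu>) (use AE_lborel_singleton[of x] in auto)
  then show ?thesis by (simp add: cball_prob_def \<mu>.prob_eq_0)
qed

lemma cball_prob_pos_imp: "0 < cball_prob x r \<Longrightarrow> 0 < r"
  by (rule ccontr) (use cball_prob_mono[of r 0 x] in auto)

text \<open>Joint measurability in centre and radius: the value is the measure of a section of the
  measurable set given by dist x y <= r.\<close>

lemma borel_measurable_cball_prob [measurable]:
  assumes [measurable]: "f \<in> borel_measurable N" "g \<in> borel_measurable N"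
  shows "(\<lambda>z. cball_prob (f z) (g z)) \<in> borel_measurable N"
proof -
  have "(\<lambda>xr. emeasure \<mu> (Pair xr -` {q \<in> space ((borel \<Otimes>\<^sub>M borel) \<Otimes>\<^sub>M \<mu>). dist (fst (fst q)) (snd q) \<le> snd (fst q)})) \<in> borel_measurable (borel \<Otimes>\<^sub>M borel)"
    by (rule \<mu>.measurable_emeasure_Pair) measurable
  also have "(\<lambda>xr. emeasure \<mu> (Pair xr -` {q \<in> space ((borel \<Otimes>\<^sub>M borel) \<Otimes>\<^sub>M \<mu>). dist (fst (fst q)) (snd q) \<le> snd (fst q)})) = (\<lambda>xr. ennreal (cball_prob (fst xr) (snd xr)))"
    by (auto simp: cball_prob_def \<mu>.emeasure_eq_measure space_pair_measure vimage_def cball_def)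
  finally have [measurable]: "(\<lambda>xr. enn2real (ennreal (cball_prob (fst xr) (snd xr)))) \<in> borel_measurable (borel \<Otimes>\<^sub>M borel)" by measurable
  have "(\<lambda>z. (f z, g z)) \<in> measurable N (borel \<Otimes>\<^sub>M borel)" by measurable
  then have "(\<lambda>z. enn2real (ennreal (cball_prob (fst (f z, g z)) (snd (f z, g z))))) \<in> borel_measurable N"
    by (rule measurable_compose) measurable
  then show ?thesis by simp
qed

definition transform :: "'a \<Rightarrow> 'a \<Rightarrow> real" where
  "transform x y = cball_prob x (dist x y)"

lemma borel_measurable_transform [measurable]:
  assumes [measurable]: "f \<in> borel_measurable N" "g \<in> borel_measurable N"
  shows "(\<lambda>z. transform (f z) (g z)) \<in> borel_measurable N"
  unfolding transform_def by measurable

text \<open>The probability integral transform of the distance from x. The distribution function is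
  continuous but may have flat pieces, so the largest radius t of mass at most s is taken:
  continuity makes its mass exactly s, and maximality makes the sublevel set of the transform
  exactly the ball of radius t.\<close>

lemma uniform_transform: "uniform_on_unit \<mu> (transform x)"
  unfolding uniform_on_unit_def
proof (intro conjI ballI allI)
  interpret D: real_distribution "distr \<mu> borel (dist x)" by (rule real_distribution_dist)
  have m: "(\<lambda>y. transform x y) \<in> borel_measurable \<mu>" by measurable
  then show "transform x \<in> borel_measurable \<mu>" by simp
  fix s :: real assume s: "s \<in> {0..1}"
  show "\<mu>.prob {y \<in> space \<mu>. transform x y \<le> s} = s"
  \<comment> \<open>For s = 1 every radius qualifies and there is no largest one.\<close>
  proof (cases "s = 1")
    case True
    then show ?thesis using \<mu>.prob_space by (simp add: transform_def)
  next
    case False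
    then have s1: "s < 1" using s by auto
    define S where "S = {r. 0 \<le> r \<and> cball_prob x r \<le> s}"
    have "(cball_prob x \<longlongrightarrow> 1) at_top"
      using D.cdf_lim_at_top_prob by (simp add: cball_prob_eq_cdf[abs_def])
    then have "eventually (\<lambda>r. s < cball_prob x r) at_top" using s1 by (rule order_tendstoD(1))
    then obtain b where b: "s < cball_prob x b" by (auto simp: eventually_at_top_linorder)
    have bdd: "r \<le> b" if "r \<in> S" for r
      using that b cball_prob_mono[of b r x] by (force simp: S_def)
    have S0: "0 \<in> S" using s by (simp add: S_def)
    have clS: "closed S"
    proof -
      have "continuous_on UNIV (cball_prob x)" by (simp add: continuous_at_imp_continuous_on isCont_cball_prob)
      then have "closed {r. cball_prob x r \<le> s}" by (intro closed_Collect_le) auto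
      moreover have "closed {r::real. 0 \<le> r}" by (intro closed_Collect_le) auto
      ultimately show ?thesis unfolding S_def Collect_conj_eq by (rule closed_Int[rotated])
    qed
    define t where "t = Sup S"
    have tS: "t \<in> S" unfolding t_def using S0 bdd clS by (intro closed_contains_Sup) (auto intro: bdd_aboveI[of _ b])
    have tmax: "r \<le> t" if "r \<in> S" for r unfolding t_def using that bdd by (intro cSup_upper) (auto intro: bdd_aboveI[of _ b])
    have Ft: "cball_prob x t = s"
    proof (rule ccontr)
      assume "cball_prob x t \<noteq> s"
      then have "cball_prob x t < s" using tS by (simp add: S_def)
      then have "eventually (\<lambda>r. cball_prob x r < s) (at t)"
        by (intro order_tendstoD(2)[OF isCont_cball_prob[of t x, unfolded isCont_def]])
      then have "eventually (\<lambda>r. cball_prob x r < s) (at_right t)" by (rule filter_leD[rotated]) (simp add: at_le)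
      then obtain c where c: "c > t" "\<And>y. y > t \<Longrightarrow> y < c \<Longrightarrow> cball_prob x y < s"
        unfolding eventually_at_right_field by auto
      define y where "y = (t + c) / 2"
      have "y > t" "y < c" using c(1) by (auto simp: y_def)
      then have "y \<in> S" using c(2)[of y] tS by (auto simp: S_def)
      then show False using tmax \<open>y > t\<close> by fastforce
    qed
    have "{y \<in> space \<mu>. transform x y \<le> s} = cball x t"
    proof (intro set_eqI iffI)
      fix y assume "y \<in> {y \<in> space \<mu>. transform x y \<le> s}"
      then have "dist x y \<in> S" by (simp add: transform_def S_def)
      then show "y \<in> cball x t" using tmax by simp
    next
      fix y assume "y \<in> cball x t"
      then show "y \<in> {y \<in> space \<mu>. transform x y \<le> s}" using cball_prob_mono[of "dist x y" t x] Ft by (simp add: transform_def)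
    qed
    then show ?thesis using Ft by (simp add: cball_prob_def)
  qed
qed (simp_all add: transform_def)


section \<open>Ball averages and Lebesgue points\<close>

lemma unit_vol_pos: "0 < unit_vol TYPE('a)" using content_cball_pos[of 1 "0::'a"] by simp

lemma measure_lborel_cball: "0 \<le> r \<Longrightarrow> measure lborel (cball (x::'a) r) = r ^ DIM('a) * unit_vol TYPE('a)"
  by (simp add: content_cball)

definition avg :: "'a \<Rightarrow> real \<Rightarrow> real" where
  "avg x r = cball_prob x r / (r ^ DIM('a) * unit_vol TYPE('a))"

lemma borel_measurable_avg [measurable]:
  assumes [measurable]: "f \<in> borel_measurable N" "g \<in> borel_measurable N"
  shows "(\<lambda>z. avg (f z) (g z)) \<in> borel_measurable N"
  unfolding avg_def by measurable

lemma avg_nonneg: "0 < r \<Longrightarrow> 0 \<le> avg x r"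
  using unit_vol_pos by (simp add: avg_def)

lemma I_avg_eq: "0 < r \<Longrightarrow> I_avg p x r = ennreal (avg x r)"
proof -
  assume r: "0 < r"
  have "(\<integral>\<^sup>+y\<in>cball x r. ennreal (p y) \<partial>lborel) = emeasure \<mu> (cball x r)"
    by (simp add: \<mu>_def emeasure_density)
  also have "\<dots> = ennreal (cball_prob x r)" by (simp add: cball_prob_def \<mu>.emeasure_eq_measure)
  finally show ?thesis using r unit_vol_pos by (simp add: I_avg_def avg_def divide_ennreal)
qed

lemma isCont_avg: "0 < r \<Longrightarrow> isCont (avg x) r"
proof -
  assume r: "0 < r"
  have "isCont (\<lambda>r. cball_prob x r / (r ^ DIM('a) * unit_vol TYPE('a))) r"
    by (rule isCont_divide[OF isCont_cball_prob]) (use r unit_vol_pos in auto)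
  then show ?thesis by (simp add: avg_def[abs_def])
qed

definition lebesgue_point :: "'a \<Rightarrow> bool" where
  "lebesgue_point x \<longleftrightarrow> 0 < p x \<and> (avg x \<longlongrightarrow> p x) (at_right 0)"

lemma AE_lebesgue_point: "AE x in \<mu>. lebesgue_point x"
proof -
  have "(\<integral>\<^sup>+x. ennreal (p x) \<partial>lborel) = emeasure \<mu> UNIV"
    by (simp add: \<mu>_def emeasure_density)
  then have ip: "integrable lborel p"
    using \<mu>.emeasure_space_1 p_nonneg by (intro integrableI_nonneg) auto
  have "AE x in lborel. (avg x \<longlongrightarrow> p x) (at_right 0)"
    using lebesgue_differentiation_cball[of p, OF p_nonneg ip]
  proof (rule AE_mp, intro AE_I2 impI)
    fix x
    assume lim: "((\<lambda>r. measure (density lborel (\<lambda>x. ennreal (p x))) (cball x r) / measure lborel (cball x r)) \<longlongrightarrow> p x) (at_right 0)"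
    have "measure (density lborel (\<lambda>x. ennreal (p x))) (cball x r) / measure lborel (cball x r) = avg x r" if "0 < r" for r
      unfolding avg_def cball_prob_def \<mu>_def measure_lborel_cball[OF less_imp_le[OF that]] ..
    then have "eventually (\<lambda>r. measure (density lborel (\<lambda>x. ennreal (p x))) (cball x r) / measure lborel (cball x r) = avg x r) (at_right 0)"
      by (intro eventually_at_rightI[of 0 1]) auto
    with lim show "(avg x \<longlongrightarrow> p x) (at_right 0)" by (rule Lim_transform_eventually)
  qed
  then have "AE x in \<mu>. (avg x \<longlongrightarrow> p x) (at_right 0)" by (rule AE_\<mu>)
  then show ?thesis using AE_p_pos by eventually_elim (simp add: lebesgue_point_def)
qed

lemma lebesgue_point_cball_prob_pos:
  assumes "lebesgue_point x" "0 < r"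
  shows "0 < cball_prob x r"
proof -
  have "eventually (\<lambda>r. 0 < avg x r) (at_right 0)" using assms(1) unfolding lebesgue_point_def by (intro order_tendstoD(1)[of "avg x" "p x"]) simp_all
  then obtain b where b: "b > 0" "\<And>y. y > 0 \<Longrightarrow> y < b \<Longrightarrow> 0 < avg x y" unfolding eventually_at_right_field by auto
  define y where "y = min r (b / 2)"
  have "0 < y" "y < b" "y \<le> r" using b assms by (auto simp: y_def)
  then have "0 < avg x y" using b by auto
  then have "cball_prob x y \<noteq> 0" by (auto simp: avg_def)
  then have "0 < cball_prob x y" using cball_prob_bounds(1)[of x y] by linarith
  then show ?thesis using cball_prob_mono[OF \<open>y \<le> r\<close>, of x] by linarith
qed

end

section \<open>Conditioning on some of the sample points\<close>

locale kl_sample = prob_space M + probability_density p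
  for M :: "'w measure" and p :: "'a::euclidean_space \<Rightarrow> real" +
  fixes Xs :: "nat \<Rightarrow> 'w \<Rightarrow> 'a" and k :: nat
  assumes indep: "indep_vars (\<lambda>_. borel) Xs {1..}"
    and law: "\<And>i. 1 \<le> i \<Longrightarrow> distr M borel (Xs i) = density lborel (\<lambda>x. ennreal (p x))"
    and k1: "1 \<le> k"
begin

lemma borel_measurable_Xs [measurable]: "1 \<le> i \<Longrightarrow> Xs i \<in> borel_measurable M"
  using indep by (auto simp: indep_vars_def)

abbreviation "pow J \<equiv> Pi\<^sub>M J (\<lambda>_. \<mu>)"
abbreviation "tup J \<omega> \<equiv> restrict (\<lambda>j. Xs j \<omega>) J"

definition knn_prob :: "nat set \<Rightarrow> nat \<Rightarrow> 'w \<Rightarrow> real" where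
  "knn_prob J i \<omega> = order_stat k J (\<lambda>j. transform (Xs i \<omega>) (Xs j \<omega>))"

lemma borel_measurable_component: "i \<in> I \<Longrightarrow> (\<lambda>w. w i) \<in> borel_measurable (pow I)"
  using measurable_component_singleton[of i I "\<lambda>_. \<mu>"] by (simp add: measurable_cong_sets[OF refl sets_\<mu>])

lemma measurable_tup [measurable]: "J \<subseteq> {1..} \<Longrightarrow> (\<lambda>\<omega>. tup J \<omega>) \<in> measurable M (pow J)"
  by (intro measurable_restrict) auto

lemma distr_tup:
  assumes "J \<subseteq> {1..}" "J \<noteq> {}"
  shows "distr M (pow J) (tup J) = pow J"
proof -
  have "indep_vars (\<lambda>_. borel) Xs J" by (rule indep_vars_subset[OF indep assms(1)])
  then have "distr M (Pi\<^sub>M J (\<lambda>_. borel)) (\<lambda>\<omega>. \<lambda>j\<in>J. Xs j \<omega>) = Pi\<^sub>M J (\<lambda>i. distr M borel (Xs i))"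
    using assms by (subst (asm) indep_vars_iff_distr_eq_PiM') auto
  also have "\<dots> = pow J"
    using assms law by (intro PiM_cong) (auto simp: \<mu>_def)
  also have "distr M (Pi\<^sub>M J (\<lambda>_. borel)) (\<lambda>\<omega>. \<lambda>j\<in>J. Xs j \<omega>) = distr M (pow J) (tup J)"
    by (intro distr_cong refl sets_PiM_cong) auto
  finally show ?thesis .
qed

text \<open>Independence of disjoint blocks of sample points: the tuple over both blocks has a
  product law, \<open>merge\<close> transports it to the product of the two powers, and restriction
  undoes \<open>merge\<close>.\<close>

lemma distr_tup_pair:
  assumes I: "finite I" "I \<subseteq> {1..}" "I \<noteq> {}" and J: "finite J" "J \<subseteq> {1..}" and disj: "I \<inter> J = {}"
  shows "distr M (pow I \<Otimes>\<^sub>M pow J) (\<lambda>\<omega>. (tup I \<omega>, tup J \<omega>)) = pow I \<Otimes>\<^sub>M pow J"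
proof -
  interpret product_sigma_finite "\<lambda>_::nat. \<mu>" by standard
  let ?r = "\<lambda>w. (restrict w I, restrict w J)"
  have r[measurable]: "?r \<in> measurable (pow (I \<union> J)) (pow I \<Otimes>\<^sub>M pow J)"
    by (intro measurable_Pair measurable_restrict_subset) auto
  have "distr M (pow I \<Otimes>\<^sub>M pow J) (\<lambda>\<omega>. (tup I \<omega>, tup J \<omega>)) = distr M (pow I \<Otimes>\<^sub>M pow J) (?r \<circ> tup (I \<union> J))"
    by (intro distr_cong refl) (auto simp: fun_eq_iff)
  also have "\<dots> = distr (distr M (pow (I \<union> J)) (tup (I \<union> J))) (pow I \<Otimes>\<^sub>M pow J) ?r"
    using I J by (intro distr_distr[symmetric] r measurable_tup) auto
  also have "\<dots> = distr (pow (I \<union> J)) (pow I \<Otimes>\<^sub>M pow J) ?r"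
    using I J by (subst distr_tup) auto
  also have "\<dots> = distr (distr (pow I \<Otimes>\<^sub>M pow J) (pow (I \<union> J)) (merge I J)) (pow I \<Otimes>\<^sub>M pow J) ?r"
    by (subst distr_merge[OF disj I(1) J(1)]) (rule refl)
  also have "\<dots> = distr (pow I \<Otimes>\<^sub>M pow J) (pow I \<Otimes>\<^sub>M pow J) (?r \<circ> merge I J)"
    by (intro distr_distr r measurable_merge)
  also have "\<dots> = distr (pow I \<Otimes>\<^sub>M pow J) (pow I \<Otimes>\<^sub>M pow J) (\<lambda>q. q)"
  proof (intro distr_cong refl)
    fix q assume "q \<in> space (pow I \<Otimes>\<^sub>M pow J)"
    then have "fst q \<in> extensional I" "snd q \<in> extensional J"
      by (auto simp: space_pair_measure space_PiM PiE_def)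
    moreover have "restrict (merge I J q) I = restrict (fst q) I" "restrict (merge I J q) J = restrict (snd q) J"
      using disj by (cases q; auto simp: merge_def fun_eq_iff)+
    ultimately show "(?r \<circ> merge I J) q = q" by (simp add: extensional_restrict)
  qed
  also have "\<dots> = pow I \<Otimes>\<^sub>M pow J" by (rule distr_id)
  finally show ?thesis .
qed

text \<open>The inner integral plays the role of the conditional expectation given the points with
  index in \<open>I\<close>; conditioning is always expressed in this way.\<close>

lemma nn_integral_tup_pair:
  assumes I: "finite I" "I \<subseteq> {1..}" "I \<noteq> {}" and J: "finite J" "J \<subseteq> {1..}" and disj: "I \<inter> J = {}"
    and g: "(\<lambda>(w, z). g w z) \<in> borel_measurable (pow I \<Otimes>\<^sub>M pow J)"
  shows "(\<integral>\<^sup>+\<omega>. g (tup I \<omega>) (tup J \<omega>) \<partial>M) = (\<integral>\<^sup>+w. \<integral>\<^sup>+z. g w z \<partial>pow J \<partial>pow I)"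
proof -
  interpret J: prob_space "pow J" by (intro prob_space_PiM \<mu>.prob_space_axioms)
  have [measurable]: "(\<lambda>\<omega>. (tup I \<omega>, tup J \<omega>)) \<in> measurable M (pow I \<Otimes>\<^sub>M pow J)" using I J by measurable
  have "(\<integral>\<^sup>+\<omega>. g (tup I \<omega>) (tup J \<omega>) \<partial>M) = (\<integral>\<^sup>+\<omega>. (\<lambda>(w, z). g w z) (tup I \<omega>, tup J \<omega>) \<partial>M)" by simp
  also have "\<dots> = (\<integral>\<^sup>+q. (\<lambda>(w, z). g w z) q \<partial>distr M (pow I \<Otimes>\<^sub>M pow J) (\<lambda>\<omega>. (tup I \<omega>, tup J \<omega>)))"
    using g by (intro nn_integral_distr[symmetric]) simp_all
  also have "\<dots> = (\<integral>\<^sup>+q. (\<lambda>(w, z). g w z) q \<partial>(pow I \<Otimes>\<^sub>M pow J))" by (simp only: distr_tup_pair[OF I J disj])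
  also have "\<dots> = (\<integral>\<^sup>+w. \<integral>\<^sup>+z. g w z \<partial>pow J \<partial>pow I)"
    using J.nn_integral_fst[OF g] by simp
  finally show ?thesis .
qed

lemma integral_tup_pair:
  fixes g :: "_ \<Rightarrow> _ \<Rightarrow> real"
  assumes I: "finite I" "I \<subseteq> {1..}" "I \<noteq> {}" and J: "finite J" "J \<subseteq> {1..}" and disj: "I \<inter> J = {}"
    and g: "(\<lambda>(w, z). g w z) \<in> borel_measurable (pow I \<Otimes>\<^sub>M pow J)"
    and int: "integrable M (\<lambda>\<omega>. g (tup I \<omega>) (tup J \<omega>))"
  shows "integrable (pow I) (\<lambda>w. LINT z|pow J. g w z)"
    and "(LINT \<omega>|M. g (tup I \<omega>) (tup J \<omega>)) = (LINT w|pow I. LINT z|pow J. g w z)"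
    and "AE w in pow I. integrable (pow J) (\<lambda>z. g w z)"
proof -
  interpret I: prob_space "pow I" by (intro prob_space_PiM \<mu>.prob_space_axioms)
  interpret J: prob_space "pow J" by (intro prob_space_PiM \<mu>.prob_space_axioms)
  interpret IJ: pair_prob_space "pow I" "pow J" ..
  have [measurable]: "(\<lambda>\<omega>. (tup I \<omega>, tup J \<omega>)) \<in> measurable M (pow I \<Otimes>\<^sub>M pow J)" using I J by measurable
  have "integrable M (\<lambda>\<omega>. (\<lambda>(w, z). g w z) (tup I \<omega>, tup J \<omega>))" using int by simp
  then have "integrable (distr M (pow I \<Otimes>\<^sub>M pow J) (\<lambda>\<omega>. (tup I \<omega>, tup J \<omega>))) (\<lambda>(w, z). g w z)"
    using g by (subst integrable_distr_eq) simp_all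
  then have i: "integrable (pow I \<Otimes>\<^sub>M pow J) (\<lambda>(w, z). g w z)" by (simp only: distr_tup_pair[OF I J disj])
  show "integrable (pow I) (\<lambda>w. LINT z|pow J. g w z)" by (rule IJ.integrable_fst[OF i])
  show "AE w in pow I. integrable (pow J) (\<lambda>z. g w z)" by (rule IJ.AE_integrable_fst[OF i])
  have "(LINT \<omega>|M. g (tup I \<omega>) (tup J \<omega>)) = (LINT \<omega>|M. (\<lambda>(w, z). g w z) (tup I \<omega>, tup J \<omega>))" by simp
  also have "\<dots> = (LINT q|distr M (pow I \<Otimes>\<^sub>M pow J) (\<lambda>\<omega>. (tup I \<omega>, tup J \<omega>)). (\<lambda>(w, z). g w z) q)"
    using g by (intro integral_distr[symmetric]) simp_all
  also have "\<dots> = (LINT q|(pow I \<Otimes>\<^sub>M pow J). (\<lambda>(w, z). g w z) q)" by (simp only: distr_tup_pair[OF I J disj])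
  also have "\<dots> = (LINT w|pow I. LINT z|pow J. g w z)" by (rule IJ.integral_fst[OF i, symmetric])
  finally show "(LINT \<omega>|M. g (tup I \<omega>) (tup J \<omega>)) = (LINT w|pow I. LINT z|pow J. g w z)" .
qed

lemma distr_tup_permute:
  assumes \<pi>: "inj_on \<pi> I" "\<pi> ` I \<subseteq> K" and K: "K \<subseteq> {1..}" "K \<noteq> {}"
  shows "distr M (pow I) (\<lambda>\<omega>. \<lambda>i\<in>I. Xs (\<pi> i) \<omega>) = pow I"
proof -
  have r: "(\<lambda>w. \<lambda>i\<in>I. w (\<pi> i)) \<in> measurable (pow K) (pow I)"
    using \<pi> by (intro measurable_restrict measurable_component_singleton) auto
  have "distr M (pow I) (\<lambda>\<omega>. \<lambda>i\<in>I. Xs (\<pi> i) \<omega>) = distr M (pow I) ((\<lambda>w. \<lambda>i\<in>I. w (\<pi> i)) \<circ> tup K)"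
    using \<pi> by (intro distr_cong refl) (auto simp: fun_eq_iff)
  also have "\<dots> = distr (distr M (pow K) (tup K)) (pow I) (\<lambda>w. \<lambda>i\<in>I. w (\<pi> i))"
    using K by (intro distr_distr[symmetric] r measurable_tup)
  also have "\<dots> = distr (pow K) (pow I) (\<lambda>w. \<lambda>i\<in>I. w (\<pi> i))" by (simp only: distr_tup[OF K])
  also have "\<dots> = pow I"
    using \<pi> by (intro distr_PiM_reindex[of K "\<lambda>_. \<mu>" \<pi> I]) (auto intro: \<mu>.prob_space_axioms)
  finally show ?thesis .
qed

lemma exchangeable:
  fixes f :: "(nat \<Rightarrow> 'a) \<Rightarrow> real"
  assumes \<pi>: "bij_betw \<pi> {1..n} {1..n}" and n: "1 \<le> n" and f: "f \<in> borel_measurable (pow {1..n})"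
  shows "(LINT \<omega>|M. f (\<lambda>i\<in>{1..n}. Xs (\<pi> i) \<omega>)) = (LINT \<omega>|M. f (tup {1..n} \<omega>))"
    and "integrable M (\<lambda>\<omega>. f (\<lambda>i\<in>{1..n}. Xs (\<pi> i) \<omega>)) \<longleftrightarrow> integrable M (\<lambda>\<omega>. f (tup {1..n} \<omega>))"
proof -
  have \<pi>': "inj_on \<pi> {1..n}" "\<pi> ` {1..n} \<subseteq> {1..n}" "{1..n} \<subseteq> {1::nat..}" "{1..n} \<noteq> {}"
    using \<pi> n by (auto simp: bij_betw_def)
  have "1 \<le> \<pi> i" if "i \<in> {1..n}" for i
    using bij_betwE[OF \<pi>] that by auto
  then have m: "(\<lambda>\<omega>. \<lambda>i\<in>{1..n}. Xs (\<pi> i) \<omega>) \<in> measurable M (pow {1..n})"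
    by (intro measurable_restrict) auto
  have m2: "tup {1..n} \<in> measurable M (pow {1..n})" by (rule measurable_tup) auto
  note e = distr_tup_permute[OF \<pi>'] distr_tup[OF \<pi>'(3,4)]
  show "(LINT \<omega>|M. f (\<lambda>i\<in>{1..n}. Xs (\<pi> i) \<omega>)) = (LINT \<omega>|M. f (tup {1..n} \<omega>))"
    unfolding integral_distr[OF m f, symmetric] integral_distr[OF m2 f, symmetric] e ..
  show "integrable M (\<lambda>\<omega>. f (\<lambda>i\<in>{1..n}. Xs (\<pi> i) \<omega>)) \<longleftrightarrow> integrable M (\<lambda>\<omega>. f (tup {1..n} \<omega>))"
    unfolding integrable_distr_eq[OF m f, symmetric] integrable_distr_eq[OF m2 f, symmetric] e ..
qed

end

locale kl_subsample = kl_sample M p Xs k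
  for M :: "'w measure" and p :: "'a::euclidean_space \<Rightarrow> real" and Xs :: "nat \<Rightarrow> 'w \<Rightarrow> 'a" and k :: nat +
  fixes J :: "nat set"
  assumes finJ: "finite J" and J1: "J \<subseteq> {1..}" and kJ: "k \<le> card J"

sublocale kl_subsample \<subseteq> us: uniform_sample \<mu> J k
  by unfold_locales (fact finJ k1 kJ)+

context kl_subsample
begin

lemma borel_measurable_knn_prob [measurable]: "1 \<le> i \<Longrightarrow> knn_prob J i \<in> borel_measurable M"
proof -
  assume [measurable]: "1 \<le> i"
  have "(\<lambda>\<omega>. order_stat k J (\<lambda>j. transform (Xs i \<omega>) (Xs j \<omega>))) \<in> borel_measurable M"
    by (rule borel_measurable_order_stat[OF finJ k1 kJ]) (use J1 in auto)
  then show ?thesis unfolding knn_prob_def .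
qed

lemma knn_prob_eq_ord: "i \<in> I \<Longrightarrow> knn_prob J i \<omega> = us.ord (transform (tup I \<omega> i)) (tup J \<omega>)"
  by (auto simp: knn_prob_def us.ord_def intro!: order_stat_cong)

lemma borel_measurable_ord_pair [measurable]:
  assumes [measurable]: "f \<in> borel_measurable N" "g \<in> measurable N (pow J)"
  shows "(\<lambda>q. us.ord (transform (f q)) (g q)) \<in> borel_measurable N"
  unfolding us.ord_def
proof (rule borel_measurable_order_stat[OF finJ k1 kJ])
  fix j assume "j \<in> J"
  then have "(\<lambda>z. z j) \<in> measurable (pow J) \<mu>" by measurable
  then have "(\<lambda>q. g q j) \<in> measurable N \<mu>" by (rule measurable_compose[OF assms(2)])
  then have [measurable]: "(\<lambda>q. g q j) \<in> borel_measurable N"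
    by (simp only: measurable_cong_sets[OF refl sets_\<mu>])
  show "(\<lambda>q. transform (f q) (g q j)) \<in> borel_measurable N" by measurable
qed

lemma nn_integral_knn_prob_iterated:
  assumes i: "1 \<le> i" "i \<notin> J" and [measurable]: "g \<in> borel_measurable borel"
  shows "(\<integral>\<^sup>+\<omega>. g (knn_prob J i \<omega>) \<partial>M) = (\<integral>\<^sup>+w. \<integral>\<^sup>+z. g (us.ord (transform (w i)) z) \<partial>pow J \<partial>pow {i})"
proof -
  have "(\<integral>\<^sup>+\<omega>. g (knn_prob J i \<omega>) \<partial>M) = (\<integral>\<^sup>+\<omega>. g (us.ord (transform (tup {i} \<omega> i)) (tup J \<omega>)) \<partial>M)"
    by (simp add: knn_prob_eq_ord[of i "{i}"])
  also have "\<dots> = (\<integral>\<^sup>+w. \<integral>\<^sup>+z. g (us.ord (transform (w i)) z) \<partial>pow J \<partial>pow {i})"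
    by (rule nn_integral_tup_pair[where g="\<lambda>w z. g (us.ord (transform (w i)) z)"]) (use i finJ J1 in \<open>auto, measurable\<close>)
  finally show ?thesis .
qed

text \<open>The inner integral has the same value c for every position x of the i-th point, so
  averaging over x changes nothing: the law of \<open>knn_prob\<close> does not depend on the
  density.\<close>

lemma nn_integral_knn_prob:
  assumes i: "1 \<le> i" "i \<notin> J" and g: "g \<in> borel_measurable borel"
    and c: "\<And>x. (\<integral>\<^sup>+z. g (us.ord (transform x) z) \<partial>pow J) = c"
  shows "(\<integral>\<^sup>+\<omega>. g (knn_prob J i \<omega>) \<partial>M) = c"
proof -
  interpret I: prob_space "pow {i}" by (intro prob_space_PiM \<mu>.prob_space_axioms)
  show ?thesis by (simp add: nn_integral_knn_prob_iterated[OF i g] c I.emeasure_space_1)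
qed

lemma nn_integral_knn_prob_le:
  assumes i: "1 \<le> i" "i \<notin> J" and g: "g \<in> borel_measurable borel"
    and c: "\<And>x. (\<integral>\<^sup>+z. g (us.ord (transform x) z) \<partial>pow J) \<le> c"
  shows "(\<integral>\<^sup>+\<omega>. g (knn_prob J i \<omega>) \<partial>M) \<le> c"
proof -
  interpret I: prob_space "pow {i}" by (intro prob_space_PiM \<mu>.prob_space_axioms)
  have "(\<integral>\<^sup>+\<omega>. g (knn_prob J i \<omega>) \<partial>M) \<le> (\<integral>\<^sup>+w. c \<partial>pow {i})"
    unfolding nn_integral_knn_prob_iterated[OF i g] by (intro nn_integral_mono c)
  then show ?thesis by (simp add: I.emeasure_space_1)
qed

context
  fixes i :: nat
  assumes i: "1 \<le> i" "i \<notin> J"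
begin

lemma AE_knn_prob_pos: "AE \<omega> in M. 0 < knn_prob J i \<omega>"
proof -
  have [measurable]: "knn_prob J i \<in> borel_measurable M" by (rule borel_measurable_knn_prob[OF i(1)])
  have "(\<integral>\<^sup>+\<omega>. indicator {..0} (knn_prob J i \<omega>) \<partial>M) = 0"
  proof (rule nn_integral_knn_prob[OF i])
    fix x
    have "AE z in pow J. 0 < us.ord (transform x) z" by (rule us.AE_ord_pos[OF uniform_transform])
    then show "(\<integral>\<^sup>+z. indicator {..0} (us.ord (transform x) z) \<partial>pow J) = 0"
      by (subst nn_integral_cong_AE[of _ "\<lambda>_. 0"]) (auto elim!: eventually_mono)
  qed measurable
  then have "AE \<omega> in M. (indicator {..0} (knn_prob J i \<omega>) :: ennreal) = 0"
    by (subst (asm) nn_integral_0_iff_AE) auto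
  then show ?thesis by eventually_elim (auto simp: indicator_def split: if_splits)
qed

lemma nn_integral_knn_prob_eq: "(\<integral>\<^sup>+\<omega>. ennreal (knn_prob J i \<omega>) \<partial>M) = ennreal (real k / (real (card J) + 1))"
  by (rule nn_integral_knn_prob[OF i, of ennreal]) (auto simp: us.nn_integral_ord[OF uniform_transform])

lemma ln_knn_prob_squared:
  assumes c: "real (card J) \<le> c" "c \<le> real (card J) + 1"
  shows "integrable M (\<lambda>\<omega>. (ln (knn_prob J i \<omega>) + (ln c - \<psi>))\<^sup>2)"
    and "(LINT \<omega>|M. (ln (knn_prob J i \<omega>) + (ln c - \<psi>))\<^sup>2) \<le> 64 + 8 * real k + 2 * \<psi>\<^sup>2"
proof -
  have [measurable]: "knn_prob J i \<in> borel_measurable M" by (rule borel_measurable_knn_prob[OF i(1)])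
  have b: "(\<integral>\<^sup>+\<omega>. ennreal ((ln (knn_prob J i \<omega>) + (ln c - \<psi>))\<^sup>2) \<partial>M) \<le> ennreal (64 + 8 * real k + 2 * \<psi>\<^sup>2)"
  proof (rule nn_integral_knn_prob_le[OF i, of "\<lambda>t. ennreal ((ln t + (ln c - \<psi>))\<^sup>2)"])
    fix x
    show "(\<integral>\<^sup>+z. ennreal ((ln (us.ord (transform x) z) + (ln c - \<psi>))\<^sup>2) \<partial>pow J) \<le> ennreal (64 + 8 * real k + 2 * \<psi>\<^sup>2)"
      using us.expectation_ln_ord_squared_le[OF uniform_transform c, of x \<psi>] us.integrable_ln_ord_squared(1)[OF uniform_transform]
      by (subst nn_integral_eq_integral) (auto intro!: ennreal_leI simp del: ennreal_plus)
  qed measurable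
  show int: "integrable M (\<lambda>\<omega>. (ln (knn_prob J i \<omega>) + (ln c - \<psi>))\<^sup>2)"
    using b by (intro integrableI_bounded) (auto intro: le_less_trans)
  show "(LINT \<omega>|M. (ln (knn_prob J i \<omega>) + (ln c - \<psi>))\<^sup>2) \<le> 64 + 8 * real k + 2 * \<psi>\<^sup>2"
    using b nn_integral_eq_integral[OF int] by (subst ennreal_le_iff[symmetric]) (simp_all del: ennreal_plus)
qed

lemma integrable_ln_knn_prob_squared: "integrable M (\<lambda>\<omega>. (ln (knn_prob J i \<omega>) + c)\<^sup>2)"
  using ln_knn_prob_squared(1)[of "real (card J)" "ln (real (card J)) - c"] by simp

lemma integrable_ln_knn_prob: "integrable M (\<lambda>\<omega>. ln (knn_prob J i \<omega>) + c)"
proof (rule square_integrable_imp_integrable[OF _ integrable_ln_knn_prob_squared])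
  have [measurable]: "knn_prob J i \<in> borel_measurable M" by (rule borel_measurable_knn_prob[OF i(1)])
  show "(\<lambda>\<omega>. ln (knn_prob J i \<omega>) + c) \<in> borel_measurable M" by measurable
qed

lemma expectation_ln_knn_prob: "(LINT \<omega>|M. ln (knn_prob J i \<omega>) + c) = c - (harm (card J) - harm (k - 1))"
proof -
  interpret I: prob_space "pow {i}" by (intro prob_space_PiM \<mu>.prob_space_axioms)
  have "(LINT \<omega>|M. ln (knn_prob J i \<omega>) + c) = (LINT \<omega>|M. ln (us.ord (transform (tup {i} \<omega> i)) (tup J \<omega>)) + c)"
    by (simp add: knn_prob_eq_ord[of i "{i}"])
  also have "\<dots> = (LINT w|pow {i}. LINT z|pow J. ln (us.ord (transform (w i)) z) + c)"
    by (rule integral_tup_pair(2)[where g="\<lambda>w z. ln (us.ord (transform (w i)) z) + c"])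
       (use i finJ J1 integrable_ln_knn_prob[of c] in \<open>auto simp: knn_prob_eq_ord[of i "{i}"], measurable\<close>)
  also have "\<dots> = c - (harm (card J) - harm (k - 1))"
    using us.expectation_ln_ord[OF uniform_transform] by (simp add: I.prob_space)
  finally show ?thesis .
qed

end

end

section \<open>Covariance of two neighbour statistics\<close>

text \<open>The right-hand side of \<open>expectation_ln_ord_product_le\<close> as a function of the
  level a, which becomes random when a is the separation of two sample points.\<close>

definition cov_bound :: "nat \<Rightarrow> nat \<Rightarrow> real \<Rightarrow> real \<Rightarrow> real \<Rightarrow> real" where
  "cov_bound k m c C a = (let \<delta> = real k / ((real m + 1) * a); \<eta> = c - (harm m - harm (k - 1)) in
     2 * \<eta>\<^sup>2 + 2 * (- ln a * \<delta>)\<^sup>2 + sqrt \<delta> * (C + (- ln a)\<^sup>2) + (- ln a)\<^sup>2 * \<delta>)"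

lemma borel_measurable_cov_bound [measurable]:
  "(\<lambda>a. cov_bound k m c C a) \<in> borel_measurable borel"
  unfolding cov_bound_def Let_def by measurable

lemma cov_bound_nonneg: "0 \<le> a \<Longrightarrow> 0 \<le> C \<Longrightarrow> 0 \<le> cov_bound k m c C a"
  unfolding cov_bound_def Let_def by (intro add_nonneg_nonneg mult_nonneg_nonneg divide_nonneg_nonneg) auto

lemma cov_bound_tendsto_0:
  assumes a: "0 < a" and f: "filterlim f at_top sequentially"
    and \<eta>: "(\<lambda>n. c n - (harm (f n) - harm (k - 1))) \<longlonglongrightarrow> 0"
  shows "(\<lambda>n. cov_bound k (f n) (c n) C a) \<longlonglongrightarrow> 0"
proof -
  have "filterlim (\<lambda>n. real (f n)) at_top sequentially"
    by (rule filterlim_compose[OF filterlim_real_sequentially f])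
  then have "filterlim (\<lambda>n. a * real (f n)) at_top sequentially"
    by (rule filterlim_tendsto_pos_mult_at_top[OF tendsto_const a])
  then have "filterlim (\<lambda>n. (real (f n) + 1) * a) at_top sequentially"
    by (rule filterlim_at_top_mono) (use a in \<open>auto simp: algebra_simps\<close>)
  then have \<delta>: "(\<lambda>n. real k / ((real (f n) + 1) * a)) \<longlonglongrightarrow> 0"
    by (intro tendsto_divide_0[OF tendsto_const] filterlim_at_top_imp_at_infinity)
  have "(\<lambda>n. cov_bound k (f n) (c n) C a) \<longlonglongrightarrow> 2 * 0\<^sup>2 + 2 * (- ln a * 0)\<^sup>2 + sqrt 0 * (C + (- ln a)\<^sup>2) + (- ln a)\<^sup>2 * 0"
    unfolding cov_bound_def Let_def by (intro tendsto_intros \<delta> \<eta>)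
  then show ?thesis by simp
qed

context probability_density
begin

definition separation :: "'a \<Rightarrow> 'a \<Rightarrow> real" where
  "separation x y = min (cball_prob x (dist x y / 2)) (cball_prob y (dist x y / 2))"

lemma borel_measurable_separation [measurable]:
  assumes [measurable]: "f \<in> borel_measurable N" "g \<in> borel_measurable N"
  shows "(\<lambda>q. separation (f q) (g q)) \<in> borel_measurable N"
  unfolding separation_def by measurable

text \<open>By the triangle inequality no z is closer than half of the distance to both x and y.
  This is the disjointness required by \<open>expectation_ln_ord_product_le\<close>.\<close>

lemma separation_le_transform: "separation x y \<le> transform x z \<or> separation x y \<le> transform y z"
proof -
  have "dist x y / 2 \<le> dist x z \<or> dist x y / 2 \<le> dist y z"
    using dist_triangle2[of x y z] by linarith
  then show ?thesis
    using cball_prob_mono[of "dist x y / 2" "dist x z" x] cball_prob_mono[of "dist x y / 2" "dist y z" y]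
    by (auto simp: separation_def transform_def)
qed

end

context kl_sample
begin

lemma nn_integral_tup_single:
  assumes I: "finite I" "I \<subseteq> {1..}" "I \<noteq> {}" and l: "1 \<le> l" "l \<notin> I"
    and g: "(\<lambda>(w, y). g w y) \<in> borel_measurable (pow I \<Otimes>\<^sub>M \<mu>)"
  shows "(\<integral>\<^sup>+\<omega>. g (tup I \<omega>) (Xs l \<omega>) \<partial>M) = (\<integral>\<^sup>+w. \<integral>\<^sup>+y. g w y \<partial>\<mu> \<partial>pow I)"
proof -
  have d: "distr (pow {l}) \<mu> (\<lambda>z. z l) = \<mu>"
    by (rule distr_PiM_component[of "{l}" "\<lambda>_. \<mu>"]) (auto intro: \<mu>.prob_space_axioms)
  have m: "(\<lambda>z. z l) \<in> measurable (pow {l}) \<mu>" by measurable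
  have mq: "(\<lambda>q. (fst q, snd q l)) \<in> measurable (pow I \<Otimes>\<^sub>M pow {l}) (pow I \<Otimes>\<^sub>M \<mu>)"
    by (intro measurable_Pair measurable_fst measurable_compose[OF measurable_snd m])
  have "(\<integral>\<^sup>+\<omega>. g (tup I \<omega>) (Xs l \<omega>) \<partial>M) = (\<integral>\<^sup>+\<omega>. g (tup I \<omega>) (tup {l} \<omega> l) \<partial>M)" by simp
  also have "\<dots> = (\<integral>\<^sup>+w. \<integral>\<^sup>+z. g w (z l) \<partial>pow {l} \<partial>pow I)"
  proof (rule nn_integral_tup_pair[where g="\<lambda>w z. g w (z l)"])
    show "(\<lambda>(w, z). g w (z l)) \<in> borel_measurable (pow I \<Otimes>\<^sub>M pow {l})"
      using measurable_compose[OF mq g] by (simp add: case_prod_beta')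
  qed (use I l in auto)
  also have "\<dots> = (\<integral>\<^sup>+w. \<integral>\<^sup>+y. g w y \<partial>\<mu> \<partial>pow I)"
  proof (intro nn_integral_cong)
    fix w assume w: "w \<in> space (pow I)"
    have "(\<lambda>y. g w y) \<in> borel_measurable \<mu>" using measurable_Pair_compose_split[OF g measurable_const[OF w] measurable_ident] by simp
    then show "(\<integral>\<^sup>+z. g w (z l) \<partial>pow {l}) = (\<integral>\<^sup>+y. g w y \<partial>\<mu>)"
      by (subst d[symmetric], subst nn_integral_distr[OF m]) simp_all
  qed
  finally show ?thesis .
qed

lemma AE_transform_pos:
  assumes "1 \<le> i" "1 \<le> l" "i \<noteq> l"
  shows "AE \<omega> in M. 0 < transform (Xs i \<omega>) (Xs l \<omega>)"
proof -
  have [measurable]: "Xs i \<in> borel_measurable M" "Xs l \<in> borel_measurable M" using assms by simp_all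
  have wm: "(\<lambda>q. fst q i) \<in> borel_measurable (pow {i} \<Otimes>\<^sub>M \<mu>)"
    using measurable_compose[OF measurable_fst measurable_component_singleton[of i "{i}" "\<lambda>_. \<mu>"], of \<mu>]
    by (simp add: measurable_cong_sets[OF refl sets_\<mu>])
  have "(\<integral>\<^sup>+\<omega>. indicator {..0} (transform (tup {i} \<omega> i) (Xs l \<omega>)) \<partial>M)
      = (\<integral>\<^sup>+w. \<integral>\<^sup>+y. indicator {..0} (transform (w i) y) \<partial>\<mu> \<partial>pow {i})"
  proof (rule nn_integral_tup_single[where g="\<lambda>w y. indicator {..0} (transform (w i) y)"])
    show "(\<lambda>(w, y). indicator {..0} (transform (w i) y) :: ennreal) \<in> borel_measurable (pow {i} \<Otimes>\<^sub>M \<mu>)"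
      unfolding case_prod_beta' using wm by measurable
  qed (use assms in auto)
  also have "\<dots> = (\<integral>\<^sup>+w. 0 \<partial>pow {i})"
  proof (intro nn_integral_cong)
    fix w :: "nat \<Rightarrow> 'a"
    have "(\<integral>\<^sup>+y. indicator {..0} (transform (w i) y) \<partial>\<mu>) = (\<integral>\<^sup>+y. indicator {y \<in> space \<mu>. transform (w i) y \<le> 0} y \<partial>\<mu>)"
      by (intro nn_integral_cong) (auto split: split_indicator)
    also have "\<dots> = emeasure \<mu> {y \<in> space \<mu>. transform (w i) y \<le> 0}" by (rule nn_integral_indicator) measurable
    also have "\<dots> = 0" using uniform_transform[of "w i"] by (simp add: uniform_on_unit_def \<mu>.emeasure_eq_measure)
    finally show "(\<integral>\<^sup>+y. indicator {..0} (transform (w i) y) \<partial>\<mu>) = (0::ennreal)" .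
  qed
  finally have "(\<integral>\<^sup>+\<omega>. indicator {..0} (transform (Xs i \<omega>) (Xs l \<omega>)) \<partial>M) = (0::ennreal)" by simp
  then have "AE \<omega> in M. (indicator {..0} (transform (Xs i \<omega>) (Xs l \<omega>)) :: ennreal) = 0"
    by (subst (asm) nn_integral_0_iff_AE) auto
  then show ?thesis by eventually_elim (auto simp: indicator_def split: if_splits)
qed

text \<open>Coinciding points would have transform 0, a value that a uniform variable almost surely
  avoids.\<close>

lemma AE_Xs_distinct:
  assumes "1 \<le> i" "1 \<le> l" "i \<noteq> l"
  shows "AE \<omega> in M. Xs i \<omega> \<noteq> Xs l \<omega>"
  using AE_transform_pos[OF assms] by eventually_elim (auto simp: transform_def)

lemma AE_tup:
  assumes "J \<subseteq> {1..}" "J \<noteq> {}" "AE \<omega> in M. Q (tup J \<omega>)" "{w \<in> space (pow J). Q w} \<in> sets (pow J)"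
  shows "AE w in pow J. Q w"
proof -
  have "AE w in distr M (pow J) (tup J). Q w"
    by (subst AE_distr_iff) (use assms in \<open>auto intro: measurable_tup\<close>)
  then show ?thesis by (simp only: distr_tup[OF assms(1,2)])
qed

text \<open>Almost surely the two points are distinct Lebesgue points of positive density, and every
  ball around such a point has positive mass.\<close>

lemma AE_separation_pos:
  fixes i l :: nat
  assumes i: "1 \<le> i" and l: "1 \<le> l" and il: "i \<noteq> l"
  shows "AE w in pow {i, l}. 0 < separation (w i) (w l)"
proof -
  let ?I = "{i, l}"
  have I: "?I \<subseteq> {1..}" "?I \<noteq> {}" using i l by auto
  have wi: "(\<lambda>w. w i) \<in> borel_measurable (pow ?I)" by (rule borel_measurable_component) simp
  have wl: "(\<lambda>w. w l) \<in> borel_measurable (pow ?I)" by (rule borel_measurable_component) simp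
  have "AE w in pow ?I. w i \<noteq> w l"
  proof (rule AE_tup[OF I])
    show "AE \<omega> in M. tup ?I \<omega> i \<noteq> tup ?I \<omega> l" using AE_Xs_distinct[OF i l il] by simp
    have "(\<lambda>w. dist (w i) (w l)) \<in> borel_measurable (pow ?I)" using wi wl by (rule borel_measurable_dist)
    then have "{w \<in> space (pow ?I). 0 < dist (w i) (w l)} \<in> sets (pow ?I)" by (rule borel_measurable_less[OF borel_measurable_const])
    then show "{w \<in> space (pow ?I). w i \<noteq> w l} \<in> sets (pow ?I)" by (simp only: zero_less_dist_iff)
  qed
  moreover have "AE w in pow ?I. lebesgue_point (w i)" "AE w in pow ?I. lebesgue_point (w l)"
    by (rule AE_PiM_component[OF \<mu>.prob_space_axioms _ AE_lebesgue_point], simp)+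
  ultimately show ?thesis
    by eventually_elim (auto simp: separation_def intro!: lebesgue_point_cball_prob_pos)
qed

end

context kl_subsample
begin

lemma kl_subsample_insert: "1 \<le> l \<Longrightarrow> kl_subsample M p Xs k (insert l J)"
  by unfold_locales (use finJ J1 kJ in \<open>auto simp: card_insert_if\<close>)

text \<open>Let U be the old statistic and T the transformed distance to the new point. The
  statistic changes only if T <= U, and then stays between T and U, so the squared change is at most
  16 (T/U)^(-1/2). Given U, T is uniform, and this has mean at most 32 U; finally U has mean k /
  (card J + 1).\<close>

lemma ln_knn_prob_insert_diff:
  assumes i: "1 \<le> i" "i \<notin> J" and l: "1 \<le> l" "l \<notin> J" and il: "i \<noteq> l"
  shows "integrable M (\<lambda>\<omega>. (ln (knn_prob (insert l J) i \<omega>) - ln (knn_prob J i \<omega>))\<^sup>2)"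
    and "(LINT \<omega>|M. (ln (knn_prob (insert l J) i \<omega>) - ln (knn_prob J i \<omega>))\<^sup>2) \<le> 32 * real k / (real (card J) + 1)"
proof -
  interpret ins: kl_subsample M p Xs k "insert l J" by (rule kl_subsample_insert[OF l(1)])
  have [measurable]: "knn_prob J i \<in> borel_measurable M" by (rule borel_measurable_knn_prob[OF i(1)])
  have [measurable]: "knn_prob (insert l J) i \<in> borel_measurable M" by (rule ins.borel_measurable_knn_prob[OF i(1)])
  have [measurable]: "Xs i \<in> borel_measurable M" "Xs l \<in> borel_measurable M" using i l by simp_all
  let ?T = "\<lambda>\<omega>. transform (Xs i \<omega>) (Xs l \<omega>)"
  let ?h = "\<lambda>c t::real. ennreal ((t / c) powr (- (1/2)) * indicator {..c} t)"
  have [measurable]: "Measurable.pred M (\<lambda>\<omega>. ?T \<omega> \<in> {..knn_prob J i \<omega>})" unfolding atMost_iff by measurable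
  have "AE \<omega> in M. 0 < knn_prob (insert l J) i \<omega>" by (rule ins.AE_knn_prob_pos) (use i il in auto)
  then have "AE \<omega> in M. ennreal ((ln (knn_prob (insert l J) i \<omega>) - ln (knn_prob J i \<omega>))\<^sup>2) \<le> ennreal 16 * ?h (knn_prob J i \<omega>) (?T \<omega>)"
    using AE_knn_prob_pos[OF i] AE_transform_pos[OF i(1) l(1) il]
  proof eventually_elim
    case (elim \<omega>)
    have le: "knn_prob (insert l J) i \<omega> \<le> knn_prob J i \<omega>"
      unfolding knn_prob_def by (rule order_stat_subset_le[OF finJ k1 kJ]) (use finJ in auto)
    have ge: "min (?T \<omega>) (knn_prob J i \<omega>) \<le> knn_prob (insert l J) i \<omega>"
      unfolding knn_prob_def by (rule order_stat_insert_ge[OF finJ k1 kJ l(2)])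
    show ?case
    proof (cases "knn_prob (insert l J) i \<omega> = knn_prob J i \<omega>")
      case False
      then have T: "?T \<omega> \<le> knn_prob (insert l J) i \<omega>" "?T \<omega> \<le> knn_prob J i \<omega>" using le ge by auto
      have "ln (?T \<omega>) \<le> ln (knn_prob (insert l J) i \<omega>)" "ln (knn_prob (insert l J) i \<omega>) \<le> ln (knn_prob J i \<omega>)"
        using T le elim by auto
      then have "\<bar>ln (knn_prob (insert l J) i \<omega>) - ln (knn_prob J i \<omega>)\<bar> \<le> \<bar>ln (?T \<omega>) - ln (knn_prob J i \<omega>)\<bar>" by linarith
      then have "(ln (knn_prob (insert l J) i \<omega>) - ln (knn_prob J i \<omega>))\<^sup>2 \<le> (ln (?T \<omega>) - ln (knn_prob J i \<omega>))\<^sup>2" by (simp add: abs_le_square_iff)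
      also have "\<dots> = (ln (?T \<omega> / knn_prob J i \<omega>))\<^sup>2" using elim by (simp add: ln_div)
      also have "\<dots> \<le> (2 / (1/2))\<^sup>2 * (?T \<omega> / knn_prob J i \<omega>) powr (- (1/2))"
        using elim T by (intro ln_squared_le_powr_minus) auto
      finally have "(ln (knn_prob (insert l J) i \<omega>) - ln (knn_prob J i \<omega>))\<^sup>2 \<le> 16 * (?T \<omega> / knn_prob J i \<omega>) powr (- (1/2))" by simp
      then show ?thesis using T(2) by (simp add: ennreal_mult[symmetric] ennreal_leI del: ennreal_numeral)
    qed simp
  qed
  then have "(\<integral>\<^sup>+\<omega>. ennreal ((ln (knn_prob (insert l J) i \<omega>) - ln (knn_prob J i \<omega>))\<^sup>2) \<partial>M) \<le> (\<integral>\<^sup>+\<omega>. ennreal 16 * ?h (knn_prob J i \<omega>) (?T \<omega>) \<partial>M)"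
    by (rule nn_integral_mono_AE)
  also have "\<dots> = ennreal 16 * (\<integral>\<^sup>+\<omega>. ?h (knn_prob J i \<omega>) (?T \<omega>) \<partial>M)"
    by (rule nn_integral_cmult) measurable
  also have "(\<integral>\<^sup>+\<omega>. ?h (knn_prob J i \<omega>) (?T \<omega>) \<partial>M) \<le> (\<integral>\<^sup>+\<omega>. ennreal 2 * ennreal (knn_prob J i \<omega>) \<partial>M)"
  proof -
    \<comment> \<open>Conditioning on the i-th point and on all of \<open>J\<close> fixes the old
      statistic \<open>?o\<close>, so that only the new point remains random.\<close>
    let ?I = "insert i J"
    let ?o = "\<lambda>w. us.ord (transform (w i)) (restrict w J)"
    have oU: "?o (tup ?I \<omega>) = knn_prob J i \<omega>" for \<omega>
      by (auto simp: knn_prob_def us.ord_def intro!: order_stat_cong)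
    have wi: "(\<lambda>w. w i) \<in> borel_measurable (pow ?I)" by (rule borel_measurable_component) simp
    have wJ: "(\<lambda>w. restrict w J) \<in> measurable (pow ?I) (pow J)" by (rule measurable_restrict_subset) auto
    have om: "?o \<in> borel_measurable (pow ?I)" by (rule borel_measurable_ord_pair[OF wi wJ])
    have "(\<integral>\<^sup>+\<omega>. ?h (knn_prob J i \<omega>) (?T \<omega>) \<partial>M) = (\<integral>\<^sup>+\<omega>. ?h (?o (tup ?I \<omega>)) (transform (tup ?I \<omega> i) (Xs l \<omega>)) \<partial>M)"
      unfolding oU by simp
    also have "\<dots> = (\<integral>\<^sup>+w. \<integral>\<^sup>+y. ?h (?o w) (transform (w i) y) \<partial>\<mu> \<partial>pow ?I)"
    proof (rule nn_integral_tup_single[where g="\<lambda>w y. ?h (?o w) (transform (w i) y)"])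
      have [measurable]: "(\<lambda>q. ?o (fst q)) \<in> borel_measurable (pow ?I \<Otimes>\<^sub>M \<mu>)" "(\<lambda>q. fst q i) \<in> borel_measurable (pow ?I \<Otimes>\<^sub>M \<mu>)"
        using measurable_compose[OF measurable_fst om] measurable_compose[OF measurable_fst wi] by simp_all
      have [measurable]: "Measurable.pred (pow ?I \<Otimes>\<^sub>M \<mu>) (\<lambda>q. transform (fst q i) (snd q) \<in> {..?o (fst q)})"
        unfolding atMost_iff by measurable
      show "(\<lambda>(w, y). ?h (?o w) (transform (w i) y)) \<in> borel_measurable (pow ?I \<Otimes>\<^sub>M \<mu>)"
        unfolding case_prod_beta' by measurable
    qed (use finJ J1 i l il in auto)
    also have "\<dots> \<le> (\<integral>\<^sup>+w. ennreal 2 * ennreal (?o w) \<partial>pow ?I)"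
    proof (intro nn_integral_mono)
      fix w :: "nat \<Rightarrow> 'a"
      have "0 \<le> ?o w" by (rule us.ord_bounds[OF uniform_transform])
      show "(\<integral>\<^sup>+y. ?h (?o w) (transform (w i) y) \<partial>\<mu>) \<le> ennreal 2 * ennreal (?o w)"
      proof (cases "?o w = 0")
        case False
        then have "0 < ?o w" using \<open>0 \<le> ?o w\<close> by simp
        then show ?thesis using \<mu>.nn_integral_uniform_powr[OF uniform_transform \<open>0 < ?o w\<close>, of "w i"]
          by (simp add: ennreal_mult[symmetric] del: ennreal_numeral)
      qed simp
    qed
    also have "\<dots> = (\<integral>\<^sup>+\<omega>. ennreal 2 * ennreal (?o (tup ?I \<omega>)) \<partial>M)"
    proof -
      have I: "?I \<subseteq> {1..}" "?I \<noteq> {}" using J1 i by auto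
      have tm: "tup ?I \<in> measurable M (pow ?I)" by (rule measurable_tup[OF I(1)])
      show ?thesis
        by (subst (1) distr_tup[OF I, symmetric], subst nn_integral_distr[OF tm]) (use om in \<open>simp_all, measurable\<close>)
    qed
    finally show ?thesis unfolding oU .
  qed
  also have "(\<integral>\<^sup>+\<omega>. ennreal 2 * ennreal (knn_prob J i \<omega>) \<partial>M) = ennreal 2 * ennreal (real k / (real (card J) + 1))"
    by (subst nn_integral_cmult) (simp_all add: nn_integral_knn_prob_eq[OF i])
  also have "ennreal 16 * (ennreal 2 * ennreal (real k / (real (card J) + 1))) = ennreal (32 * real k / (real (card J) + 1))"
    by (simp add: ennreal_mult[symmetric] del: ennreal_numeral)
  finally have b: "(\<integral>\<^sup>+\<omega>. ennreal ((ln (knn_prob (insert l J) i \<omega>) - ln (knn_prob J i \<omega>))\<^sup>2) \<partial>M) \<le> ennreal (32 * real k / (real (card J) + 1))"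
    by (simp add: mult_left_mono)
  show int: "integrable M (\<lambda>\<omega>. (ln (knn_prob (insert l J) i \<omega>) - ln (knn_prob J i \<omega>))\<^sup>2)"
    using b by (intro integrableI_bounded) (auto intro: le_less_trans)
  show "(LINT \<omega>|M. (ln (knn_prob (insert l J) i \<omega>) - ln (knn_prob J i \<omega>))\<^sup>2) \<le> 32 * real k / (real (card J) + 1)"
    using b nn_integral_eq_integral[OF int] by (subst ennreal_le_iff[symmetric]) simp_all
qed

text \<open>For fixed positions of the two points, \<open>expectation_ln_ord_product_le\<close>
  applies with their separation as level. That bound is unbounded as the separation tends to 0,
  hence the minimum with the second-moment bound C. With two of n points omitted, card J + 1 is n -
  1, the normalisation of the full statistic.\<close>

lemma expectation_ln_knn_prob_product_le:
  fixes \<psi> :: real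
  assumes i: "1 \<le> i" "i \<notin> J" and l: "1 \<le> l" "l \<notin> J" and il: "i \<noteq> l"
  defines "c \<equiv> ln (real (card J) + 1) - \<psi>" and "C \<equiv> 64 + 8 * real k + 2 * \<psi>\<^sup>2"
  shows "(LINT \<omega>|M. (ln (knn_prob J i \<omega>) + c) * (ln (knn_prob J l \<omega>) + c))
    \<le> (LINT w|pow {i, l}. min C (cov_bound k (card J) c C (separation (w i) (w l))))"
proof -
  let ?I = "{i, l}"
  have I: "finite ?I" "?I \<subseteq> {1..}" "?I \<noteq> {}" "?I \<inter> J = {}" using i l by auto
  interpret I: prob_space "pow ?I" by (intro prob_space_PiM \<mu>.prob_space_axioms)
  have C0: "0 \<le> C" by (simp add: C_def)
  have [measurable]: "knn_prob J i \<in> borel_measurable M" "knn_prob J l \<in> borel_measurable M"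
    using borel_measurable_knn_prob[OF i(1)] borel_measurable_knn_prob[OF l(1)] by auto
  let ?Y = "\<lambda>x z. ln (us.ord (transform x) z) + c"
  have int: "integrable M (\<lambda>\<omega>. (ln (knn_prob J i \<omega>) + c) * (ln (knn_prob J l \<omega>) + c))"
    by (rule integrable_mult_of_squares) (use integrable_ln_knn_prob_squared i l in auto)
  have eq: "(ln (knn_prob J i \<omega>) + c) * (ln (knn_prob J l \<omega>) + c) = ?Y (tup ?I \<omega> i) (tup J \<omega>) * ?Y (tup ?I \<omega> l) (tup J \<omega>)" for \<omega>
    using knn_prob_eq_ord[of i ?I \<omega>] knn_prob_eq_ord[of l ?I \<omega>] by simp
  have wi: "(\<lambda>w. w i) \<in> borel_measurable (pow ?I)" by (rule borel_measurable_component) simp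
  have wl: "(\<lambda>w. w l) \<in> borel_measurable (pow ?I)" by (rule borel_measurable_component) simp
  have g: "(\<lambda>(w, z). ?Y (w i) z * ?Y (w l) z) \<in> borel_measurable (pow ?I \<Otimes>\<^sub>M pow J)"
  proof -
    have [measurable]: "(\<lambda>q. fst q i) \<in> borel_measurable (pow ?I \<Otimes>\<^sub>M pow J)" "(\<lambda>q. fst q l) \<in> borel_measurable (pow ?I \<Otimes>\<^sub>M pow J)"
      using measurable_compose[OF measurable_fst wi] measurable_compose[OF measurable_fst wl] by simp_all
    show ?thesis unfolding case_prod_beta' by measurable
  qed
  note tp = integral_tup_pair[OF I(1-3) finJ J1 I(4) g, OF int[unfolded eq]]
  have c: "real (card J) \<le> real (card J) + 1" "real (card J) + 1 \<le> real (card J) + 1" by auto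
  have sq: "(LINT z|pow J. (?Y x z)\<^sup>2) \<le> C" for x
    using us.expectation_ln_ord_squared_le[OF uniform_transform c, of x \<psi>] by (simp add: c_def C_def)
  have iq: "integrable (pow J) (\<lambda>z. (?Y x z)\<^sup>2)" for x
    by (rule us.integrable_ln_ord_squared(1)[OF uniform_transform])
  have ipr: "integrable (pow J) (\<lambda>z. ?Y x z * ?Y y z)" for x y
    by (rule integrable_mult_of_squares[OF _ _ iq iq]) measurable
  have le_C: "(LINT z|pow J. ?Y x z * ?Y y z) \<le> C" for x y
  proof -
    have "(LINT z|pow J. ?Y x z * ?Y y z) \<le> (LINT z|pow J. ((?Y x z)\<^sup>2 + (?Y y z)\<^sup>2) / 2)"
    proof (rule integral_mono[OF ipr])
      show "?Y x z * ?Y y z \<le> ((?Y x z)\<^sup>2 + (?Y y z)\<^sup>2) / 2" for z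
        by (rule mult_le_half_squares)
    qed (use iq in auto)
    also have "\<dots> = ((LINT z|pow J. (?Y x z)\<^sup>2) + (LINT z|pow J. (?Y y z)\<^sup>2)) / 2"
      using iq by simp
    also have "\<dots> \<le> C" using sq[of x] sq[of y] by simp
    finally show ?thesis .
  qed
  note sep_pos = AE_separation_pos[OF i(1) l(1) il]
  have "(LINT \<omega>|M. (ln (knn_prob J i \<omega>) + c) * (ln (knn_prob J l \<omega>) + c)) = (LINT w|pow ?I. LINT z|pow J. ?Y (w i) z * ?Y (w l) z)"
    unfolding eq by (rule tp(2))
  also have "\<dots> \<le> (LINT w|pow ?I. min C (cov_bound k (card J) c C (separation (w i) (w l))))"
  proof (rule integral_mono_AE[OF tp(1)])
    have nn: "0 \<le> separation x y" for x y by (simp add: separation_def)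
    have [measurable]: "(\<lambda>w. separation (w i) (w l)) \<in> borel_measurable (pow ?I)" by (rule borel_measurable_separation[OF wi wl])
    show "integrable (pow ?I) (\<lambda>w. min C (cov_bound k (card J) c C (separation (w i) (w l))))"
      by (rule I.integrable_const_bound[where B=C]) (use cov_bound_nonneg[OF nn C0] C0 in \<open>auto simp: abs_le_iff intro: order_trans[of _ 0]\<close>)
    show "AE w in pow ?I. (LINT z|pow J. ?Y (w i) z * ?Y (w l) z) \<le> min C (cov_bound k (card J) c C (separation (w i) (w l)))"
      using sep_pos
    proof eventually_elim
      case (elim w)
      have "(LINT z|pow J. ?Y (w i) z * ?Y (w l) z) \<le> cov_bound k (card J) c C (separation (w i) (w l))"
        unfolding cov_bound_def Let_def
        by (rule us.expectation_ln_ord_product_le[OF uniform_transform uniform_transform elim])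
           (use sq separation_le_transform in \<open>auto simp: separation_def min_le_iff_disj\<close>)
      then show ?case using le_C by simp
    qed
  qed
  finally show ?thesis .
qed

end

text \<open>First 1 and i are exchanged, then the image of 2 is exchanged with l; the second
  transposition leaves i alone because i differs from l and from the image of 2.\<close>

lemma ex_permutation_pair:
  fixes i l n :: nat
  assumes "i \<in> {1..n}" "l \<in> {1..n}" "i \<noteq> l"
  shows "\<exists>\<pi>. bij_betw \<pi> {1..n} {1..n} \<and> \<pi> 1 = i \<and> \<pi> 2 = l"
proof -
  have n: "1 \<in> {1..n}" "2 \<in> {1..n}" using assms by auto
  let ?t = "Transposition.transpose 1 i"
  let ?\<pi> = "Transposition.transpose l (?t 2) \<circ> ?t"
  have t2: "?t 2 \<in> {1..n}" using assms n by (auto simp: Transposition.transpose_def)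
  have "?t permutes {1..n}" using assms n by (intro permutes_swap_id) auto
  moreover have "Transposition.transpose l (?t 2) permutes {1..n}" using assms t2 by (intro permutes_swap_id) auto
  ultimately have "?\<pi> permutes {1..n}" by (rule permutes_compose)
  then have "bij_betw ?\<pi> {1..n} {1..n}" by (rule permutes_imp_bij)
  moreover have "?\<pi> 1 = i" using assms by (auto simp: Transposition.transpose_def)
  moreover have "?\<pi> 2 = l" by simp
  ultimately show ?thesis by blast
qed

context prob_space
begin

text \<open>Mixed terms are bounded from above only, which is what negative dependence can
  provide.\<close>

lemma
  fixes Z :: "nat \<Rightarrow> 'a \<Rightarrow> real"
  assumes m[measurable]: "\<And>i. i \<in> {1..n} \<Longrightarrow> Z i \<in> borel_measurable M"
    and int: "\<And>i. i \<in> {1..n} \<Longrightarrow> integrable M (\<lambda>\<omega>. (Z i \<omega>)\<^sup>2)"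
  shows integrable_average_squared: "integrable M (\<lambda>\<omega>. (1 / real n * (\<Sum>i=1..n. Z i \<omega>))\<^sup>2)"
    and expectation_average_squared_le: "1 \<le> n
      \<Longrightarrow> (\<And>i. i \<in> {1..n} \<Longrightarrow> expectation (\<lambda>\<omega>. (Z i \<omega>)\<^sup>2) \<le> a)
      \<Longrightarrow> (\<And>i l. i \<in> {1..n} \<Longrightarrow> l \<in> {1..n} \<Longrightarrow> i \<noteq> l \<Longrightarrow> expectation (\<lambda>\<omega>. Z i \<omega> * Z l \<omega>) \<le> b)
      \<Longrightarrow> 0 \<le> b \<Longrightarrow> expectation (\<lambda>\<omega>. (1 / real n * (\<Sum>i=1..n. Z i \<omega>))\<^sup>2) \<le> a / real n + b"
proof -
  have e: "(1 / real n * (\<Sum>i=1..n. Z i \<omega>))\<^sup>2 = (1 / (real n)\<^sup>2) * (\<Sum>i=1..n. \<Sum>l=1..n. Z i \<omega> * Z l \<omega>)" for \<omega>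
    by (simp add: power_mult_distrib power_one_over power2_eq_square sum_product)
  have ip: "integrable M (\<lambda>\<omega>. Z i \<omega> * Z l \<omega>)" if "i \<in> {1..n}" "l \<in> {1..n}" for i l
    by (rule integrable_mult_of_squares) (use that int in auto)
  show "integrable M (\<lambda>\<omega>. (1 / real n * (\<Sum>i=1..n. Z i \<omega>))\<^sup>2)"
    unfolding e using ip by (intro integrable_mult_right Bochner_Integration.integrable_sum) auto
  assume n: "1 \<le> n"
    and diag: "\<And>i. i \<in> {1..n} \<Longrightarrow> expectation (\<lambda>\<omega>. (Z i \<omega>)\<^sup>2) \<le> a"
    and off: "\<And>i l. i \<in> {1..n} \<Longrightarrow> l \<in> {1..n} \<Longrightarrow> i \<noteq> l \<Longrightarrow> expectation (\<lambda>\<omega>. Z i \<omega> * Z l \<omega>) \<le> b"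
    and b: "0 \<le> b"
  have "expectation (\<lambda>\<omega>. (1 / real n * (\<Sum>i=1..n. Z i \<omega>))\<^sup>2) = (1 / (real n)\<^sup>2) * (\<Sum>i=1..n. \<Sum>l=1..n. expectation (\<lambda>\<omega>. Z i \<omega> * Z l \<omega>))"
  proof -
    have "expectation (\<lambda>\<omega>. \<Sum>i=1..n. \<Sum>l=1..n. Z i \<omega> * Z l \<omega>) = (\<Sum>i=1..n. expectation (\<lambda>\<omega>. \<Sum>l=1..n. Z i \<omega> * Z l \<omega>))"
      by (intro Bochner_Integration.integral_sum Bochner_Integration.integrable_sum ip)
    also have "\<dots> = (\<Sum>i=1..n. \<Sum>l=1..n. expectation (\<lambda>\<omega>. Z i \<omega> * Z l \<omega>))"
      by (intro sum.cong refl Bochner_Integration.integral_sum ip)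
    finally show ?thesis unfolding e by simp
  qed
  \<comment> \<open>The diagonal terms receive a + b instead of a, so that the double sum is
    computed without separating the diagonal; this uses 0 <= b.\<close>
  also have "(\<Sum>i=1..n. \<Sum>l=1..n. expectation (\<lambda>\<omega>. Z i \<omega> * Z l \<omega>)) \<le> (\<Sum>i=1..n. \<Sum>l=1..n. (if l = i then a else 0) + b)"
  proof (intro sum_mono)
    fix i l assume "i \<in> {1..n}" "l \<in> {1..n}"
    then show "expectation (\<lambda>\<omega>. Z i \<omega> * Z l \<omega>) \<le> (if l = i then a else 0) + b"
      using diag[of i] off[of i l] b by (auto simp: power2_eq_square)
  qed
  also have "\<dots> = real n * a + (real n)\<^sup>2 * b" by (simp add: sum.distrib power2_eq_square algebra_simps)
  also have "1 / (real n)\<^sup>2 * (real n * a + (real n)\<^sup>2 * b) = a / real n + b"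
  proof -
    have "1 / x\<^sup>2 * (x * a + x\<^sup>2 * b) = a / x + b" if "x > 0" for x :: real
      using that by (simp add: power2_eq_square add_divide_distrib ring_distribs)
    then show ?thesis using n by simp
  qed
  finally show "expectation (\<lambda>\<omega>. (1 / real n * (\<Sum>i=1..n. Z i \<omega>))\<^sup>2) \<le> a / real n + b"
    by (simp add: mult_left_mono divide_right_mono)
qed

end

lemma ln_minus_harm_tendsto: "(\<lambda>n. ln (real (n - 1)) - harm (n - 1) :: real) \<longlonglongrightarrow> - euler_mascheroni"
proof -
  have "(\<lambda>n. - (harm n - ln (of_nat n)) :: real) \<longlonglongrightarrow> - euler_mascheroni"
    by (intro tendsto_minus euler_mascheroni_LIMSEQ)
  then have "(\<lambda>n. ln (real n) - harm n :: real) \<longlonglongrightarrow> - euler_mascheroni" by simp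
  then show ?thesis
    by (rule filterlim_compose) (rule filterlim_minus_const_nat_at_top)
qed

section \<open>The uniform part of the estimator\<close>

context kl_sample
begin

definition psi :: real where "psi = harm (k - 1) - euler_mascheroni"

lemma psi_eq: "psi = Digamma (real k)"
  using Digamma_of_nat[of "k - 1", where 'a=real] k1 by (simp add: psi_def)

definition Y :: "nat \<Rightarrow> nat \<Rightarrow> 'w \<Rightarrow> real" where
  "Y n i \<omega> = ln (knn_prob ({1..n} - {i}) i \<omega>) + (ln (real (n - 1)) - psi)"

abbreviation moment_bound :: real where "moment_bound \<equiv> 64 + 8 * real k + 2 * psi\<^sup>2"

lemma subsample: "J \<subseteq> {1..} \<Longrightarrow> finite J \<Longrightarrow> k \<le> card J \<Longrightarrow> kl_subsample M p Xs k J"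
  by unfold_locales

context
  fixes n i :: nat
  assumes n: "k + 1 \<le> n" and i: "i \<in> {1..n}"
begin

interpretation s: kl_subsample M p Xs k "{1..n} - {i}"
  by (rule subsample) (use n i in auto)

lemma borel_measurable_Y: "Y n i \<in> borel_measurable M"
proof -
  have [measurable]: "knn_prob ({1..n} - {i}) i \<in> borel_measurable M" by (rule s.borel_measurable_knn_prob) (use i in auto)
  show ?thesis unfolding Y_def[abs_def] by measurable
qed

lemma AE_knn_prob_full_pos: "AE \<omega> in M. 0 < knn_prob ({1..n} - {i}) i \<omega>"
  by (rule s.AE_knn_prob_pos) (use i in auto)

lemma Y_squared: "integrable M (\<lambda>\<omega>. (Y n i \<omega>)\<^sup>2)" "expectation (\<lambda>\<omega>. (Y n i \<omega>)\<^sup>2) \<le> moment_bound"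
  using s.ln_knn_prob_squared[of i "real (n - 1)" psi] n i by (auto simp: Y_def)

lemma integrable_Y: "integrable M (Y n i)"
  by (rule square_integrable_imp_integrable[OF borel_measurable_Y Y_squared(1)])

text \<open>The harmonic number of k - 1 in \<open>psi\<close> cancels against that in the mean of
  the order statistic, so only n is left.\<close>

lemma expectation_Y: "expectation (Y n i) = ln (real (n - 1)) - harm (n - 1) + euler_mascheroni"
  using s.expectation_ln_knn_prob[of i "ln (real (n - 1)) - psi"] n i by (simp add: Y_def[abs_def] psi_def)

end

lemma knn_prob_permute:
  assumes \<pi>: "bij_betw \<pi> {1..n} {1..n}" and n: "k + 1 \<le> n" and i: "i \<in> {1..n}"
  shows "order_stat k ({1..n} - {i}) (\<lambda>j. transform ((\<lambda>i\<in>{1..n}. x (\<pi> i)) i) ((\<lambda>i\<in>{1..n}. x (\<pi> i)) j))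
    = order_stat k ({1..n} - {\<pi> i}) (\<lambda>j. transform (x (\<pi> i)) (x j))"
proof -
  have "bij_betw \<pi> ({1..n} - {i}) ({1..n} - {\<pi> i})"
    using \<pi> i by (intro bij_betw_DiffI) (auto simp: bij_betw_def)
  then have "order_stat k ({1..n} - {i}) (\<lambda>j. transform (x (\<pi> i)) (x (\<pi> j))) = order_stat k ({1..n} - {\<pi> i}) (\<lambda>j. transform (x (\<pi> i)) (x j))"
    by (rule order_stat_reindex) (use n i k1 in auto)
  then show ?thesis using i by (subst order_stat_cong[where g="\<lambda>j. transform (x (\<pi> i)) (x (\<pi> j))"]) auto
qed

lemma expectation_Y_product_eq:
  assumes n: "k + 2 \<le> n" and i: "i \<in> {1..n}" and l: "l \<in> {1..n}" and il: "i \<noteq> l"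
  shows "expectation (\<lambda>\<omega>. Y n i \<omega> * Y n l \<omega>) = expectation (\<lambda>\<omega>. Y n 1 \<omega> * Y n 2 \<omega>)"
proof -
  obtain \<pi> where \<pi>: "bij_betw \<pi> {1..n} {1..n}" "\<pi> 1 = i" "\<pi> 2 = l"
    using ex_permutation_pair[OF i l il] by blast
  define h where "h i w = ln (order_stat k ({1..n} - {i}) (\<lambda>j. transform (w i) (w j))) + (ln (real (n - 1)) - psi)" for i and w :: "nat \<Rightarrow> 'a"
  have mh: "h i \<in> borel_measurable (pow {1..n})" if i: "i \<in> {1..n}" for i
  proof -
    have c: "(\<lambda>w. w j) \<in> borel_measurable (pow {1..n})" if "j \<in> {1..n}" for j
      using that by (rule borel_measurable_component)
    have [measurable]: "(\<lambda>w. order_stat k ({1..n} - {i}) (\<lambda>j. transform (w i) (w j))) \<in> borel_measurable (pow {1..n})"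
      by (rule borel_measurable_order_stat) (use n i k1 c in \<open>auto intro!: borel_measurable_transform\<close>)
    show ?thesis unfolding h_def[abs_def] by measurable
  qed
  have Yh: "Y n i \<omega> = h i (tup {1..n} \<omega>)" if "i \<in> {1..n}" for i \<omega>
    using that by (auto simp: Y_def h_def knn_prob_def intro!: arg_cong[where f=ln] order_stat_cong)
  have Yp: "h i (\<lambda>i\<in>{1..n}. Xs (\<pi> i) \<omega>) = Y n (\<pi> i) \<omega>" if "i \<in> {1..n}" for i \<omega>
    using knn_prob_permute[OF \<pi>(1) _ that, of "\<lambda>i. Xs i \<omega>"] n by (simp add: h_def Y_def knn_prob_def)
  have n12: "1 \<in> {1..n}" "2 \<in> {1..n}" using n k1 by auto
  have "expectation (\<lambda>\<omega>. Y n i \<omega> * Y n l \<omega>) = (LINT \<omega>|M. (\<lambda>w. h 1 w * h 2 w) (\<lambda>i\<in>{1..n}. Xs (\<pi> i) \<omega>))"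
    using Yp[OF n12(1)] Yp[OF n12(2)] \<pi> by simp
  also have "\<dots> = (LINT \<omega>|M. (\<lambda>w. h 1 w * h 2 w) (tup {1..n} \<omega>))"
    by (rule exchangeable(1)[OF \<pi>(1)]) (use n mh n12 in \<open>auto intro!: borel_measurable_times\<close>)
  also have "\<dots> = expectation (\<lambda>\<omega>. Y n 1 \<omega> * Y n 2 \<omega>)" using Yh n12 by simp
  finally show ?thesis .
qed

text \<open>The integral bounds the mixed moment when neither of the first two points counts as a
  neighbour; the second summand is the price in mean square of omitting them.\<close>

definition cov_limit :: "nat \<Rightarrow> real" where
  "cov_limit n = (LINT w|pow {1, 2::nat}. min moment_bound (cov_bound k (n - 2) (ln (real (n - 1)) - psi) moment_bound (separation (w 1) (w 2))))
     + sqrt (32 * real k / real (n - 1)) * (moment_bound + 1)"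

text \<open>Let A_1 and A_2 be the statistics without the points 1 and 2 as neighbours. Then Y_1 Y_2
  = A_1 A_2 + Y_2 (Y_1 - A_1) + A_1 (Y_2 - A_2), where the first product has the conditional
  covariance bound and the differences are small in mean square.\<close>

lemma expectation_Y_product_le:
  assumes n: "k + 2 \<le> n"
  shows "expectation (\<lambda>\<omega>. Y n 1 \<omega> * Y n 2 \<omega>) \<le> cov_limit n"
proof -
  let ?J = "{1..n} - {1, 2::nat}"
  have cJ: "card ?J = n - 2" using n k1 by (subst card_Diff_subset) auto
  interpret s: kl_subsample M p Xs k ?J
    by (rule subsample) (use n cJ in auto)
  let ?c = "ln (real (n - 1)) - psi"
  have n1: "real (n - 2) + 1 = real (n - 1)" using n by (simp add: of_nat_diff)
  have ins: "insert 2 ?J = {1..n} - {1}" "insert 1 ?J = {1..n} - {2}" using n k1 by auto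
  define A where "A i \<omega> = ln (knn_prob ?J i \<omega>) + ?c" for i \<omega>
  have [measurable]: "A i \<in> borel_measurable M" if "1 \<le> i" for i
  proof -
    have [measurable]: "knn_prob ?J i \<in> borel_measurable M" by (rule s.borel_measurable_knn_prob[OF that])
    show ?thesis unfolding A_def[abs_def] by measurable
  qed
  have Ym[measurable]: "Y n 1 \<in> borel_measurable M" "Y n 2 \<in> borel_measurable M"
    using n by (auto intro!: borel_measurable_Y)
  have A2: "integrable M (\<lambda>\<omega>. (A i \<omega>)\<^sup>2)" "expectation (\<lambda>\<omega>. (A i \<omega>)\<^sup>2) \<le> moment_bound" if "i \<in> {1, 2::nat}" for i
    using s.ln_knn_prob_squared[of i "real (n - 1)" psi] that n1 cJ by (auto simp: A_def)
  have Y2: "integrable M (\<lambda>\<omega>. (Y n i \<omega>)\<^sup>2)" "expectation (\<lambda>\<omega>. (Y n i \<omega>)\<^sup>2) \<le> moment_bound" if "i \<in> {1, 2::nat}" for i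
    using Y_squared[of n i] n that by auto
  define d where "d = 32 * real k / real (n - 1)"
  have d: "d > 0" using n k1 by (simp add: d_def)
  have D1: "integrable M (\<lambda>\<omega>. (Y n 1 \<omega> - A 1 \<omega>)\<^sup>2)" "expectation (\<lambda>\<omega>. (Y n 1 \<omega> - A 1 \<omega>)\<^sup>2) \<le> d"
    using s.ln_knn_prob_insert_diff[of 1 2, unfolded ins cJ n1] by (simp_all add: Y_def A_def d_def)
  have D2: "integrable M (\<lambda>\<omega>. (Y n 2 \<omega> - A 2 \<omega>)\<^sup>2)" "expectation (\<lambda>\<omega>. (Y n 2 \<omega> - A 2 \<omega>)\<^sup>2) \<le> d"
    using s.ln_knn_prob_insert_diff[of 2 1, unfolded ins cJ n1] by (simp_all add: Y_def A_def d_def)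
  \<comment> \<open>With t = sqrt d, each cross term costs at most t (\<open>moment_bound\<close> +
    1) / 2, since d / (2 t) = t / 2.\<close>
  define t where "t = sqrt d"
  have t: "t > 0" "t * t = d" using d by (auto simp: t_def)
  note cross = mult_le_weighted_squares[OF t(1)]
  have iA: "integrable M (\<lambda>\<omega>. A 1 \<omega> * A 2 \<omega>)"
    by (rule integrable_mult_of_squares) (use A2 in auto)
  have iY: "integrable M (\<lambda>\<omega>. Y n 1 \<omega> * Y n 2 \<omega>)"
    by (rule integrable_mult_of_squares[OF Ym]) (use Y2 in auto)
  have "expectation (\<lambda>\<omega>. Y n 1 \<omega> * Y n 2 \<omega>) \<le> expectation (\<lambda>\<omega>. A 1 \<omega> * A 2 \<omega>
      + (t * (Y n 2 \<omega>)\<^sup>2 / 2 + (Y n 1 \<omega> - A 1 \<omega>)\<^sup>2 / (2 * t)) + (t * (A 1 \<omega>)\<^sup>2 / 2 + (Y n 2 \<omega> - A 2 \<omega>)\<^sup>2 / (2 * t)))"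
  proof (rule integral_mono[OF iY])
    fix \<omega>
    have "Y n 1 \<omega> * Y n 2 \<omega> = A 1 \<omega> * A 2 \<omega> + Y n 2 \<omega> * (Y n 1 \<omega> - A 1 \<omega>) + A 1 \<omega> * (Y n 2 \<omega> - A 2 \<omega>)"
      by (simp add: algebra_simps)
    also have "\<dots> \<le> A 1 \<omega> * A 2 \<omega> + (t * (Y n 2 \<omega>)\<^sup>2 / 2 + (Y n 1 \<omega> - A 1 \<omega>)\<^sup>2 / (2 * t)) + (t * (A 1 \<omega>)\<^sup>2 / 2 + (Y n 2 \<omega> - A 2 \<omega>)\<^sup>2 / (2 * t))"
      by (intro add_mono order_refl cross)
    finally show "Y n 1 \<omega> * Y n 2 \<omega> \<le> \<dots>" .
  qed (use iA Y2 A2 D1 D2 in auto)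
  also have "\<dots> = expectation (\<lambda>\<omega>. A 1 \<omega> * A 2 \<omega>)
      + (t * expectation (\<lambda>\<omega>. (Y n 2 \<omega>)\<^sup>2) / 2 + expectation (\<lambda>\<omega>. (Y n 1 \<omega> - A 1 \<omega>)\<^sup>2) / (2 * t))
      + (t * expectation (\<lambda>\<omega>. (A 1 \<omega>)\<^sup>2) / 2 + expectation (\<lambda>\<omega>. (Y n 2 \<omega> - A 2 \<omega>)\<^sup>2) / (2 * t))"
    using iA Y2 A2 D1 D2 by simp
  also have "\<dots> \<le> (LINT w|pow {1, 2::nat}. min moment_bound (cov_bound k (n - 2) ?c moment_bound (separation (w 1) (w 2))))
      + (t * moment_bound / 2 + d / (2 * t)) + (t * moment_bound / 2 + d / (2 * t))"
  proof (intro add_mono)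
    show "expectation (\<lambda>\<omega>. A 1 \<omega> * A 2 \<omega>) \<le> (LINT w|pow {1, 2::nat}. min moment_bound (cov_bound k (n - 2) ?c moment_bound (separation (w 1) (w 2))))"
      using s.expectation_ln_knn_prob_product_le[of 1 2 psi] cJ n1 by (simp add: A_def)
  qed (use Y2 A2 D1 D2 t in \<open>auto intro!: divide_right_mono mult_left_mono\<close>)
  also have "\<dots> = cov_limit n"
  proof -
    have dt: "d / (2 * t) = t / 2" using t(1) unfolding t(2)[symmetric] by simp
    show ?thesis unfolding cov_limit_def d_def[symmetric] t_def[symmetric] dt
      by (simp add: field_simps)
  qed
  finally show ?thesis .
qed

text \<open>At every positive separation \<open>cov_bound\<close> tends to 0. The cap
  \<open>moment_bound\<close> is the constant dominating function that carries this over to the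
  integral over both points.\<close>

lemma cov_limit_tendsto_0: "cov_limit \<longlonglongrightarrow> 0"
proof -
  interpret I: prob_space "pow {1, 2::nat}" by (intro prob_space_PiM \<mu>.prob_space_axioms)
  have "(\<lambda>n. ln (real (n - 1)) - harm (n - 1)) \<longlonglongrightarrow> - (euler_mascheroni :: real)" by (rule ln_minus_harm_tendsto)
  \<comment> \<open>With two points omitted, harm (n - 2) meets the normalisation ln (n - 1); the
    mismatch with harm (n - 1) is 1 / (n - 1).\<close>
  moreover have "(\<lambda>n. harm (n - 1) - harm (n - 2) :: real) \<longlonglongrightarrow> 0"
  proof (rule Lim_transform_eventually)
    show "(\<lambda>n. 1 / real (n - 1)) \<longlonglongrightarrow> 0"
      by (intro tendsto_divide_0[OF tendsto_const] filterlim_at_top_imp_at_infinity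
          filterlim_compose[OF filterlim_real_sequentially filterlim_minus_const_nat_at_top])
    show "eventually (\<lambda>n. 1 / real (n - 1) = harm (n - 1) - harm (n - 2)) sequentially"
      using eventually_ge_at_top[of 2]
    proof eventually_elim
      case (elim n)
      then have "n = Suc (Suc (n - 2))" by simp
      then obtain m where "n = Suc (Suc m)" by blast
      then show ?case by (simp add: harm_Suc field_simps)
    qed
  qed
  ultimately have "(\<lambda>n. (ln (real (n - 1)) - harm (n - 1)) + (harm (n - 1) - harm (n - 2)) - psi + harm (k - 1)) \<longlonglongrightarrow> - euler_mascheroni + 0 - psi + harm (k - 1)"
    by (intro tendsto_intros)
  then have \<eta>: "(\<lambda>n. (ln (real (n - 1)) - psi) - (harm (n - 2) - harm (k - 1))) \<longlonglongrightarrow> 0"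
    by (simp add: psi_def algebra_simps)
  have wi: "(\<lambda>w. w i) \<in> borel_measurable (pow {1, 2::nat})" if "i \<in> {1, 2::nat}" for i
      using that by (rule borel_measurable_component)
  have [measurable]: "(\<lambda>w. separation (w 1) (w 2)) \<in> borel_measurable (pow {1, 2::nat})"
    by (intro borel_measurable_separation wi) auto
  have nn: "0 \<le> separation x y" for x y by (simp add: separation_def)
  have moment_bound: "0 \<le> moment_bound" by simp
  have "(\<lambda>n. LINT w|pow {1, 2::nat}. min moment_bound (cov_bound k (n - 2) (ln (real (n - 1)) - psi) moment_bound (separation (w 1) (w 2)))) \<longlonglongrightarrow> (LINT w|pow {1, 2::nat}. 0)"
  proof (rule integral_dominated_convergence[where w="\<lambda>_. moment_bound"])
    have "AE w in pow {1, 2::nat}. 0 < separation (w 1) (w 2)" by (rule AE_separation_pos) auto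
    then show "AE w in pow {1, 2::nat}. (\<lambda>n. min moment_bound (cov_bound k (n - 2) (ln (real (n - 1)) - psi) moment_bound (separation (w 1) (w 2)))) \<longlonglongrightarrow> 0"
    proof eventually_elim
      case (elim w)
      have "(\<lambda>n. min moment_bound (cov_bound k (n - 2) (ln (real (n - 1)) - psi) moment_bound (separation (w 1) (w 2)))) \<longlonglongrightarrow> min moment_bound 0"
        by (intro tendsto_min tendsto_const cov_bound_tendsto_0 elim \<eta> filterlim_minus_const_nat_at_top)
      then show ?case using moment_bound by (simp add: min_absorb2)
    qed
    show "AE w in pow {1, 2::nat}. norm (min moment_bound (cov_bound k (n - 2) (ln (real (n - 1)) - psi) moment_bound (separation (w 1) (w 2)))) \<le> moment_bound" for n
      using cov_bound_nonneg[OF nn moment_bound] moment_bound by (intro AE_I2) (simp add: abs_of_nonneg)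
    show "integrable (pow {1, 2::nat}) (\<lambda>_. moment_bound)" by (rule I.integrable_const)
    show "(\<lambda>w. min moment_bound (cov_bound k (n - 2) (ln (real (n - 1)) - psi) moment_bound (separation (w 1) (w 2)))) \<in> borel_measurable (pow {1, 2::nat})" for n
      by measurable
  qed simp
  moreover have "(\<lambda>n. sqrt (32 * real k / real (n - 1)) * (moment_bound + 1)) \<longlonglongrightarrow> 0"
  proof -
    have "(\<lambda>n. 32 * real k / real (n - 1)) \<longlonglongrightarrow> 0"
      by (intro tendsto_divide_0[OF tendsto_const] filterlim_at_top_imp_at_infinity
          filterlim_compose[OF filterlim_real_sequentially filterlim_minus_const_nat_at_top])
    then have "(\<lambda>n. sqrt (32 * real k / real (n - 1)) * (moment_bound + 1)) \<longlonglongrightarrow> sqrt 0 * (moment_bound + 1)"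
      by (intro tendsto_intros)
    then show ?thesis by simp
  qed
  ultimately have "cov_limit \<longlonglongrightarrow> (LINT w|pow {1, 2::nat}. 0) + 0"
    unfolding cov_limit_def[abs_def] by (rule tendsto_add)
  then show ?thesis by simp
qed

lemma Y_average_squared:
  assumes n: "k + 1 \<le> n"
  shows "integrable M (\<lambda>\<omega>. (1 / real n * (\<Sum>i=1..n. Y n i \<omega>))\<^sup>2)"
  using n by (intro integrable_average_squared borel_measurable_Y Y_squared) auto

lemma Y_average_tendsto_0:
  "(\<lambda>n. expectation (\<lambda>\<omega>. (1 / real n * (\<Sum>i=1..n. Y n i \<omega>))\<^sup>2)) \<longlonglongrightarrow> 0"
proof (rule tendsto_sandwich[OF _ _ tendsto_const])
  show "(\<lambda>n. moment_bound / real n + \<bar>cov_limit n\<bar>) \<longlonglongrightarrow> 0"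
  proof -
    have "(\<lambda>n. moment_bound / real n) \<longlonglongrightarrow> 0" by (intro tendsto_divide_0[OF tendsto_const] filterlim_at_top_imp_at_infinity filterlim_real_sequentially)
    moreover have "(\<lambda>n. \<bar>cov_limit n\<bar>) \<longlonglongrightarrow> 0" using cov_limit_tendsto_0 by (rule tendsto_rabs_zero)
    ultimately show ?thesis by (rule tendsto_add_zero)
  qed
  show "eventually (\<lambda>n. 0 \<le> expectation (\<lambda>\<omega>. (1 / real n * (\<Sum>i=1..n. Y n i \<omega>))\<^sup>2)) sequentially"
    by (intro always_eventually allI integral_nonneg_AE AE_I2) simp
  show "eventually (\<lambda>n. expectation (\<lambda>\<omega>. (1 / real n * (\<Sum>i=1..n. Y n i \<omega>))\<^sup>2) \<le> moment_bound / real n + \<bar>cov_limit n\<bar>) sequentially"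
    using eventually_ge_at_top[of "k + 2"]
  proof eventually_elim
    case (elim n)
    have "expectation (\<lambda>\<omega>. Y n i \<omega> * Y n l \<omega>) \<le> \<bar>cov_limit n\<bar>" if "i \<in> {1..n}" "l \<in> {1..n}" "i \<noteq> l" for i l
      using expectation_Y_product_eq[OF elim that] expectation_Y_product_le[OF elim] by simp
    then show ?case
      using elim by (intro expectation_average_squared_le) (auto intro!: borel_measurable_Y Y_squared)
  qed
qed

end

section \<open>Logarithms of ball averages\<close>

locale kl_density = probability_density p for p :: "'a::euclidean_space \<Rightarrow> real" +
  fixes \<epsilon> R :: real
  assumes \<epsilon>: "0 < \<epsilon>" and R: "0 < R" and Q: "Q_fun p \<epsilon> R < \<infinity>" and T: "T_fun p \<epsilon> R < \<infinity>"
begin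

text \<open>Rational radii make the suprema below countable, hence measurable in the centre;
  continuity of \<open>avg\<close> in the radius recovers all radii below \<open>R\<close>.\<close>

definition radii :: "real set" where "radii = {r \<in> \<rat>. 0 < r \<and> r < R}"

lemma countable_radii [simp]: "countable radii"
  unfolding radii_def by (rule countable_subset[OF _ countable_rat]) auto

abbreviation "powr_const \<equiv> (2 / \<epsilon>)\<^sup>2"

text \<open>Division by \<open>powr_const\<close> scales the squared logarithm so that it lies below
  the power of the maximal average itself.\<close>

definition sup_ln_avg_pos :: "'a \<Rightarrow> ennreal" where
  "sup_ln_avg_pos x = (SUP r\<in>radii. ennreal ((ln (max 1 (avg x r)))\<^sup>2 / powr_const))"
definition sup_ln_avg_neg :: "'a \<Rightarrow> ennreal" where
  "sup_ln_avg_neg x = (SUP r\<in>radii. ennreal ((ln (min 1 (avg x r)))\<^sup>2 / powr_const))"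

lemma borel_measurable_sup_ln_avg_pos [measurable]: "sup_ln_avg_pos \<in> borel_measurable borel"
  unfolding sup_ln_avg_pos_def[abs_def] by (intro borel_measurable_SUP) (auto intro!: measurable_compose[OF _ measurable_ennreal])
lemma borel_measurable_sup_ln_avg_neg [measurable]: "sup_ln_avg_neg \<in> borel_measurable borel"
  unfolding sup_ln_avg_neg_def[abs_def] by (intro borel_measurable_SUP) (auto intro!: measurable_compose[OF _ measurable_ennreal])

lemma powr_const_pos: "0 < powr_const" using \<epsilon> by simp

lemma sup_ln_avg_pos_le: "sup_ln_avg_pos x \<le> ennreal_powr (M_sup p x R) \<epsilon>"
  unfolding sup_ln_avg_pos_def
proof (rule SUP_least)
  fix r assume "r \<in> radii"
  then have r: "0 < r" "r < R" by (auto simp: radii_def)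
  have M: "ennreal (avg x r) \<le> M_sup p x R"
    unfolding M_sup_def I_avg_eq[OF r(1), symmetric] using r by (intro SUP_upper) auto
  show "ennreal ((ln (max 1 (avg x r)))\<^sup>2 / powr_const) \<le> ennreal_powr (M_sup p x R) \<epsilon>"
  proof (cases "M_sup p x R = \<infinity> \<or> avg x r \<le> 1")
    case True
    then show ?thesis by (auto simp: ennreal_powr_def)
  next
    case False
    then have a: "1 \<le> avg x r" and "M_sup p x R < \<top>" by (auto simp: less_top)
    then have "avg x r \<le> enn2real (M_sup p x R)"
      using enn2real_mono[OF M] avg_nonneg[OF r(1), of x] by simp
    then have "avg x r powr \<epsilon> \<le> enn2real (M_sup p x R) powr \<epsilon>"
      using a \<epsilon> by (intro powr_mono2) auto
    moreover have "(ln (avg x r))\<^sup>2 / powr_const \<le> avg x r powr \<epsilon>"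
      using ln_squared_le_powr[OF a \<epsilon>] powr_const_pos by (simp only: pos_divide_le_eq mult.commute)
    ultimately show ?thesis using False a by (auto simp: ennreal_powr_def max_absorb2 intro!: ennreal_leI)
  qed
qed

lemma sup_ln_avg_neg_le: "sup_ln_avg_neg x \<le> inverse (ennreal_powr (m_inf p x R) \<epsilon>)"
  unfolding sup_ln_avg_neg_def
proof (rule SUP_least)
  fix r assume "r \<in> radii"
  then have r: "0 < r" "r < R" by (auto simp: radii_def)
  have M: "m_inf p x R \<le> ennreal (avg x r)"
    unfolding m_inf_def I_avg_eq[OF r(1), symmetric] using r by (intro INF_lower) auto
  show "ennreal ((ln (min 1 (avg x r)))\<^sup>2 / powr_const) \<le> inverse (ennreal_powr (m_inf p x R) \<epsilon>)"
  \<comment> \<open>At average 0 the convention ln 0 = 0 makes the left side 0, just as it is for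
    averages of at least 1.\<close>
  proof (cases "avg x r = 0 \<or> 1 \<le> avg x r")
    case True
    then show ?thesis by auto
  next
    case False
    then have a: "0 < avg x r" "avg x r \<le> 1" using avg_nonneg[OF r(1), of x] by auto
    have fin: "m_inf p x R < \<top>" using M by (rule le_less_trans) simp
    have "enn2real (m_inf p x R) \<le> avg x r" using enn2real_mono[OF M] a by simp
    then have "enn2real (m_inf p x R) powr \<epsilon> \<le> avg x r powr \<epsilon>" using \<epsilon> by (intro powr_mono2) auto
    then have "inverse (ennreal (avg x r powr \<epsilon>)) \<le> inverse (ennreal (enn2real (m_inf p x R) powr \<epsilon>))"
      using a by (cases "enn2real (m_inf p x R) = 0") (auto simp: inverse_ennreal intro!: ennreal_leI)
    then have i: "inverse (ennreal (avg x r powr \<epsilon>)) \<le> inverse (ennreal_powr (m_inf p x R) \<epsilon>)"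
      using fin by (auto simp: ennreal_powr_def)
    have "(ln (avg x r))\<^sup>2 / powr_const \<le> avg x r powr - \<epsilon>"
      using ln_squared_le_powr_minus[OF a \<epsilon>] powr_const_pos by (simp only: pos_divide_le_eq mult.commute)
    then have "ennreal ((ln (avg x r))\<^sup>2 / powr_const) \<le> ennreal (avg x r powr - \<epsilon>)" by (rule ennreal_leI)
    also have "\<dots> = inverse (ennreal (avg x r powr \<epsilon>))"
      using a by (simp add: inverse_ennreal powr_minus)
    finally show ?thesis using a i by (simp add: min_absorb2 order_trans del: divide_divide_eq_right times_divide_eq_right)
  qed
qed

text \<open>\<open>enn2real\<close> sends an infinite value to 0, so this is a bound only where the
  suprema are finite, which holds almost everywhere.\<close>

definition ln_avg_bound :: "'a \<Rightarrow> real" where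
  "ln_avg_bound x = enn2real (ennreal powr_const * (sup_ln_avg_pos x + sup_ln_avg_neg x))"

lemma borel_measurable_ln_avg_bound [measurable]: "ln_avg_bound \<in> borel_measurable borel"
  unfolding ln_avg_bound_def[abs_def] by measurable

lemma ln_avg_bound_nonneg: "0 \<le> ln_avg_bound x" by (simp add: ln_avg_bound_def)

lemma nn_integral_B: "(\<integral>\<^sup>+x. ennreal powr_const * (sup_ln_avg_pos x + sup_ln_avg_neg x) \<partial>\<mu>) < \<infinity>"
proof -
  have "(\<integral>\<^sup>+x. sup_ln_avg_pos x \<partial>\<mu>) = (\<integral>\<^sup>+x. ennreal (p x) * sup_ln_avg_pos x \<partial>lborel)"
    unfolding \<mu>_def by (rule nn_integral_density) measurable
  also have "\<dots> \<le> Q_fun p \<epsilon> R"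
    unfolding Q_fun_def by (intro nn_integral_mono, subst mult.commute) (intro mult_right_mono sup_ln_avg_pos_le, simp)
  finally have p: "(\<integral>\<^sup>+x. sup_ln_avg_pos x \<partial>\<mu>) < \<infinity>" using Q by (rule le_less_trans)
  have "(\<integral>\<^sup>+x. sup_ln_avg_neg x \<partial>\<mu>) = (\<integral>\<^sup>+x. ennreal (p x) * sup_ln_avg_neg x \<partial>lborel)"
    unfolding \<mu>_def by (rule nn_integral_density) measurable
  also have "\<dots> \<le> T_fun p \<epsilon> R"
    unfolding T_fun_def by (intro nn_integral_mono, subst mult.commute) (intro mult_right_mono sup_ln_avg_neg_le, simp)
  finally have m: "(\<integral>\<^sup>+x. sup_ln_avg_neg x \<partial>\<mu>) < \<infinity>" using T by (rule le_less_trans)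
  have "(\<integral>\<^sup>+x. ennreal powr_const * (sup_ln_avg_pos x + sup_ln_avg_neg x) \<partial>\<mu>) = ennreal powr_const * ((\<integral>\<^sup>+x. sup_ln_avg_pos x \<partial>\<mu>) + (\<integral>\<^sup>+x. sup_ln_avg_neg x \<partial>\<mu>))"
    by (subst nn_integral_cmult, measurable, subst nn_integral_add, measurable)
  also have "\<dots> < \<infinity>" using p m by (simp add: ennreal_mult_less_top)
  finally show ?thesis .
qed

lemma integrable_ln_avg_bound: "integrable \<mu> ln_avg_bound"
proof (rule integrableI_bounded)
  have "(\<integral>\<^sup>+x. ennreal (norm (ln_avg_bound x)) \<partial>\<mu>) \<le> (\<integral>\<^sup>+x. ennreal powr_const * (sup_ln_avg_pos x + sup_ln_avg_neg x) \<partial>\<mu>)"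
    by (intro nn_integral_mono) (simp add: ln_avg_bound_def ennreal_enn2real_if)
  then show "(\<integral>\<^sup>+x. ennreal (norm (ln_avg_bound x)) \<partial>\<mu>) < \<infinity>" using nn_integral_B by (rule le_less_trans)
qed measurable

text \<open>Were the supremum smaller, continuity would give larger values on an interval to the
  right of r, and that interval contains a rational radius.\<close>

lemma SUP_radii_ge:
  assumes r: "0 < r" "r < R" and h: "isCont h r"
  shows "ennreal (h r) \<le> (SUP q\<in>radii. ennreal (h q))"
proof (rule ccontr)
  assume "\<not> ?thesis"
  then have lt: "(SUP q\<in>radii. ennreal (h q)) < ennreal (h r)" by simp
  have "((\<lambda>q. ennreal (h q)) \<longlongrightarrow> ennreal (h r)) (at r)"
    using h by (intro tendsto_ennrealI) (simp add: isCont_def)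
  then have "eventually (\<lambda>q. (SUP q\<in>radii. ennreal (h q)) < ennreal (h q)) (at r)"
    using lt by (rule order_tendstoD(1))
  then have "eventually (\<lambda>q. (SUP q\<in>radii. ennreal (h q)) < ennreal (h q)) (at_right r)"
    by (rule filter_leD[rotated]) (simp add: at_le)
  then obtain b where b: "b > r" "\<And>q. q > r \<Longrightarrow> q < b \<Longrightarrow> (SUP q\<in>radii. ennreal (h q)) < ennreal (h q)"
    unfolding eventually_at_right_field by auto
  have "r < min b R" using b r by simp
  then obtain q where q: "q \<in> \<rat>" "r < q" "q < min b R" using Rats_dense_in_real by blast
  then have "q \<in> radii" using r by (auto simp: radii_def)
  then have "ennreal (h q) \<le> (SUP q\<in>radii. ennreal (h q))" by (rule SUP_upper)
  then show False using b(2)[of q] q by simp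
qed

lemma ln_avg_squared_le:
  assumes "lebesgue_point x" "0 < r" "r < R" and fin: "ennreal powr_const * (sup_ln_avg_pos x + sup_ln_avg_neg x) < \<infinity>"
  shows "(ln (avg x r))\<^sup>2 \<le> ln_avg_bound x"
proof -
  have pos: "0 < avg x r"
    using lebesgue_point_cball_prob_pos[OF assms(1,2)] unit_vol_pos assms(2) by (simp add: avg_def)
  have c: "isCont (avg x) r" by (rule isCont_avg[OF assms(2)])
  have "isCont (\<lambda>r. (ln (max 1 (avg x r)))\<^sup>2 / powr_const) r"
    by (intro continuous_intros c) (use powr_const_pos in auto)
  from SUP_radii_ge[OF assms(2,3) this]
  have 1: "ennreal ((ln (max 1 (avg x r)))\<^sup>2 / powr_const) \<le> sup_ln_avg_pos x" by (simp add: sup_ln_avg_pos_def)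
  have "isCont (\<lambda>r. (ln (min 1 (avg x r)))\<^sup>2 / powr_const) r"
    by (intro continuous_intros c) (use powr_const_pos pos in auto)
  from SUP_radii_ge[OF assms(2,3) this]
  have 2: "ennreal ((ln (min 1 (avg x r)))\<^sup>2 / powr_const) \<le> sup_ln_avg_neg x" by (simp add: sup_ln_avg_neg_def)
  have "(ln (avg x r))\<^sup>2 = powr_const * ((ln (max 1 (avg x r)))\<^sup>2 / powr_const + (ln (min 1 (avg x r)))\<^sup>2 / powr_const)"
    using powr_const_pos pos by (cases "avg x r \<le> 1") (auto simp: max_def min_def distrib_left)
  also have "ennreal \<dots> \<le> ennreal powr_const * (sup_ln_avg_pos x + sup_ln_avg_neg x)"
  proof -
    have "ennreal (powr_const * ((ln (max 1 (avg x r)))\<^sup>2 / powr_const + (ln (min 1 (avg x r)))\<^sup>2 / powr_const))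
      = ennreal powr_const * (ennreal ((ln (max 1 (avg x r)))\<^sup>2 / powr_const) + ennreal ((ln (min 1 (avg x r)))\<^sup>2 / powr_const))"
      using powr_const_pos by (subst ennreal_mult) (auto simp del: divide_divide_eq_right times_divide_eq_right intro!: add_nonneg_nonneg divide_nonneg_nonneg)
    also have "\<dots> \<le> ennreal powr_const * (sup_ln_avg_pos x + sup_ln_avg_neg x)" by (intro mult_left_mono add_mono 1 2) auto
    finally show ?thesis .
  qed
  finally have "enn2real (ennreal ((ln (avg x r))\<^sup>2)) \<le> enn2real (ennreal powr_const * (sup_ln_avg_pos x + sup_ln_avg_neg x))"
    using fin by (intro enn2real_mono) auto
  then show ?thesis by (simp add: ln_avg_bound_def)
qed

definition dominated_point :: "'a \<Rightarrow> bool" where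
  "dominated_point x \<longleftrightarrow> lebesgue_point x \<and> (\<forall>r. 0 < r \<and> r < R \<longrightarrow> (ln (avg x r))\<^sup>2 \<le> ln_avg_bound x)"

lemma AE_dominated_point: "AE x in \<mu>. dominated_point x"
proof -
  have "AE x in \<mu>. ennreal powr_const * (sup_ln_avg_pos x + sup_ln_avg_neg x) \<noteq> \<infinity>"
    by (rule nn_integral_noteq_infinite) (use nn_integral_B in \<open>auto\<close>)
  then show ?thesis using AE_lebesgue_point
    by eventually_elim (auto simp: dominated_point_def less_top intro!: ln_avg_squared_le)
qed

text \<open>The bound for ball averages passes to the limit of radius 0 at a Lebesgue point. It
  makes ln p square-integrable, so the entropy is finite.\<close>

lemma dominated_point_ln_p:
  assumes "dominated_point x"
  shows "(ln (p x))\<^sup>2 \<le> ln_avg_bound x"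
proof (rule tendsto_upperbound)
  have x: "0 < p x" "(avg x \<longlongrightarrow> p x) (at_right 0)" using assms by (auto simp: dominated_point_def lebesgue_point_def)
  then show "((\<lambda>r. (ln (avg x r))\<^sup>2) \<longlongrightarrow> (ln (p x))\<^sup>2) (at_right 0)" by (intro tendsto_intros) auto
  show "\<forall>\<^sub>F r in at_right 0. (ln (avg x r))\<^sup>2 \<le> ln_avg_bound x"
    using assms R by (intro eventually_at_rightI[of 0 R]) (auto simp: dominated_point_def)
qed simp

lemma integrable_ln_p_squared: "integrable \<mu> (\<lambda>x. (ln (p x))\<^sup>2)"
  by (rule Bochner_Integration.integrable_bound[OF integrable_ln_avg_bound])
     (measurable, use AE_dominated_point in eventually_elim, auto dest!: dominated_point_ln_p simp: ln_avg_bound_nonneg)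

lemma integrable_ln_p: "integrable \<mu> (\<lambda>x. ln (p x))"
  by (rule \<mu>.square_integrable_imp_integrable[OF _ integrable_ln_p_squared]) measurable

lemma integrable_p_ln_p: "integrable lborel (\<lambda>x. p x * ln (p x))"
proof -
  have "integrable lborel (\<lambda>x. p x *\<^sub>R ln (p x))"
    using integrable_ln_p unfolding \<mu>_def
    by (subst (asm) integrable_density) (use p_nonneg in auto)
  then show ?thesis by simp
qed

lemma entropy_eq: "(LINT x|\<mu>. ln (p x)) = - differential_entropy p"
  unfolding \<mu>_def differential_entropy_def
  by (subst integral_density) (use p_nonneg in auto)

end

lemma integrable_square_sum:
  fixes f :: "'i \<Rightarrow> 'a \<Rightarrow> real"
  assumes "finite I" "\<And>i. i \<in> I \<Longrightarrow> f i \<in> borel_measurable M" "\<And>i. i \<in> I \<Longrightarrow> integrable M (\<lambda>x. (f i x)\<^sup>2)"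
  shows "integrable M (\<lambda>x. (\<Sum>i\<in>I. f i x)\<^sup>2)"
  using assms
proof (induction I rule: finite_induct)
  case (insert i I)
  have "integrable M (\<lambda>x. (f i x + (\<Sum>i\<in>I. f i x))\<^sup>2)"
    by (rule integrable_square_add) (use insert in auto)
  then show ?case using insert by simp
qed simp

section \<open>Ball averages at the neighbour distance: convergence and domination\<close>

locale kl_setting = kl_sample M p Xs k + kl_density p \<epsilon> R
  for M :: "'w measure" and p :: "'a::euclidean_space \<Rightarrow> real" and Xs :: "nat \<Rightarrow> 'w \<Rightarrow> 'a" and k :: nat and \<epsilon> R :: real
begin

definition knn_dist :: "nat \<Rightarrow> nat \<Rightarrow> 'w \<Rightarrow> real" where
  "knn_dist n i \<omega> = order_stat k ({1..n} - {i}) (\<lambda>j. dist (Xs i \<omega>) (Xs j \<omega>))"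

definition L :: "nat \<Rightarrow> nat \<Rightarrow> 'w \<Rightarrow> real" where
  "L n i \<omega> = ln (avg (Xs i \<omega>) (knn_dist n i \<omega>))"

context
  fixes n i :: nat
  assumes n: "k + 1 \<le> n" and i: "i \<in> {1..n}"
begin

lemma index_set: "finite ({1..n} - {i})" "k \<le> card ({1..n} - {i})"
  using n i by auto

lemma knn_prob_eq_cball_prob: "knn_prob ({1..n} - {i}) i \<omega> = cball_prob (Xs i \<omega>) (knn_dist n i \<omega>)"
  unfolding knn_prob_def knn_dist_def transform_def
  by (rule order_stat_mono_comp[OF index_set(1) k1 index_set(2) mono_cball_prob])

lemma borel_measurable_knn_dist: "knn_dist n i \<in> borel_measurable M"
proof -
  have "(\<lambda>\<omega>. order_stat k ({1..n} - {i}) (\<lambda>j. dist (Xs i \<omega>) (Xs j \<omega>))) \<in> borel_measurable M"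
    by (rule borel_measurable_order_stat[OF index_set(1) k1 index_set(2)]) (use i in auto)
  then show ?thesis by (simp add: knn_dist_def[abs_def])
qed

lemma borel_measurable_L: "L n i \<in> borel_measurable M"
proof -
  note [measurable] = borel_measurable_knn_dist
  have [measurable]: "Xs i \<in> borel_measurable M" using i by simp
  show ?thesis unfolding L_def[abs_def] by measurable
qed

lemma AE_knn_dist_pos: "AE \<omega> in M. 0 < knn_dist n i \<omega>"
  using AE_knn_prob_full_pos[OF n i] unfolding knn_prob_eq_cball_prob by eventually_elim (rule cball_prob_pos_imp)

end

lemma AE_Xs:
  assumes i: "1 \<le> i" and "AE x in \<mu>. Q x"
  shows "AE \<omega> in M. Q (Xs i \<omega>)"
proof (rule AE_distrD[of "Xs i" M borel])
  show "Xs i \<in> borel_measurable M" using i by simp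
  show "AE x in distr M borel (Xs i). Q x" using assms(2) unfolding law[OF i] \<mu>_def .
qed

lemma integral_Xs:
  fixes f :: "'a \<Rightarrow> real"
  assumes i: "1 \<le> i" and f: "f \<in> borel_measurable borel"
  shows "expectation (\<lambda>\<omega>. f (Xs i \<omega>)) = (LINT x|\<mu>. f x)" "integrable M (\<lambda>\<omega>. f (Xs i \<omega>)) \<longleftrightarrow> integrable \<mu> f"
  unfolding \<mu>_def law[OF i, symmetric] integral_distr[OF borel_measurable_Xs[OF i] f]
    integrable_distr_eq[OF borel_measurable_Xs[OF i] f] by (rule refl)+

text \<open>The mass of the neighbour ball has mean k / n, so its infimum over n has mean 0 and
  vanishes almost surely. At a Lebesgue point every ball of radius a has positive mass, so some
  neighbour distance is below a, and monotonicity in n keeps all later ones there.\<close>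

lemma AE_knn_dist_tendsto: "AE \<omega> in M. filterlim (\<lambda>n. knn_dist n 1 \<omega>) (at_right 0) sequentially"
proof -
  let ?U = "\<lambda>n \<omega>. knn_prob ({1..n} - {1}) 1 \<omega>"
  have mU: "?U n \<in> borel_measurable M" if "k + 1 \<le> n" for n
  proof -
    interpret s: kl_subsample M p Xs k "{1..n} - {1}" by (rule subsample) (use that in auto)
    show ?thesis by (rule s.borel_measurable_knn_prob) simp
  qed
  have EU: "(\<integral>\<^sup>+\<omega>. ennreal (?U n \<omega>) \<partial>M) = ennreal (real k / real n)" if "k + 1 \<le> n" for n
  proof -
    interpret s: kl_subsample M p Xs k "{1..n} - {1}" by (rule subsample) (use that in auto)
    show ?thesis using s.nn_integral_knn_prob_eq[of 1] that by (simp add: of_nat_diff)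
  qed
  have mI: "(\<lambda>\<omega>. INF n\<in>{k+1..}. ennreal (?U n \<omega>)) \<in> borel_measurable M"
    by (rule borel_measurable_INF) (auto simp only: atLeast_iff countableI_type intro!: measurable_compose[OF mU measurable_ennreal])
  have "(\<integral>\<^sup>+\<omega>. (INF n\<in>{k+1..}. ennreal (?U n \<omega>)) \<partial>M) \<le> 0"
  proof (rule tendsto_lowerbound)
    have "(\<lambda>n. real k / real n) \<longlonglongrightarrow> 0"
      by (intro tendsto_divide_0[OF tendsto_const] filterlim_at_top_imp_at_infinity filterlim_real_sequentially)
    then have "(\<lambda>n. ennreal (real k / real n)) \<longlonglongrightarrow> ennreal 0" by (rule tendsto_ennrealI)
    then show "(\<lambda>n. ennreal (real k / real n)) \<longlonglongrightarrow> 0" by simp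
    show "\<forall>\<^sub>F n in sequentially. (\<integral>\<^sup>+\<omega>. (INF n\<in>{k+1..}. ennreal (?U n \<omega>)) \<partial>M) \<le> ennreal (real k / real n)"
      using eventually_ge_at_top[of "k + 1"]
      by eventually_elim (auto simp: EU[symmetric] intro!: nn_integral_mono INF_lower)
  qed simp
  then have "AE \<omega> in M. (INF n\<in>{k+1..}. ennreal (?U n \<omega>)) = 0"
    using nn_integral_0_iff_AE[OF mI] by simp
  moreover have "AE \<omega> in M. \<forall>n\<in>{k+1..}. 0 < knn_dist n 1 \<omega>"
    by (intro AE_ball_countable[THEN iffD2] ballI AE_knn_dist_pos) auto
  moreover have "AE \<omega> in M. lebesgue_point (Xs 1 \<omega>)" by (rule AE_Xs[OF _ AE_lebesgue_point]) simp
  ultimately show ?thesis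
  proof eventually_elim
    case (elim \<omega>)
    have pos: "0 < knn_dist n 1 \<omega>" if "k + 1 \<le> n" for n using bspec[OF elim(2), of n] that by simp
    show ?case
    proof (rule filterlim_at[THEN iffD2, OF conjI])
      show "(\<lambda>n. knn_dist n 1 \<omega>) \<longlonglongrightarrow> 0"
      proof (rule order_tendstoI)
        fix a :: real assume "a < 0"
        show "\<forall>\<^sub>F n in sequentially. a < knn_dist n 1 \<omega>"
          by (rule eventually_mono[OF eventually_ge_at_top[of "k + 1"]]) (rule less_trans[OF \<open>a < 0\<close> pos])
      next
        fix a :: real assume a: "0 < a"
        have "(INF n\<in>{k+1..}. ennreal (?U n \<omega>)) < ennreal (cball_prob (Xs 1 \<omega>) a)"
          using elim(1) lebesgue_point_cball_prob_pos[OF elim(3) a] by simp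
        then obtain m where m: "k + 1 \<le> m" "ennreal (?U m \<omega>) < ennreal (cball_prob (Xs 1 \<omega>) a)"
          unfolding INF_less_iff by auto
        then have "cball_prob (Xs 1 \<omega>) (knn_dist m 1 \<omega>) < cball_prob (Xs 1 \<omega>) a"
          using knn_prob_eq_cball_prob[OF m(1), of 1 \<omega>] by (simp add: ennreal_less_iff)
        then have Rm: "knn_dist m 1 \<omega> < a" using cball_prob_mono[of a "knn_dist m 1 \<omega>" "Xs 1 \<omega>"] by linarith
        show "\<forall>\<^sub>F n in sequentially. knn_dist n 1 \<omega> < a"
          using eventually_ge_at_top[of m]
        proof eventually_elim
          case (elim n)
          have "knn_dist n 1 \<omega> \<le> knn_dist m 1 \<omega>"
            unfolding knn_dist_def using m(1) elim index_set[OF m(1), of 1] by (intro order_stat_subset_le k1) auto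
          then show ?case using Rm by simp
        qed
      qed
      show "\<forall>\<^sub>F n in sequentially. knn_dist n 1 \<omega> \<in> {0<..} \<and> knn_dist n 1 \<omega> \<noteq> 0"
        by (rule eventually_mono[OF eventually_ge_at_top[of "k + 1"]]) (use pos in force)
    qed
  qed
qed

lemma AE_L_tendsto: "AE \<omega> in M. (\<lambda>n. L n 1 \<omega>) \<longlonglongrightarrow> ln (p (Xs 1 \<omega>))"
proof -
  have "AE \<omega> in M. lebesgue_point (Xs 1 \<omega>)" by (rule AE_Xs[OF _ AE_lebesgue_point]) simp
  with AE_knn_dist_tendsto show ?thesis
  proof eventually_elim
    case (elim \<omega>)
    have p: "0 < p (Xs 1 \<omega>)" "(avg (Xs 1 \<omega>) \<longlongrightarrow> p (Xs 1 \<omega>)) (at_right 0)"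
      using elim(2) by (auto simp: lebesgue_point_def)
    have "(\<lambda>n. avg (Xs 1 \<omega>) (knn_dist n 1 \<omega>)) \<longlonglongrightarrow> p (Xs 1 \<omega>)"
      by (rule filterlim_compose[OF p(2) elim(1)])
    then show ?case unfolding L_def using p(1) by (intro tendsto_ln) auto
  qed
qed

definition ln_plus_dist :: "nat \<Rightarrow> 'w \<Rightarrow> real" where
  "ln_plus_dist j \<omega> = max 0 (ln (dist (Xs 1 \<omega>) (Xs j \<omega>)))"

text \<open>One of the two square roots bounds ln p and the other \<open>L\<close>. The constants
  and the distances to the points 2 to k + 1, which are neighbours for every n >= k + 1, cover the
  case of a neighbour distance of at least \<open>R\<close>.\<close>

definition dominating :: "'w \<Rightarrow> real" where
  "dominating \<omega> = 2 * sqrt (ln_avg_bound (Xs 1 \<omega>)) + (\<bar>ln ((R / 2) ^ DIM('a) * unit_vol TYPE('a))\<bar> + \<bar>ln (unit_vol TYPE('a))\<bar> + real DIM('a) * \<bar>ln R\<bar>)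
     + real DIM('a) * (\<Sum>j=2..k+1. ln_plus_dist j \<omega>)"

text \<open>If the neighbour distance r is at least \<open>R\<close>, the logarithm of the ball mass
  and that of r are bounded separately: the mass lies between that of the ball of radius R/2 and 1,
  and r lies between \<open>R\<close> and the largest distance to the first k other points.\<close>

lemma abs_L_le:
  assumes n: "k + 1 \<le> n" and x: "dominated_point (Xs 1 \<omega>)" and U: "0 < knn_prob ({1..n} - {1}) 1 \<omega>"
  shows "\<bar>L n 1 \<omega>\<bar> \<le> dominating \<omega> - sqrt (ln_avg_bound (Xs 1 \<omega>))"
proof -
  let ?x = "Xs 1 \<omega>" and ?r = "knn_dist n 1 \<omega>" and ?d = "real DIM('a)"
  have i1: "1 \<in> {1..n}" using n by auto
  have Ue: "knn_prob ({1..n} - {1}) 1 \<omega> = cball_prob ?x ?r" by (rule knn_prob_eq_cball_prob[OF n i1])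
  have r0: "0 < ?r" using U unfolding Ue by (rule cball_prob_pos_imp)
  have ell0: "0 \<le> (\<Sum>j=2..k+1. ln_plus_dist j \<omega>)" by (intro sum_nonneg) (simp add: ln_plus_dist_def)
  have dell0: "0 \<le> ?d * (\<Sum>j=2..k+1. ln_plus_dist j \<omega>)" by (rule mult_nonneg_nonneg[OF of_nat_0_le_iff ell0])
  have dR0: "0 \<le> ?d * \<bar>ln R\<bar>" by simp
  have V0: "0 < unit_vol TYPE('a)" by (rule unit_vol_pos)
  show ?thesis
  proof (cases "?r < R")
    case True
    have "(ln (avg ?x ?r))\<^sup>2 \<le> ln_avg_bound ?x" using x True r0 by (simp add: dominated_point_def)
    then have "\<bar>L n 1 \<omega>\<bar> \<le> sqrt (ln_avg_bound ?x)" by (simp add: L_def real_le_rsqrt)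
    then show ?thesis using dell0 dR0 unfolding dominating_def by linarith
  next
    case False
    \<comment> \<open>The radius is R/2 because the domination of ball averages is available only
      strictly below \<open>R\<close>.\<close>
    have F: "0 < cball_prob ?x (R / 2)" using lebesgue_point_cball_prob_pos[of ?x "R/2"] x R by (simp add: dominated_point_def)
    have "cball_prob ?x (R / 2) \<le> cball_prob ?x ?r" using False R by (intro cball_prob_mono) auto
    then have "ln (cball_prob ?x (R / 2)) \<le> ln (cball_prob ?x ?r)" using F by simp
    moreover have "ln (cball_prob ?x ?r) \<le> 0" using cball_prob_bounds(2)[of ?x ?r] U Ue by simp
    ultimately have lnU: "\<bar>ln (cball_prob ?x ?r)\<bar> \<le> \<bar>ln (cball_prob ?x (R / 2))\<bar>" by linarith
    have "ln (avg ?x (R / 2)) = ln (cball_prob ?x (R / 2)) - ln ((R / 2) ^ DIM('a) * unit_vol TYPE('a))"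
      unfolding avg_def using F R V0 by (intro ln_divide_pos) auto
    moreover have "\<bar>ln (avg ?x (R / 2))\<bar> \<le> sqrt (ln_avg_bound ?x)"
      using x R by (simp add: dominated_point_def real_le_rsqrt)
    ultimately have S: "\<bar>ln (cball_prob ?x (R / 2))\<bar> \<le> sqrt (ln_avg_bound ?x) + \<bar>ln ((R / 2) ^ DIM('a) * unit_vol TYPE('a))\<bar>" by linarith
    have lnr: "\<bar>ln ?r\<bar> \<le> \<bar>ln R\<bar> + (\<Sum>j=2..k+1. ln_plus_dist j \<omega>)"
    proof -
      have k2: "k + 1 \<le> k + 1" "(1::nat) \<in> {1..k + 1}" by auto
      have s: "{1..k + 1} - {1::nat} = {2..k + 1}" by auto
      have "?r \<le> knn_dist (k + 1) 1 \<omega>"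
        unfolding knn_dist_def using n index_set[OF k2] by (intro order_stat_subset_le k1) auto
      moreover obtain j where j: "j \<in> {2..k + 1}" "knn_dist (k + 1) 1 \<omega> = dist ?x (Xs j \<omega>)"
        using order_stat_attained[OF index_set(1)[OF k2] k1 index_set(2)[OF k2]] unfolding knn_dist_def s by blast
      ultimately have "ln ?r \<le> ln (dist ?x (Xs j \<omega>))" using r0 by (intro ln_mono) auto
      also have "\<dots> \<le> ln_plus_dist j \<omega>" by (simp add: ln_plus_dist_def)
      also have "\<dots> \<le> (\<Sum>j=2..k+1. ln_plus_dist j \<omega>)" using j(1) by (intro member_le_sum) (auto simp: ln_plus_dist_def)
      finally have "ln ?r \<le> (\<Sum>j=2..k+1. ln_plus_dist j \<omega>)" .
      moreover have "ln R \<le> ln ?r" using False R by simp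
      ultimately show ?thesis using ell0 by linarith
    qed
    have "L n 1 \<omega> = ln (cball_prob ?x ?r) - ln (?r ^ DIM('a) * unit_vol TYPE('a))"
      unfolding L_def avg_def using U Ue r0 V0 by (intro ln_divide_pos) auto
    also have "ln (?r ^ DIM('a) * unit_vol TYPE('a)) = ?d * ln ?r + ln (unit_vol TYPE('a))"
      using r0 V0 by (subst ln_mult_pos) (auto simp: ln_realpow)
    finally have "\<bar>L n 1 \<omega>\<bar> \<le> \<bar>ln (cball_prob ?x ?r)\<bar> + \<bar>?d * ln ?r\<bar> + \<bar>ln (unit_vol TYPE('a))\<bar>" by linarith
    moreover have "\<bar>?d * ln ?r\<bar> \<le> ?d * (\<bar>ln R\<bar> + (\<Sum>j=2..k+1. ln_plus_dist j \<omega>))"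
      using lnr by (simp add: abs_mult mult_left_mono)
    ultimately show ?thesis using lnU S unfolding dominating_def distrib_left by linarith
  qed
qed

lemma AE_L_dominated: "AE \<omega> in M. \<forall>n\<ge>k+1. \<bar>L n 1 \<omega> - ln (p (Xs 1 \<omega>))\<bar> \<le> dominating \<omega>"
proof -
  have "AE \<omega> in M. dominated_point (Xs 1 \<omega>)" by (rule AE_Xs[OF _ AE_dominated_point]) simp
  moreover have "AE \<omega> in M. \<forall>n\<in>{k+1..}. 0 < knn_prob ({1..n} - {1}) 1 \<omega>"
    by (intro AE_ball_countable[THEN iffD2] ballI AE_knn_prob_full_pos) auto
  ultimately show ?thesis
  proof eventually_elim
    case (elim \<omega>)
    show ?case
    proof (intro allI impI)
      fix n assume n: "k + 1 \<le> n"
      have "\<bar>ln (p (Xs 1 \<omega>))\<bar> \<le> sqrt (ln_avg_bound (Xs 1 \<omega>))" using dominated_point_ln_p[OF elim(1)] by (simp add: real_le_rsqrt)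
      then show "\<bar>L n 1 \<omega> - ln (p (Xs 1 \<omega>))\<bar> \<le> dominating \<omega>" using abs_L_le[OF n elim(1)] elim(2) n by fastforce
    qed
  qed
qed

text \<open>The moment of ln^+ of the distance between two independent points. Finiteness for q = 1
  or q = 2 is all that is extracted from \<open>K_fun\<close> or \<open>L_fun\<close>.\<close>

definition log_moment :: "nat \<Rightarrow> ennreal" where
  "log_moment q = (\<integral>\<^sup>+x. \<integral>\<^sup>+y. ennreal ((max 0 (ln (dist x y))) ^ q) \<partial>\<mu> \<partial>\<mu>)"

lemma borel_measurable_ln_plus_dist [measurable]: "1 \<le> j \<Longrightarrow> ln_plus_dist j \<in> borel_measurable M"
  unfolding ln_plus_dist_def[abs_def] by (intro borel_measurable_max borel_measurable_const borel_measurable_ln borel_measurable_dist borel_measurable_Xs) auto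

lemma integrable_ln_plus_dist:
  assumes q: "log_moment q < \<infinity>" and j: "2 \<le> j"
  shows "integrable M (\<lambda>\<omega>. (ln_plus_dist j \<omega>) ^ q)"
proof (rule integrableI_bounded)
  have [measurable]: "ln_plus_dist j \<in> borel_measurable M" using j by (intro borel_measurable_ln_plus_dist) auto
  show "(\<lambda>\<omega>. (ln_plus_dist j \<omega>) ^ q) \<in> borel_measurable M" by measurable
  let ?g = "\<lambda>x y. ennreal ((max 0 (ln (dist x (y::'a)))) ^ q)"
  have d: "distr (pow {1::nat}) \<mu> (\<lambda>z. z (1::nat)) = \<mu>"
    by (rule distr_PiM_component[of "{1::nat}" "\<lambda>_. \<mu>"]) (auto intro: \<mu>.prob_space_axioms)
  have wm: "(\<lambda>w. w 1) \<in> measurable (pow {1::nat}) \<mu>" by measurable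
  then have wb: "(\<lambda>q. fst q 1) \<in> borel_measurable (pow {1::nat} \<Otimes>\<^sub>M \<mu>)"
    using measurable_compose[OF measurable_fst wm] by (simp only: measurable_cong_sets[OF refl sets_\<mu>])
  have "(\<integral>\<^sup>+\<omega>. ennreal (norm ((ln_plus_dist j \<omega>) ^ q)) \<partial>M) = (\<integral>\<^sup>+\<omega>. ?g (tup {1} \<omega> 1) (Xs j \<omega>) \<partial>M)"
    by (simp add: ln_plus_dist_def)
  also have "\<dots> = (\<integral>\<^sup>+w. \<integral>\<^sup>+y. ?g (w 1) y \<partial>\<mu> \<partial>pow {1::nat})"
  proof (rule nn_integral_tup_single[where g="\<lambda>w y. ?g (w 1) y"])
    show "(\<lambda>(w, y). ?g (w 1) y) \<in> borel_measurable (pow {1::nat} \<Otimes>\<^sub>M \<mu>)"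
      unfolding case_prod_beta' using wb by measurable
  qed (use j in auto)
  also have "\<dots> = (\<integral>\<^sup>+x. \<integral>\<^sup>+y. ?g x y \<partial>\<mu> \<partial>distr (pow {1::nat}) \<mu> (\<lambda>z. z (1::nat)))"
    by (rule nn_integral_distr[symmetric, OF wm]) measurable
  also have "\<dots> < \<infinity>" using q unfolding d log_moment_def .
  finally show "(\<integral>\<^sup>+\<omega>. ennreal (norm ((ln_plus_dist j \<omega>) ^ q)) \<partial>M) < \<infinity>" .
qed

lemma borel_measurable_dominating [measurable]: "dominating \<in> borel_measurable M"
proof -
  have [measurable]: "Xs 1 \<in> borel_measurable M" by simp
  have [measurable]: "(\<lambda>\<omega>. \<Sum>j=2..k+1. ln_plus_dist j \<omega>) \<in> borel_measurable M" by (intro borel_measurable_sum borel_measurable_ln_plus_dist) auto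
  show ?thesis unfolding dominating_def[abs_def] by measurable
qed

lemma integrable_dominating:
  assumes "log_moment 1 < \<infinity>"
  shows "integrable M dominating"
proof -
  have [measurable]: "Xs 1 \<in> borel_measurable M" by simp
  have w: "integrable M (\<lambda>\<omega>. ln_avg_bound (Xs 1 \<omega>))" using integral_Xs(2)[of 1 ln_avg_bound] integrable_ln_avg_bound by simp
  have "integrable M (\<lambda>\<omega>. sqrt (ln_avg_bound (Xs 1 \<omega>)))"
    by (rule square_integrable_imp_integrable) (use w in \<open>simp_all add: ln_avg_bound_nonneg\<close>)
  moreover have "integrable M (\<lambda>\<omega>. \<Sum>j=2..k+1. ln_plus_dist j \<omega>)"
    using integrable_ln_plus_dist[OF assms] by (intro Bochner_Integration.integrable_sum) auto
  ultimately show ?thesis unfolding dominating_def[abs_def] by auto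
qed

lemma integrable_dominating_squared:
  assumes "log_moment 2 < \<infinity>"
  shows "integrable M (\<lambda>\<omega>. (dominating \<omega>)\<^sup>2)"
proof -
  have [measurable]: "Xs 1 \<in> borel_measurable M" by simp
  have [measurable]: "(\<lambda>\<omega>. \<Sum>j=2..k+1. ln_plus_dist j \<omega>) \<in> borel_measurable M" by (intro borel_measurable_sum borel_measurable_ln_plus_dist) auto
  have w: "integrable M (\<lambda>\<omega>. ln_avg_bound (Xs 1 \<omega>))" using integral_Xs(2)[of 1 ln_avg_bound] integrable_ln_avg_bound by simp
  have "integrable M (\<lambda>\<omega>. (\<Sum>j=2..k+1. ln_plus_dist j \<omega>)\<^sup>2)"
    using integrable_ln_plus_dist[OF assms] by (intro integrable_square_sum borel_measurable_ln_plus_dist) auto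
  then show ?thesis unfolding dominating_def[abs_def]
    by (intro integrable_square_add) (use w in \<open>simp_all add: power_mult_distrib ln_avg_bound_nonneg\<close>)
qed

definition error :: "nat \<Rightarrow> nat \<Rightarrow> real" where
  "error q n = expectation (\<lambda>\<omega>. \<bar>L n 1 \<omega> - ln (p (Xs 1 \<omega>))\<bar> ^ q)"

lemma L_convergence:
  assumes q: "q \<noteq> 0" and int: "integrable M (\<lambda>\<omega>. (dominating \<omega>) ^ q)"
  shows "error q \<longlonglongrightarrow> 0"
    and "k + 1 \<le> n \<Longrightarrow> integrable M (\<lambda>\<omega>. \<bar>L n 1 \<omega> - ln (p (Xs 1 \<omega>))\<bar> ^ q)"
proof -
  have X1: "Xs 1 \<in> borel_measurable M" by simp
  have lp: "(\<lambda>\<omega>. ln (p (Xs 1 \<omega>))) \<in> borel_measurable M" using X1 by measurable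
  have m: "(\<lambda>\<omega>. \<bar>L n 1 \<omega> - ln (p (Xs 1 \<omega>))\<bar> ^ q) \<in> borel_measurable M" if "k + 1 \<le> n" for n
  proof -
    have [measurable]: "L n 1 \<in> borel_measurable M" by (rule borel_measurable_L[OF that]) (use that in auto)
    show ?thesis using lp by measurable
  qed
  have dom: "AE \<omega> in M. norm (\<bar>L n 1 \<omega> - ln (p (Xs 1 \<omega>))\<bar> ^ q) \<le> (dominating \<omega>) ^ q" if "k + 1 \<le> n" for n
    using AE_L_dominated by eventually_elim (use that in \<open>auto intro!: power_mono\<close>)
  \<comment> \<open>The index is shifted because measurability and domination are available only
    from n = k + 1 on.\<close>
  have "(\<lambda>n. expectation (\<lambda>\<omega>. \<bar>L (n + (k + 1)) 1 \<omega> - ln (p (Xs 1 \<omega>))\<bar> ^ q)) \<longlonglongrightarrow> expectation (\<lambda>\<omega>. 0)"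
  proof (rule integral_dominated_convergence[where w="\<lambda>\<omega>. (dominating \<omega>) ^ q"])
    show "AE \<omega> in M. (\<lambda>n. \<bar>L (n + (k + 1)) 1 \<omega> - ln (p (Xs 1 \<omega>))\<bar> ^ q) \<longlonglongrightarrow> 0"
      using AE_L_tendsto
    proof eventually_elim
      case (elim \<omega>)
      have "(\<lambda>n. L (n + (k + 1)) 1 \<omega>) \<longlonglongrightarrow> ln (p (Xs 1 \<omega>))" using elim by (rule LIMSEQ_ignore_initial_segment)
      then have "(\<lambda>n. \<bar>L (n + (k + 1)) 1 \<omega> - ln (p (Xs 1 \<omega>))\<bar> ^ q) \<longlonglongrightarrow> \<bar>ln (p (Xs 1 \<omega>)) - ln (p (Xs 1 \<omega>))\<bar> ^ q"
        by (intro tendsto_intros)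
      moreover have "\<bar>ln (p (Xs 1 \<omega>)) - ln (p (Xs 1 \<omega>))\<bar> ^ q = 0" using q by simp
      ultimately show ?case by (simp only:)
    qed
  qed (use int m dom in auto)
  then have "(\<lambda>n. error q (n + (k + 1))) \<longlonglongrightarrow> 0" unfolding error_def by simp
  then show "error q \<longlonglongrightarrow> 0" by (rule LIMSEQ_offset)
  show "integrable M (\<lambda>\<omega>. \<bar>L n 1 \<omega> - ln (p (Xs 1 \<omega>))\<bar> ^ q)" if "k + 1 \<le> n"
    by (rule Bochner_Integration.integrable_bound[OF int m[OF that]])
       (use dom[OF that] in \<open>eventually_elim, auto\<close>)
qed

lemma L_exchangeable:
  assumes n: "k + 1 \<le> n" and i: "i \<in> {1..n}"
  shows "expectation (\<lambda>\<omega>. \<bar>L n i \<omega> - ln (p (Xs i \<omega>))\<bar> ^ q) = error q n"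
    and "integrable M (\<lambda>\<omega>. \<bar>L n i \<omega> - ln (p (Xs i \<omega>))\<bar> ^ q) \<longleftrightarrow> integrable M (\<lambda>\<omega>. \<bar>L n 1 \<omega> - ln (p (Xs 1 \<omega>))\<bar> ^ q)"
proof -
  let ?\<pi> = "Transposition.transpose 1 i"
  have i1: "1 \<in> {1..n}" using n by auto
  have "?\<pi> permutes {1..n}" using i i1 by (intro permutes_swap_id) auto
  then have \<pi>: "bij_betw ?\<pi> {1..n} {1..n}" by (rule permutes_imp_bij)
  define h where "h w = \<bar>ln (avg (w 1) (order_stat k ({1..n} - {1}) (\<lambda>j. dist (w 1) (w j)))) - ln (p (w 1))\<bar> ^ q" for w :: "nat \<Rightarrow> 'a"
  have c: "(\<lambda>w. w j) \<in> borel_measurable (pow {1..n})" if "j \<in> {1..n}" for j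
      using that by (rule borel_measurable_component)
  have mh: "h \<in> borel_measurable (pow {1..n})"
  proof -
    have [measurable]: "(\<lambda>w. order_stat k ({1..n} - {1}) (\<lambda>j. dist (w 1) (w j))) \<in> borel_measurable (pow {1..n})"
      by (rule borel_measurable_order_stat) (use n k1 c i1 in \<open>auto intro!: borel_measurable_dist\<close>)
    note [measurable] = c[OF i1]
    show ?thesis unfolding h_def[abs_def] by measurable
  qed
  have "bij_betw ?\<pi> ({1..n} - {1}) ({1..n} - {?\<pi> 1})"
    using \<pi> i1 i by (intro bij_betw_DiffI) (auto simp: bij_betw_def)
  then have b: "bij_betw ?\<pi> ({1..n} - {1}) ({1..n} - {i})" by simp
  have r: "order_stat k ({1..n} - {1}) (\<lambda>j. dist (Xs i \<omega>) (Xs (?\<pi> j) \<omega>)) = knn_dist n i \<omega>" for \<omega>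
    unfolding knn_dist_def by (rule order_stat_reindex[OF b]) (use n k1 in auto)
  have h1: "h (\<lambda>j\<in>{1..n}. Xs (?\<pi> j) \<omega>) = \<bar>L n i \<omega> - ln (p (Xs i \<omega>))\<bar> ^ q" for \<omega>
  proof -
    have "order_stat k ({1..n} - {1}) (\<lambda>j. dist ((\<lambda>j\<in>{1..n}. Xs (?\<pi> j) \<omega>) 1) ((\<lambda>j\<in>{1..n}. Xs (?\<pi> j) \<omega>) j))
      = order_stat k ({1..n} - {1}) (\<lambda>j. dist (Xs i \<omega>) (Xs (?\<pi> j) \<omega>))"
      using i1 by (intro order_stat_cong) auto
    then show ?thesis using i1 unfolding h_def L_def r[symmetric] by simp
  qed
  have h2: "h (tup {1..n} \<omega>) = \<bar>L n 1 \<omega> - ln (p (Xs 1 \<omega>))\<bar> ^ q" for \<omega>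
  proof -
    have "order_stat k ({1..n} - {1}) (\<lambda>j. dist (tup {1..n} \<omega> 1) (tup {1..n} \<omega> j)) = knn_dist n 1 \<omega>"
      unfolding knn_dist_def using i1 by (intro order_stat_cong) auto
    then show ?thesis using i1 unfolding h_def L_def by simp
  qed
  have n1: "1 \<le> n" using n by simp
  show "expectation (\<lambda>\<omega>. \<bar>L n i \<omega> - ln (p (Xs i \<omega>))\<bar> ^ q) = error q n"
    using exchangeable(1)[OF \<pi> n1 mh] unfolding h1 h2 error_def .
  show "integrable M (\<lambda>\<omega>. \<bar>L n i \<omega> - ln (p (Xs i \<omega>))\<bar> ^ q) \<longleftrightarrow> integrable M (\<lambda>\<omega>. \<bar>L n 1 \<omega> - ln (p (Xs 1 \<omega>))\<bar> ^ q)"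
    using exchangeable(2)[OF \<pi> n1 mh] unfolding h1 h2 .
qed

end

section \<open>Convergence of the estimator\<close>

lemma iter_exp_ge_1: "1 \<le> iter_exp N"
  by (induction N) (auto intro: order_trans[OF _ exp_ge_add_one_self])

lemma iter_ln_ge_1: "iter_exp N \<le> t \<Longrightarrow> 1 \<le> iter_ln N t"
proof (induction N arbitrary: t)
  case (Suc N)
  have shift: "iter_ln (Suc N) t = iter_ln N (ln t)" for t by (induction N) auto
  have "0 < t" using Suc.prems by (simp add: less_le_trans[OF exp_gt_zero])
  then have "iter_exp N \<le> ln t" using Suc.prems by (simp add: ln_ge_iff)
  then show ?case using Suc.IH shift by simp
qed simp

text \<open>From \<open>iter_exp N\<close> on, the iterated logarithm in \<open>G_fun\<close> is at
  least 1.\<close>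

lemma le_G_fun:
  assumes "1 \<le> N" "iter_exp N \<le> t"
  shows "t \<le> G_fun N t"
proof -
  obtain m where m: "N = Suc m" using assms(1) by (cases N) auto
  have "iter_exp (N - 1) < t"
    using exp_ge_add_one_self[of "iter_exp m"] assms(2) unfolding m iter_exp.simps diff_Suc_1 by linarith
  moreover have "t * 1 \<le> t * iter_ln N t"
    using iter_ln_ge_1[OF assms(2)] assms(2) iter_exp_ge_1[of N] by (intro mult_left_mono) auto
  ultimately show ?thesis by (simp add: G_fun_def)
qed

text \<open>Two thresholds are involved: r must lie in the range of integration of
  \<open>K_fun\<close>, and |ln r|^q must be large enough for \<open>le_G_fun\<close>. If the first
  fails, the left side is at most ln (\<open>iter_exp N\<close>)^q; if only the second fails, it is
  below \<open>iter_exp N\<close>. The constant is the sum of both.\<close>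

lemma ln_plus_powr_le_G_fun:
  fixes r :: real and q :: nat
  assumes N: "1 \<le> N" and r: "0 \<le> r" and q: "1 \<le> q"
  shows "ennreal ((max 0 (ln r)) ^ q)
    \<le> ennreal (ln (iter_exp N) ^ q + iter_exp N) + (if r > iter_exp N then ennreal (G_fun N (\<bar>ln r\<bar> powr real q)) else 0)"
proof (cases "r > iter_exp N")
  case False
  have e: "1 \<le> iter_exp N" by (rule iter_exp_ge_1)
  have "max 0 (ln r) \<le> ln (iter_exp N)"
    using False e r by (cases "r = 0") auto
  then have "(max 0 (ln r)) ^ q \<le> ln (iter_exp N) ^ q" by (intro power_mono) auto
  then have "ennreal ((max 0 (ln r)) ^ q) \<le> ennreal (ln (iter_exp N) ^ q + iter_exp N)"
    using e by (intro ennreal_leI) linarith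
  then show ?thesis using False by (simp del: ennreal_plus)
next
  case True
  have e: "1 \<le> iter_exp N" by (rule iter_exp_ge_1)
  have l: "0 < ln r" using True e by simp
  let ?t = "\<bar>ln r\<bar> powr real q"
  have t: "(max 0 (ln r)) ^ q = ?t" using l by (simp add: powr_realpow max_absorb2)
  show ?thesis
  proof (cases "iter_exp N \<le> ?t")
    case True
    have "ennreal ?t \<le> ennreal (G_fun N ?t)" by (rule ennreal_leI[OF le_G_fun[OF N True]])
    then show ?thesis unfolding t using \<open>r > iter_exp N\<close> by (simp add: add_increasing del: ennreal_plus)
  next
    case False
    have "0 \<le> ln (iter_exp N) ^ q" using e by simp
    then have "ennreal ?t \<le> ennreal (ln (iter_exp N) ^ q + iter_exp N)" using False by (intro ennreal_leI) linarith
    then show ?thesis unfolding t by (simp add: add_increasing2 del: ennreal_plus)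
  qed
qed

lemma borel_measurable_iter_ln [measurable]: "iter_ln N \<in> borel_measurable borel"
proof (induction N)
  case (Suc N)
  have "(\<lambda>t. ln (iter_ln N t)) \<in> borel_measurable borel" using Suc by (rule borel_measurable_ln)
  then show ?case by (simp cong: measurable_cong)
qed (simp cong: measurable_cong)

lemma borel_measurable_G_fun [measurable]: "G_fun N \<in> borel_measurable borel"
  unfolding G_fun_def[abs_def] by measurable

context kl_setting
begin

text \<open>The common part of both moment hypotheses: under a probability measure the constant
  contributes only C, so an integrable kernel dominating ln^+ up to a constant suffices.\<close>

lemma log_moment_less_infinity:
  assumes h: "(\<lambda>(x, y). h x y) \<in> borel_measurable (borel \<Otimes>\<^sub>M borel)"
    and le: "\<And>x y. ennreal ((max 0 (ln (dist x y))) ^ q) \<le> ennreal C + ennreal (h x y)"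
    and fin: "(\<integral>\<^sup>+x. \<integral>\<^sup>+y. ennreal (h x y * p x * p y) \<partial>lborel \<partial>lborel) < \<infinity>"
  shows "log_moment q < \<infinity>"
proof -
  have hm[measurable]: "(\<lambda>q. h (fst q) (snd q)) \<in> borel_measurable (borel \<Otimes>\<^sub>M borel)"
    using h by (simp add: case_prod_beta')
  have h1[measurable]: "(\<lambda>y. h x y) \<in> borel_measurable borel" for x
    using measurable_compose[OF measurable_Pair1' hm, of x] by simp
  have h2: "(\<lambda>x. \<integral>\<^sup>+y. ennreal (h x y) \<partial>\<mu>) \<in> borel_measurable borel"
  proof -
    have "(\<lambda>q. ennreal (h (fst q) (snd q))) \<in> borel_measurable (borel \<Otimes>\<^sub>M \<mu>)"
      using hm by (simp add: measurable_cong_sets[OF sets_pair_measure_cong[OF refl sets_\<mu>] refl])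
    from \<mu>.borel_measurable_nn_integral_fst[OF this] show ?thesis by simp
  qed
  have "(\<integral>\<^sup>+x. \<integral>\<^sup>+y. ennreal (h x y) \<partial>\<mu> \<partial>\<mu>) = (\<integral>\<^sup>+x. ennreal (p x) * (\<integral>\<^sup>+y. ennreal (h x y) \<partial>\<mu>) \<partial>lborel)"
    by (subst (1) \<mu>_def, rule nn_integral_density) (use h2 in simp_all)
  also have "\<dots> = (\<integral>\<^sup>+x. \<integral>\<^sup>+y. ennreal (h x y * p x * p y) \<partial>lborel \<partial>lborel)"
  proof (intro nn_integral_cong)
    fix x
    have hp: "ennreal (h x y * p x * p y) = ennreal (h x y) * ennreal (p x) * ennreal (p y)" for y
      by (simp add: ennreal_mult'' p_nonneg)
    have "(\<integral>\<^sup>+y. ennreal (h x y) \<partial>\<mu>) = (\<integral>\<^sup>+y. ennreal (p y) * ennreal (h x y) \<partial>lborel)"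
      unfolding \<mu>_def by (rule nn_integral_density) simp_all
    also have "ennreal (p x) * \<dots> = (\<integral>\<^sup>+y. ennreal (p x) * (ennreal (p y) * ennreal (h x y)) \<partial>lborel)"
      by (rule nn_integral_cmult[symmetric]) simp
    also have "\<dots> = (\<integral>\<^sup>+y. ennreal (h x y * p x * p y) \<partial>lborel)"
      unfolding hp by (intro nn_integral_cong) (simp only: ac_simps)
    finally show "ennreal (p x) * (\<integral>\<^sup>+y. ennreal (h x y) \<partial>\<mu>) = (\<integral>\<^sup>+y. ennreal (h x y * p x * p y) \<partial>lborel)" .
  qed
  finally have e: "(\<integral>\<^sup>+x. \<integral>\<^sup>+y. ennreal (h x y) \<partial>\<mu> \<partial>\<mu>) < \<infinity>" using fin by simp
  have "log_moment q \<le> (\<integral>\<^sup>+x. \<integral>\<^sup>+y. ennreal C + ennreal (h x y) \<partial>\<mu> \<partial>\<mu>)"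
    unfolding log_moment_def by (intro nn_integral_mono le)
  also have "\<dots> = (\<integral>\<^sup>+x. ennreal C + (\<integral>\<^sup>+y. ennreal (h x y) \<partial>\<mu>) \<partial>\<mu>)"
    using \<mu>.emeasure_space_1 by (intro nn_integral_cong, subst nn_integral_add) simp_all
  also have "\<dots> = ennreal C + (\<integral>\<^sup>+x. \<integral>\<^sup>+y. ennreal (h x y) \<partial>\<mu> \<partial>\<mu>)"
    using \<mu>.emeasure_space_1 h2 by (subst nn_integral_add) simp_all
  also have "\<dots> < \<infinity>" using e by simp
  finally show ?thesis .
qed

lemma log_moment_K_fun:
  assumes N: "1 \<le> N" and q: "1 \<le> q" and K: "K_fun p (real q) N < \<infinity>"
  shows "log_moment q < \<infinity>"
proof (rule log_moment_less_infinity)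
  let ?h = "\<lambda>x y::'a. (if norm (x - y) > iter_exp N then G_fun N (\<bar>ln (norm (x - y))\<bar> powr real q) else 0)"
  show "(\<lambda>(x, y). ?h x y) \<in> borel_measurable (borel \<Otimes>\<^sub>M borel)"
    unfolding case_prod_beta' by measurable
  show "ennreal ((max 0 (ln (dist x y))) ^ q) \<le> ennreal (ln (iter_exp N) ^ q + iter_exp N) + ennreal (?h x y)" for x y
    using ln_plus_powr_le_G_fun[OF N zero_le_dist q, of x y] by (auto simp: dist_norm)
  have "(\<integral>\<^sup>+x. \<integral>\<^sup>+y. ennreal (?h x y * p x * p y) \<partial>lborel \<partial>lborel) = K_fun p (real q) N"
    unfolding K_fun_def by (intro nn_integral_cong) (auto split: split_indicator)
  then show "(\<integral>\<^sup>+x. \<integral>\<^sup>+y. ennreal (?h x y * p x * p y) \<partial>lborel \<partial>lborel) < \<infinity>" using K by simp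
qed

lemma log_moment_L_fun:
  assumes \<nu>: "real q < \<nu>" and q: "1 \<le> q" and L: "L_fun p \<nu> < \<infinity>"
  shows "log_moment q < \<infinity>"
proof (rule log_moment_less_infinity)
  let ?h = "\<lambda>x y::'a. \<bar>ln (norm (x - y))\<bar> powr \<nu>"
  show "(\<lambda>(x, y). ?h x y) \<in> borel_measurable (borel \<Otimes>\<^sub>M borel)"
    unfolding case_prod_beta' by measurable
  show "ennreal ((max 0 (ln (dist x y))) ^ q) \<le> ennreal 1 + ennreal (?h x y)" for x y :: 'a
  proof (cases "1 \<le> ln (dist x y)")
    case True
    then have "(max 0 (ln (dist x y))) ^ q = ln (dist x y) powr real q" by (simp add: powr_realpow max_absorb2)
    also have "\<dots> \<le> ln (dist x y) powr \<nu>" using True \<nu> by (intro powr_mono) auto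
    finally have "ennreal ((max 0 (ln (dist x y))) ^ q) \<le> ennreal (?h x y)" using True by (auto simp: dist_norm intro!: ennreal_leI)
    then show ?thesis by (simp add: add_increasing)
  next
    case False
    then have "(max 0 (ln (dist x y))) ^ q \<le> 1" by (intro power_le_one) auto
    then have "ennreal ((max 0 (ln (dist x y))) ^ q) \<le> ennreal 1" by (rule ennreal_leI)
    then show ?thesis by (simp add: add_increasing2)
  qed
  show "(\<integral>\<^sup>+x. \<integral>\<^sup>+y. ennreal (?h x y * p x * p y) \<partial>lborel \<partial>lborel) < \<infinity>"
    using L by (simp add: L_fun_def)
qed

text \<open>Each summand is multiplied and divided by the mass of the neighbour ball inside the
  logarithm. This is legitimate almost surely because that mass is positive.\<close>

lemma KL_estimator_eq:
  assumes n: "k + 1 \<le> n"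
  shows "AE \<omega> in M. KL_estimator (\<lambda>i. Xs i \<omega>) n k = 1 / real n * (\<Sum>i=1..n. Y n i \<omega> - L n i \<omega>)"
proof -
  have "AE \<omega> in M. \<forall>i\<in>{1..n}. 0 < knn_prob ({1..n} - {i}) i \<omega>"
    by (intro AE_finite_allI AE_knn_prob_full_pos n) auto
  then show ?thesis
  proof eventually_elim
    case (elim \<omega>)
    have "ln (nn_dist (\<lambda>i. Xs i \<omega>) n k i ^ DIM('a) * unit_vol TYPE('a) * (real n - 1) / exp (Digamma (real k))) = Y n i \<omega> - L n i \<omega>"
      if i: "i \<in> {1..n}" for i
    proof -
      have U: "0 < knn_prob ({1..n} - {i}) i \<omega>" using elim i by blast
      have Ue: "knn_prob ({1..n} - {i}) i \<omega> = cball_prob (Xs i \<omega>) (knn_dist n i \<omega>)" by (rule knn_prob_eq_cball_prob[OF n i])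
      have r: "0 < knn_dist n i \<omega>" using U unfolding Ue by (rule cball_prob_pos_imp)
      have nn: "nn_dist (\<lambda>i. Xs i \<omega>) n k i = knn_dist n i \<omega>"
        unfolding knn_dist_def by (rule nn_dist_eq_order_stat[OF k1 n i])
      have v: "0 < knn_dist n i \<omega> ^ DIM('a) * unit_vol TYPE('a)" using r unit_vol_pos by (intro mult_pos_pos) auto
      have n1: "0 < real n - 1" using n k1 by simp
      have "ln (knn_dist n i \<omega> ^ DIM('a) * unit_vol TYPE('a) * (real n - 1) / exp (Digamma (real k)))
        = ln (knn_dist n i \<omega> ^ DIM('a) * unit_vol TYPE('a)) + ln (real n - 1) - psi"
        using v n1 by (subst ln_divide_pos, simp, simp, subst ln_mult_pos) (simp_all add: psi_eq)
      moreover have "L n i \<omega> = ln (knn_prob ({1..n} - {i}) i \<omega>) - ln (knn_dist n i \<omega> ^ DIM('a) * unit_vol TYPE('a))"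
        unfolding L_def avg_def Ue by (rule ln_divide_pos) (use U Ue v in auto)
      moreover have "real (n - 1) = real n - 1" using n by (simp add: of_nat_diff)
      ultimately show ?thesis unfolding nn Y_def by simp
    qed
    then show ?case unfolding KL_estimator_def by (intro arg_cong2[where f="(*)"] refl sum.cong) auto
  qed
qed

lemma borel_measurable_KL_estimator:
  assumes n: "k + 1 \<le> n"
  shows "(\<lambda>\<omega>. KL_estimator (\<lambda>i. Xs i \<omega>) n k) \<in> borel_measurable M"
proof -
  have [measurable]: "(\<lambda>\<omega>. nn_dist (\<lambda>i. Xs i \<omega>) n k i) \<in> borel_measurable M" if "i \<in> {1..n}" for i
    using borel_measurable_knn_dist[OF n that] by (simp add: nn_dist_eq_order_stat[OF k1 n that] knn_dist_def[abs_def])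
  show ?thesis unfolding KL_estimator_def by measurable
qed

text \<open>The three averages vanish for different reasons: the first by domination of
  \<open>L\<close>, the second as an average of independent centred variables, the third by the
  covariance bound.\<close>

lemma KL_estimator_decomposition:
  assumes n: "k + 1 \<le> n"
  shows "AE \<omega> in M. KL_estimator (\<lambda>i. Xs i \<omega>) n k - differential_entropy p
    = - (1 / real n * (\<Sum>i=1..n. L n i \<omega> - ln (p (Xs i \<omega>))))
      + (- (1 / real n * (\<Sum>i=1..n. ln (p (Xs i \<omega>)) + differential_entropy p))
      + 1 / real n * (\<Sum>i=1..n. Y n i \<omega>))"
  using KL_estimator_eq[OF n]
proof eventually_elim
  case (elim \<omega>)
  have "real n > 0" using n by simp
  then show ?case unfolding elim by (simp add: sum.distrib sum_subtractf field_simps)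
qed

lemma borel_measurable_ln_p_Xs: "1 \<le> i \<Longrightarrow> (\<lambda>\<omega>. ln (p (Xs i \<omega>))) \<in> borel_measurable M"
  by (intro borel_measurable_ln measurable_compose[OF borel_measurable_Xs p_measurable])

lemma ln_p_Xs:
  assumes i: "1 \<le> i"
  shows "expectation (\<lambda>\<omega>. ln (p (Xs i \<omega>))) = - differential_entropy p" "integrable M (\<lambda>\<omega>. ln (p (Xs i \<omega>)))"
    and "integrable M (\<lambda>\<omega>. (ln (p (Xs i \<omega>)))\<^sup>2)"
  using integral_Xs[OF i, of "\<lambda>x. ln (p x)"] integral_Xs(2)[OF i, of "\<lambda>x. (ln (p x))\<^sup>2"]
    integrable_ln_p integrable_ln_p_squared entropy_eq by auto

theorem KL_estimator_expectation:
  assumes q: "log_moment 1 < \<infinity>"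
  shows "\<forall>n\<ge>k + 1. integrable M (\<lambda>\<omega>. KL_estimator (\<lambda>i. Xs i \<omega>) n k)"
    and "(\<lambda>n. expectation (\<lambda>\<omega>. KL_estimator (\<lambda>i. Xs i \<omega>) n k)) \<longlonglongrightarrow> differential_entropy p"
proof -
  have H1: "integrable M (\<lambda>\<omega>. (dominating \<omega>) ^ 1)" using integrable_dominating[OF q] by simp
  have iL: "integrable M (\<lambda>\<omega>. L n i \<omega> - ln (p (Xs i \<omega>)))" and bL: "\<bar>expectation (\<lambda>\<omega>. L n i \<omega> - ln (p (Xs i \<omega>)))\<bar> \<le> error 1 n"
    if n: "k + 1 \<le> n" and i: "i \<in> {1..n}" for n i
  proof -
    have i1: "1 \<le> i" using i by simp
    have "integrable M (\<lambda>\<omega>. \<bar>L n i \<omega> - ln (p (Xs i \<omega>))\<bar> ^ 1)"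
      using L_exchangeable(2)[OF n i, of 1] L_convergence(2)[OF one_neq_zero H1 n] by simp
    then have a: "integrable M (\<lambda>\<omega>. \<bar>L n i \<omega> - ln (p (Xs i \<omega>))\<bar>)" by simp
    show "integrable M (\<lambda>\<omega>. L n i \<omega> - ln (p (Xs i \<omega>)))"
      by (rule Bochner_Integration.integrable_bound[OF a]) (use borel_measurable_L[OF n i] borel_measurable_ln_p_Xs[OF i1] in auto)
    have "\<bar>expectation (\<lambda>\<omega>. L n i \<omega> - ln (p (Xs i \<omega>)))\<bar> \<le> expectation (\<lambda>\<omega>. \<bar>L n i \<omega> - ln (p (Xs i \<omega>))\<bar>)"
      by (rule integral_abs_bound)
    also have "\<dots> = error 1 n" using L_exchangeable(1)[OF n i, of 1] by simp
    finally show "\<bar>expectation (\<lambda>\<omega>. L n i \<omega> - ln (p (Xs i \<omega>)))\<bar> \<le> error 1 n" .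
  qed
  let ?y = "\<lambda>n. ln (real (n - 1)) - harm (n - 1) + euler_mascheroni :: real"
  have main: "integrable M (\<lambda>\<omega>. KL_estimator (\<lambda>i. Xs i \<omega>) n k)
      \<and> \<bar>expectation (\<lambda>\<omega>. KL_estimator (\<lambda>i. Xs i \<omega>) n k) - differential_entropy p\<bar> \<le> error 1 n + \<bar>?y n\<bar>"
    if n: "k + 1 \<le> n" for n
  proof -
    have gen1: "(\<Sum>i=1..n. z - f i) = real n * z - (\<Sum>i=1..n. f i)" for z :: real and f by (simp add: sum_subtractf)
    have gen2: "1 / real n * (real n * z - S) = z - 1 / real n * S" for z S :: real using n by (simp add: right_diff_distrib)
    \<comment> \<open>ln p is subtracted and added because integrability is known for
      \<open>L\<close> - ln p, for ln p and for \<open>Y\<close>.\<close>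
    let ?F = "\<lambda>\<omega>. 1 / real n * (\<Sum>i=1..n. (Y n i \<omega> - ln (p (Xs i \<omega>))) - (L n i \<omega> - ln (p (Xs i \<omega>))))"
    have i: "integrable M (\<lambda>\<omega>. (Y n i \<omega> - ln (p (Xs i \<omega>))) - (L n i \<omega> - ln (p (Xs i \<omega>))))" if "i \<in> {1..n}" for i
      using that by (intro Bochner_Integration.integrable_diff integrable_Y[OF n] ln_p_Xs iL n) auto
    have iF: "integrable M ?F" by (intro integrable_mult_right Bochner_Integration.integrable_sum i)
    have ae: "AE \<omega> in M. ?F \<omega> = KL_estimator (\<lambda>i. Xs i \<omega>) n k"
      using KL_estimator_eq[OF n] by eventually_elim simp
    have iK: "integrable M (\<lambda>\<omega>. KL_estimator (\<lambda>i. Xs i \<omega>) n k)"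
      by (rule integrable_cong_AE_imp[OF iF borel_measurable_KL_estimator[OF n] ae])
    have "expectation (\<lambda>\<omega>. KL_estimator (\<lambda>i. Xs i \<omega>) n k) = expectation ?F"
      by (rule integral_cong_AE[symmetric]) (use iF borel_measurable_KL_estimator[OF n] ae in auto)
    also have "\<dots> = 1 / real n * (\<Sum>i=1..n. expectation (\<lambda>\<omega>. (Y n i \<omega> - ln (p (Xs i \<omega>))) - (L n i \<omega> - ln (p (Xs i \<omega>)))))"
      by (subst integral_mult_right_zero, subst Bochner_Integration.integral_sum[OF i]) auto
    also have "(\<Sum>i=1..n. expectation (\<lambda>\<omega>. (Y n i \<omega> - ln (p (Xs i \<omega>))) - (L n i \<omega> - ln (p (Xs i \<omega>)))))
       = (\<Sum>i=1..n. (?y n + differential_entropy p) - expectation (\<lambda>\<omega>. L n i \<omega> - ln (p (Xs i \<omega>))))"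
    proof (intro sum.cong refl)
      fix i assume i: "i \<in> {1..n}"
      then have i1: "1 \<le> i" by simp
      have "expectation (\<lambda>\<omega>. Y n i \<omega> - ln (p (Xs i \<omega>))) = ?y n + differential_entropy p"
        unfolding Bochner_Integration.integral_diff[OF integrable_Y[OF n i] ln_p_Xs(2)[OF i1]]
          expectation_Y[OF n i] ln_p_Xs(1)[OF i1] by (rule diff_minus_eq_add)
      then show "expectation (\<lambda>\<omega>. (Y n i \<omega> - ln (p (Xs i \<omega>))) - (L n i \<omega> - ln (p (Xs i \<omega>)))) = (?y n + differential_entropy p) - expectation (\<lambda>\<omega>. L n i \<omega> - ln (p (Xs i \<omega>)))"
        by (subst Bochner_Integration.integral_diff[OF Bochner_Integration.integrable_diff[OF integrable_Y[OF n i] ln_p_Xs(2)[OF i1]] iL[OF n i]]) simp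
    qed
    also have "\<dots> = real n * (?y n + differential_entropy p) - (\<Sum>i=1..n. expectation (\<lambda>\<omega>. L n i \<omega> - ln (p (Xs i \<omega>))))"
      by (rule gen1)
    also have "1 / real n * (real n * (?y n + differential_entropy p) - (\<Sum>i=1..n. expectation (\<lambda>\<omega>. L n i \<omega> - ln (p (Xs i \<omega>)))))
        = ?y n + differential_entropy p - 1 / real n * (\<Sum>i=1..n. expectation (\<lambda>\<omega>. L n i \<omega> - ln (p (Xs i \<omega>))))"
      by (rule gen2)
    finally have EK: "expectation (\<lambda>\<omega>. KL_estimator (\<lambda>i. Xs i \<omega>) n k) = ?y n + differential_entropy p - 1 / real n * (\<Sum>i=1..n. expectation (\<lambda>\<omega>. L n i \<omega> - ln (p (Xs i \<omega>))))" .
    have "\<bar>1 / real n * (\<Sum>i=1..n. expectation (\<lambda>\<omega>. L n i \<omega> - ln (p (Xs i \<omega>))))\<bar> \<le> error 1 n"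
    proof -
      have "\<bar>\<Sum>i=1..n. expectation (\<lambda>\<omega>. L n i \<omega> - ln (p (Xs i \<omega>)))\<bar> \<le> (\<Sum>i=1..n. error 1 n)"
        by (intro order_trans[OF sum_abs] sum_mono bL n)
      then have "\<bar>\<Sum>i=1..n. expectation (\<lambda>\<omega>. L n i \<omega> - ln (p (Xs i \<omega>)))\<bar> \<le> error 1 n * real n" by (simp add: mult.commute)
      then show ?thesis using n by (simp add: abs_mult pos_divide_le_eq)
    qed
    then have "\<bar>expectation (\<lambda>\<omega>. KL_estimator (\<lambda>i. Xs i \<omega>) n k) - differential_entropy p\<bar> \<le> error 1 n + \<bar>?y n\<bar>"
      unfolding EK by linarith
    with iK show ?thesis by (rule conjI)
  qed
  then show "\<forall>n\<ge>k + 1. integrable M (\<lambda>\<omega>. KL_estimator (\<lambda>i. Xs i \<omega>) n k)" by blast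
  have "(\<lambda>n. error 1 n + \<bar>?y n\<bar>) \<longlonglongrightarrow> 0 + \<bar>- euler_mascheroni + euler_mascheroni\<bar>"
    by (intro tendsto_intros L_convergence(1) H1 ln_minus_harm_tendsto) simp
  then have "(\<lambda>n. error 1 n + \<bar>?y n\<bar>) \<longlonglongrightarrow> 0" by simp
  then have "(\<lambda>n. expectation (\<lambda>\<omega>. KL_estimator (\<lambda>i. Xs i \<omega>) n k) - differential_entropy p) \<longlonglongrightarrow> 0"
    by (rule Lim_null_comparison[rotated]) (use main in \<open>auto intro!: eventually_mono[OF eventually_ge_at_top[of "k + 1"]]\<close>)
  then show "(\<lambda>n. expectation (\<lambda>\<omega>. KL_estimator (\<lambda>i. Xs i \<omega>) n k)) \<longlonglongrightarrow> differential_entropy p"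
    by (simp add: LIM_zero_iff)
qed

text \<open>The square of a sum of three terms is at most three times the sum of the squares, so the
  three averages of \<open>KL_estimator_decomposition\<close> are treated separately.\<close>

theorem KL_estimator_mean_square:
  assumes q: "log_moment 2 < \<infinity>"
  shows "\<forall>n\<ge>k + 1. integrable M (\<lambda>\<omega>. (KL_estimator (\<lambda>i. Xs i \<omega>) n k - differential_entropy p)\<^sup>2)"
    and "(\<lambda>n. expectation (\<lambda>\<omega>. (KL_estimator (\<lambda>i. Xs i \<omega>) n k - differential_entropy p)\<^sup>2)) \<longlonglongrightarrow> 0"
proof -
  have H2: "integrable M (\<lambda>\<omega>. (dominating \<omega>) ^ 2)" using integrable_dominating_squared[OF q] .
  let ?h = "differential_entropy p"
  let ?D = "\<lambda>n i \<omega>. L n i \<omega> - ln (p (Xs i \<omega>))"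
  let ?E = "\<lambda>i \<omega>. ln (p (Xs i \<omega>)) + ?h"
  let ?a = "\<lambda>n \<omega>. 1 / real n * (\<Sum>i=1..n. ?D n i \<omega>)"
  let ?b = "\<lambda>n \<omega>. 1 / real n * (\<Sum>i=1..n. ?E i \<omega>)"
  let ?c = "\<lambda>n \<omega>. 1 / real n * (\<Sum>i=1..n. Y n i \<omega>)"
  define v where "v = expectation (\<lambda>\<omega>. (?E 1 \<omega>)\<^sup>2)"
  have Dm: "?D n i \<in> borel_measurable M" if "k + 1 \<le> n" "i \<in> {1..n}" for n i
    using borel_measurable_L[OF that] borel_measurable_ln_p_Xs[of i] that by auto
  have D2: "integrable M (\<lambda>\<omega>. (?D n i \<omega>)\<^sup>2)" and ED: "expectation (\<lambda>\<omega>. (?D n i \<omega>)\<^sup>2) = error 2 n"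
    if n: "k + 1 \<le> n" and i: "i \<in> {1..n}" for n i
    using L_exchangeable[OF n i, of 2] L_convergence(2)[OF _ H2 n] by auto
  have Em: "?E i \<in> borel_measurable M" if "1 \<le> i" for i
    using borel_measurable_ln_p_Xs[OF that] by auto
  have E2: "integrable M (\<lambda>\<omega>. (?E i \<omega>)\<^sup>2)" if "1 \<le> i" for i
    by (rule integrable_square_add) (use ln_p_Xs(3)[OF that] borel_measurable_ln_p_Xs[OF that] in auto)
  have EE: "expectation (\<lambda>\<omega>. (?E i \<omega>)\<^sup>2) = v" if "1 \<le> i" for i
    using integral_Xs(1)[OF that, of "\<lambda>x. (ln (p x) + ?h)\<^sup>2"] integral_Xs(1)[of 1 "\<lambda>x. (ln (p x) + ?h)\<^sup>2"] by (simp add: v_def)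
  have cross: "expectation (\<lambda>\<omega>. ?E i \<omega> * ?E l \<omega>) = 0" if i: "1 \<le> i" and l: "1 \<le> l" and il: "i \<noteq> l" for i l
  proof -
    have "indep_vars (\<lambda>_. borel) Xs {i, l}" by (rule indep_vars_subset[OF indep]) (use i l in auto)
    then have iv: "indep_vars (\<lambda>_. borel) (\<lambda>i \<omega>. ?E i \<omega>) {i, l}"
      by (rule indep_vars_compose2[where Y="\<lambda>_ x. ln (p x) + ?h"]) measurable
    have z: "expectation (?E i) = 0" if "1 \<le> i" for i
      using ln_p_Xs[OF that] by (simp add: prob_space)
    have "expectation (\<lambda>\<omega>. \<Prod>j\<in>{i, l}. ?E j \<omega>) = (\<Prod>j\<in>{i, l}. expectation (?E j))"
      by (rule indep_vars_lebesgue_integral[OF _ iv]) (use ln_p_Xs(2) i l in auto)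
    also have "\<dots> = 0" using z[OF i] il by simp
    finally show ?thesis using il by simp
  qed
  have err0: "0 \<le> error 2 n" for n unfolding error_def by simp
  have ia: "integrable M (\<lambda>\<omega>. (?a n \<omega>)\<^sup>2)" and ea: "expectation (\<lambda>\<omega>. (?a n \<omega>)\<^sup>2) \<le> error 2 n / real n + error 2 n"
    if n: "k + 1 \<le> n" for n
  proof -
    show "integrable M (\<lambda>\<omega>. (?a n \<omega>)\<^sup>2)" by (rule integrable_average_squared[OF Dm[OF n] D2[OF n]])
    show "expectation (\<lambda>\<omega>. (?a n \<omega>)\<^sup>2) \<le> error 2 n / real n + error 2 n"
    proof (rule expectation_average_squared_le[OF Dm[OF n] D2[OF n]])
      fix i l assume il: "i \<in> {1..n}" "l \<in> {1..n}"
      \<comment> \<open>The variables \<open>?D n i\<close> are dependent, but each has second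
        moment \<open>error 2 n\<close>, which already tends to 0, so the crude bound of a product
        by squares is enough.\<close>
      have "expectation (\<lambda>\<omega>. ?D n i \<omega> * ?D n l \<omega>) \<le> expectation (\<lambda>\<omega>. ((?D n i \<omega>)\<^sup>2 + (?D n l \<omega>)\<^sup>2) / 2)"
        by (rule integral_mono[OF integrable_mult_of_squares[OF Dm[OF n il(1)] Dm[OF n il(2)] D2[OF n il(1)] D2[OF n il(2)]]])
           (use D2[OF n il(1)] D2[OF n il(2)] mult_le_half_squares in auto)
      also have "\<dots> = (error 2 n + error 2 n) / 2"
        using D2[OF n il(1)] D2[OF n il(2)] ED[OF n il(1)] ED[OF n il(2)] by simp
      finally show "expectation (\<lambda>\<omega>. ?D n i \<omega> * ?D n l \<omega>) \<le> error 2 n" by simp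
    qed (use n ED[OF n] err0 in auto)
  qed
  have ib: "integrable M (\<lambda>\<omega>. (?b n \<omega>)\<^sup>2)" for n
    by (rule integrable_average_squared) (use Em E2 in auto)
  have eb: "expectation (\<lambda>\<omega>. (?b n \<omega>)\<^sup>2) \<le> v / real n + 0" if n: "k + 1 \<le> n" for n
  proof (rule expectation_average_squared_le)
    fix i l assume "i \<in> {1..n}" "l \<in> {1..n}" "i \<noteq> l"
    then show "expectation (\<lambda>\<omega>. ?E i \<omega> * ?E l \<omega>) \<le> 0" using cross[of i l] by simp
  next
    fix i assume "i \<in> {1..n}"
    then have "1 \<le> i" by simp
    then show "?E i \<in> borel_measurable M" "integrable M (\<lambda>\<omega>. (?E i \<omega>)\<^sup>2)" "expectation (\<lambda>\<omega>. (?E i \<omega>)\<^sup>2) \<le> v"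
      using Em[of i] E2[of i] EE[of i] by blast+
  qed (use n in auto)
  let ?K = "\<lambda>n \<omega>. KL_estimator (\<lambda>i. Xs i \<omega>) n k - ?h"
  have main: "integrable M (\<lambda>\<omega>. (?K n \<omega>)\<^sup>2) \<and> expectation (\<lambda>\<omega>. (?K n \<omega>)\<^sup>2)
      \<le> 3 * ((error 2 n / real n + error 2 n) + v / real n + expectation (\<lambda>\<omega>. (?c n \<omega>)\<^sup>2))"
    if n: "k + 1 \<le> n" for n
  proof -
    have ic: "integrable M (\<lambda>\<omega>. (?c n \<omega>)\<^sup>2)" by (rule Y_average_squared[OF n])
    have three: "(x + y + z)\<^sup>2 \<le> 3 * (x\<^sup>2 + y\<^sup>2 + z\<^sup>2)" for x y z :: real
    proof -
      have "0 \<le> (x - y)\<^sup>2 + (y - z)\<^sup>2 + (x - z)\<^sup>2" by simp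
      then show ?thesis by (simp add: power2_eq_square algebra_simps)
    qed
    have ae: "AE \<omega> in M. (?K n \<omega>)\<^sup>2 \<le> 3 * ((?a n \<omega>)\<^sup>2 + (?b n \<omega>)\<^sup>2 + (?c n \<omega>)\<^sup>2)"
      using KL_estimator_decomposition[OF n]
    proof eventually_elim
      case (elim \<omega>)
      show ?case unfolding elim using three[of "- ?a n \<omega>" "- ?b n \<omega>" "?c n \<omega>"] by (simp only: power2_minus add.assoc)
    qed
    have i3: "integrable M (\<lambda>\<omega>. 3 * ((?a n \<omega>)\<^sup>2 + (?b n \<omega>)\<^sup>2 + (?c n \<omega>)\<^sup>2))"
      by (intro integrable_mult_right Bochner_Integration.integrable_add ia[OF n] ib ic)
    have Km: "(\<lambda>\<omega>. (?K n \<omega>)\<^sup>2) \<in> borel_measurable M"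
      using borel_measurable_KL_estimator[OF n] by measurable
    have iK: "integrable M (\<lambda>\<omega>. (?K n \<omega>)\<^sup>2)"
    proof (rule Bochner_Integration.integrable_bound[OF i3 Km])
      show "AE \<omega> in M. norm ((?K n \<omega>)\<^sup>2) \<le> norm (3 * ((?a n \<omega>)\<^sup>2 + (?b n \<omega>)\<^sup>2 + (?c n \<omega>)\<^sup>2))"
        using ae unfolding real_norm_def abs_power2 by eventually_elim (erule order_trans, rule abs_ge_self)
    qed
    have "expectation (\<lambda>\<omega>. (?K n \<omega>)\<^sup>2) \<le> expectation (\<lambda>\<omega>. 3 * ((?a n \<omega>)\<^sup>2 + (?b n \<omega>)\<^sup>2 + (?c n \<omega>)\<^sup>2))"
      by (rule integral_mono_AE[OF iK i3 ae])
    also have "\<dots> = 3 * (expectation (\<lambda>\<omega>. (?a n \<omega>)\<^sup>2) + expectation (\<lambda>\<omega>. (?b n \<omega>)\<^sup>2) + expectation (\<lambda>\<omega>. (?c n \<omega>)\<^sup>2))"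
      by (subst integral_mult_right_zero, subst Bochner_Integration.integral_add[OF Bochner_Integration.integrable_add[OF ia[OF n] ib] ic],
          subst Bochner_Integration.integral_add[OF ia[OF n] ib]) (rule refl)
    also have "\<dots> \<le> 3 * ((error 2 n / real n + error 2 n) + v / real n + expectation (\<lambda>\<omega>. (?c n \<omega>)\<^sup>2))"
      using ea[OF n] eb[OF n] by simp
    finally show ?thesis using iK by blast
  qed
  then show "\<forall>n\<ge>k + 1. integrable M (\<lambda>\<omega>. (?K n \<omega>)\<^sup>2)" by blast
  have e: "error 2 \<longlonglongrightarrow> 0" by (rule L_convergence(1)[OF _ H2]) simp
  have inv: "(\<lambda>n. v / real n) \<longlonglongrightarrow> 0"
    by (intro tendsto_divide_0[OF tendsto_const] filterlim_at_top_imp_at_infinity filterlim_real_sequentially)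
  have en: "(\<lambda>n. error 2 n / real n) \<longlonglongrightarrow> 0"
    by (intro tendsto_divide_0[OF e] filterlim_at_top_imp_at_infinity filterlim_real_sequentially)
  have "(\<lambda>n. 3 * ((error 2 n / real n + error 2 n) + v / real n + expectation (\<lambda>\<omega>. (?c n \<omega>)\<^sup>2))) \<longlonglongrightarrow> 3 * ((0 + 0) + 0 + 0)"
    by (intro tendsto_intros e inv en Y_average_tendsto_0)
  then have lim: "(\<lambda>n. 3 * ((error 2 n / real n + error 2 n) + v / real n + expectation (\<lambda>\<omega>. (?c n \<omega>)\<^sup>2))) \<longlonglongrightarrow> 0" by simp
  show "(\<lambda>n. expectation (\<lambda>\<omega>. (?K n \<omega>)\<^sup>2)) \<longlonglongrightarrow> 0"
  proof (rule tendsto_sandwich[OF _ _ tendsto_const lim])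
    show "eventually (\<lambda>n. 0 \<le> expectation (\<lambda>\<omega>. (?K n \<omega>)\<^sup>2)) sequentially"
      by (intro always_eventually allI integral_nonneg_AE AE_I2) simp
    show "eventually (\<lambda>n. expectation (\<lambda>\<omega>. (?K n \<omega>)\<^sup>2) \<le> 3 * ((error 2 n / real n + error 2 n) + v / real n + expectation (\<lambda>\<omega>. (?c n \<omega>)\<^sup>2))) sequentially"
      by (rule eventually_mono[OF eventually_ge_at_top[of "k + 1"]]) (use main in blast)
  qed
qed

end

text \<open>The integral of a function that is not integrable is 0 by convention. The integrability
  claims make sure that the entropy, the mean and the mean square are genuine expectations.\<close>

theorem corollary6:
  fixes M :: "'w measure"
    and X :: "'w \<Rightarrow> 'a::euclidean_space"
    and Xs :: "nat \<Rightarrow> 'w \<Rightarrow> 'a"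
    and p :: "'a \<Rightarrow> real"
    and \<epsilon> R :: real
    and k :: nat
  assumes "prob_space M"
    and "\<And>x. 0 \<le> p x"
    and "distributed M lborel X (\<lambda>x. ennreal (p x))"
    and "prob_space.indep_vars M (\<lambda>_. borel) Xs {1..}"
    and "\<And>i. 1 \<le> i \<Longrightarrow> distr M borel (Xs i) = distr M borel X"
    and "0 < \<epsilon>" and "0 < R"
    and "Q_fun p \<epsilon> R < \<infinity>"
    and "T_fun p \<epsilon> R < \<infinity>"
    and "1 \<le> k"
  shows "integrable lborel (\<lambda>x. p x * ln (p x))
    \<and> ((\<exists>N\<ge>1. K_fun p 1 N < \<infinity>) \<or> (\<exists>\<nu>>1. L_fun p \<nu> < \<infinity>) \<longrightarrow>
         (\<forall>n\<ge>k + 1. integrable M (\<lambda>\<omega>. KL_estimator (\<lambda>i. Xs i \<omega>) n k))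
       \<and> (\<lambda>n. LINT \<omega>|M. KL_estimator (\<lambda>i. Xs i \<omega>) n k) \<longlonglongrightarrow> differential_entropy p)
    \<and> ((\<exists>N\<ge>1. K_fun p 2 N < \<infinity>) \<or> (\<exists>\<nu>>2. L_fun p \<nu> < \<infinity>) \<longrightarrow>
         (\<forall>n\<ge>k + 1. integrable M (\<lambda>\<omega>. (KL_estimator (\<lambda>i. Xs i \<omega>) n k - differential_entropy p)\<^sup>2))
       \<and> (\<lambda>n. LINT \<omega>|M. (KL_estimator (\<lambda>i. Xs i \<omega>) n k - differential_entropy p)\<^sup>2) \<longlonglongrightarrow> 0)"
proof -
  note ps = assms(1) and p0 = assms(2) and X = assms(3)
  interpret prob_space M by (rule ps)
  have p_meas: "p \<in> borel_measurable borel"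
  proof -
    have "(\<lambda>x. enn2real (ennreal (p x))) \<in> borel_measurable borel"
      using distributed_borel_measurable[OF X] by measurable
    then show ?thesis using p0 by simp
  qed
  have dX: "distr M borel X = density lborel (\<lambda>x. ennreal (p x))"
    unfolding distributed_distr_eq_density[OF X, symmetric] by (intro distr_cong) auto
  have mX: "X \<in> borel_measurable M" using distributed_measurable[OF X] by simp
  have pd: "probability_density p"
  proof (rule probability_density.intro)
    show "prob_space (density lborel (\<lambda>x. ennreal (p x)))"
      unfolding dX[symmetric] by (rule prob_space_distr[OF mX])
  qed (fact p0 p_meas)+
  have kl: "kl_sample M p Xs k"
  proof (intro kl_sample.intro kl_sample_axioms.intro ps pd)
    show "distr M borel (Xs i) = density lborel (\<lambda>x. ennreal (p x))" if "1 \<le> i" for i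
      using assms(5)[OF that] dX by simp
  qed (fact assms)+
  interpret kl_setting M p Xs k \<epsilon> R
    by (intro kl_setting.intro kl_density.intro kl_density_axioms.intro kl pd) (fact assms)+
  have one: "log_moment 1 < \<infinity>" if "(\<exists>N\<ge>1. K_fun p 1 N < \<infinity>) \<or> (\<exists>\<nu>>1. L_fun p \<nu> < \<infinity>)"
    using that log_moment_K_fun[of _ 1] log_moment_L_fun[of 1] by auto
  have two: "log_moment 2 < \<infinity>" if "(\<exists>N\<ge>1. K_fun p 2 N < \<infinity>) \<or> (\<exists>\<nu>>2. L_fun p \<nu> < \<infinity>)"
    using that log_moment_K_fun[of _ 2] log_moment_L_fun[of 2] by auto
  show ?thesis
    using integrable_p_ln_p KL_estimator_expectation[OF one] KL_estimator_mean_square[OF two] by blast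
qed

end
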